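(* Let $H\cong U_3(2){:}2$ be a maximal subgroup of $M_{11}$ and let $A_{24}$ be the subalgebra of $A_{286}$ generated by the $21$ axes corresponding to the involutions of $H$. Then $A_{24}$ has dimension $24$ and its full automorphism group is $\mathrm{Aut}(A_{24})=H\cong U_3(2){:}2$.
   Context: All algebras are commutative, not necessarily associative, over $\mathbb{Q}$. For an algebra $B$, $a\in B$ and a scalar $\lambda$, put $B_\lambda(a)=\{u\in B: au=\lambda u\}$. A nonzero idempotent $a\in B$ is a primitive axis with Monster fusion law $\mathcal{M}(\frac14,\frac1{32})$ if $B=B_1(a)\oplus B_0(a)\oplus B_{1/4}(a)\oplus B_{1/32}(a)$, $B_1(a)=\mathbb{Q}a$, and $B_\lambda(a)B_\mu(a)\subseteq\bigoplus_{\nu\in\lambda\ast\mu}B_\nu(a)$, where $\ast$ is symmetric with $1\ast1=\{1\}$, $1\ast0=\emptyset$, $0\ast0=\{0\}$, $1\ast\frac14=0\ast\frac14=\{\frac14\}$, $1\ast\frac1{32}=0\ast\frac1{32}=\frac14\ast\frac1{32}=\{\frac1{32}\}$, $\frac14\ast\frac14=\{1,0\}$, $\frac1{32}\ast\frac1{32}=\{1,0,\frac14\}$. The Miyamoto involution $\tau_a\in\mathrm{Aut}(B)$ acts as $-1$ on $B_{1/32}(a)$ and as $1$ on the other eigenspaces. $A_{286}$ is the algebra (constructed by Seress) of dimension $286$ generated by a set $X$ of $165$ primitive axes with fusion law $\mathcal{M}(\frac14,\frac1{32})$ such that the Miyamoto group $\langle\tau_a: a\in X\rangle$ is isomorphic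 to the Mathieu group $M_{11}$, $X$ is invariant under it, and $a\mapsto\tau_a$ is a bijection from $X$ onto the set of all $165$ involutions of $M_{11}$. It carries a positive definite symmetric bilinear Frobenius form ($(uv,w)=(u,vw)$ for all $u,v,w$) with $(a,a)=1$ for $a\in X$; for distinct $a,b\in X$ with $|\tau_a\tau_b|=2,3,4,5,6$ the value $(a,b)$ is $\frac18,\frac{13}{256},\frac1{64},\frac3{128},\frac5{256}$ respectively (the subalgebra generated by $a,b$ is the Norton–Sakuma algebra of type 2A, 3A, 4B, 5A, 6A respectively). The maximal subgroup $H\cong U_3(2){:}2$ of $M_{11}$ has order $144$ and contains $21=9+12$ involutions, which generate a subgroup $H_0\cong S_3\wr 2$ of index $2$ in $H$. An axis $a\in X$ corresponds to the involution $\tau_a$. The group $H$ acts on $A_{24}$ by restriction of its action on $A_{286}$. *)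

theory Defs
  imports
    "HOL-Analysis.Determinants"
    "HOL-Library.Z2"
    "HOL-Algebra.Bij"
    "HOL-Algebra.Coset"
    "HOL-Algebra.Multiplicative_Group"
    "HOL-Algebra.Sym_Groups"
begin

section \<open>The groups $M_{11}$ and $U_3(2){:}2$\<close>

definition maximal_subgroup :: "'g set \<Rightarrow> ('g, 'm) monoid_scheme \<Rightarrow> bool" where
  "maximal_subgroup H G \<longleftrightarrow> subgroup H G \<and> H \<noteq> carrier G \<and>
     (\<forall>K. subgroup K G \<and> H \<subseteq> K \<longrightarrow> K = H \<or> K = carrier G)"

text \<open>The usual generating permutations of $M_{11}$ in its action on 11 points:
  $(1\,2\,3\,4\,5\,6\,7\,8\,9\,10\,11)$ and $(3\,7\,11\,8)(4\,10\,5\,6)$.\<close>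

definition M11 :: "(nat \<Rightarrow> nat) monoid" where
  "M11 = (sym_group 11)\<lparr>carrier := generate (sym_group 11)
     {cycle_of_list [1, 2, 3, 4, 5, 6, 7, 8, 9, 10, 11],
      cycle_of_list [3, 7, 11, 8] \<circ> cycle_of_list [4, 10, 5, 6]}\<rparr>"

text \<open>The field with four elements; \<open>GF4 a b\<close> is $a + b\omega$ with $\omega^2 = \omega + 1$.\<close>

datatype gf4 = GF4 bit bit

instantiation gf4 :: field
begin

definition "0 = GF4 0 0"
definition "1 = GF4 1 0"

fun plus_gf4 :: "gf4 \<Rightarrow> gf4 \<Rightarrow> gf4" where
  "GF4 a b + GF4 c d = GF4 (a + c) (b + d)"

fun times_gf4 :: "gf4 \<Rightarrow> gf4 \<Rightarrow> gf4" where
  "GF4 a b * GF4 c d = GF4 (a * c + b * d) (a * d + b * c + b * d)"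

definition "- (x :: gf4) = x"
definition "x - (y :: gf4) = x + y"
definition "inverse (x :: gf4) = x * x"
definition "x div (y :: gf4) = x * inverse y"

instance
proof
  fix a b c :: gf4
  obtain a1 a2 b1 b2 c1 c2
    where abc [simp]: "a = GF4 a1 a2" "b = GF4 b1 b2" "c = GF4 c1 c2"
    by (metis gf4.exhaust)
  show "a + b + c = a + (b + c)" "a + b = b + a" "a * b = b * a" "a * b * c = a * (b * c)"
    "(a + b) * c = a * c + b * c"
    by (cases a1; cases a2; cases b1; cases b2; cases c1; cases c2; simp)+
  show "0 + a = a" "1 * a = a" "- a + a = 0"
    by (simp_all add: zero_gf4_def one_gf4_def uminus_gf4_def)
  show "a - b = a + - b"
    by (simp add: minus_gf4_def uminus_gf4_def del: abc)
  show "(0::gf4) \<noteq> 1"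
    by (simp add: zero_gf4_def one_gf4_def)
  show "a \<noteq> 0 \<Longrightarrow> inverse a * a = 1"
    by (cases a1; cases a2; simp add: zero_gf4_def one_gf4_def inverse_gf4_def)
  show "inverse (0::gf4) = 0"
    by (simp add: zero_gf4_def inverse_gf4_def)
  show "a div b = a * inverse b"
    by (simp add: divide_gf4_def del: abc)
qed

end

text \<open>$SU_3(2)$ for the standard Hermitian form on $\mathbb{F}_4^3$; the involutory
  field automorphism is $x \mapsto x^2$.\<close>

definition SU3_2 :: "(gf4 ^ 3 ^ 3) set" where
  "SU3_2 = {A. A ** transpose (\<chi> i j. (A $ i $ j)\<^sup>2) = mat 1 \<and> det A = 1}"

text \<open>$SU_3(2)$ extended by the field automorphism, as a group of semilinear maps
  on $\mathbb{F}_4^3$, and its quotient $U_3(2){:}2$ by the scalars; all three nonzero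
  scalars lie in $SU_3(2)$.\<close>

definition SigmaU3_2 :: "(gf4 ^ 3 \<Rightarrow> gf4 ^ 3) monoid" where
  "SigmaU3_2 =
     \<lparr>carrier = {\<lambda>v. A *v v | A. A \<in> SU3_2}
               \<union> {\<lambda>v. A *v (\<chi> i. (v $ i)\<^sup>2) | A. A \<in> SU3_2},
      mult = (\<circ>), one = id\<rparr>"

definition U3_2_ext2 :: "(gf4 ^ 3 \<Rightarrow> gf4 ^ 3) set monoid" where
  "U3_2_ext2 = SigmaU3_2 Mod {\<lambda>v. c *s v | c. c \<noteq> 0}"


section \<open>Axial algebras of Monster type $(\frac14,\frac1{32})$\<close>

definition monster_fusion :: "rat \<Rightarrow> rat \<Rightarrow> rat set" where
  "monster_fusion l m =
    (if {l, m} = {1} then {1}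
     else if {l, m} = {1, 0} then {}
     else if {l, m} = {0} then {0}
     else if {l, m} = {1, 1/4} \<or> {l, m} = {0, 1/4} then {1/4}
     else if {l, m} = {1, 1/32} \<or> {l, m} = {0, 1/32} \<or> {l, m} = {1/4, 1/32} then {1/32}
     else if {l, m} = {1/4} then {1, 0}
     else if {l, m} = {1/32} then {1, 0, 1/4}
     else {})"

text \<open>The whole type \<open>'v\<close> is the underlying space of the algebra.\<close>

locale comm_algebra = vector_space scale
  for scale :: "rat \<Rightarrow> 'v::ab_group_add \<Rightarrow> 'v" (infixr \<open>*\<^sub>Q\<close> 75) +
  fixes mul :: "'v \<Rightarrow> 'v \<Rightarrow> 'v" (infixl \<open>\<diamondop>\<close> 72)
  assumes mul_commute: "x \<diamondop> y = y \<diamondop> x"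
    and mul_add_left: "(x + y) \<diamondop> z = x \<diamondop> z + y \<diamondop> z"
    and mul_scale_left: "(c *\<^sub>Q x) \<diamondop> y = c *\<^sub>Q (x \<diamondop> y)"
begin

definition subalgebra :: "'v set \<Rightarrow> bool" where
  "subalgebra S \<longleftrightarrow> subspace S \<and> (\<forall>x\<in>S. \<forall>y\<in>S. x \<diamondop> y \<in> S)"

definition gen_subalgebra :: "'v set \<Rightarrow> 'v set" where
  "gen_subalgebra Y = \<Inter>{S. subalgebra S \<and> Y \<subseteq> S}"

text \<open>The automorphism group of the algebra carried by a subalgebra \<open>S\<close>. As in
  \<^const>\<open>BijGroup\<close>, automorphisms are maps that are \<open>undefined\<close> outside \<open>S\<close>.\<close>

definition aut_group :: "'v set \<Rightarrow> ('v \<Rightarrow> 'v) monoid" where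
  "aut_group S = (BijGroup S)\<lparr>carrier := {f \<in> Bij S.
     (\<forall>x\<in>S. \<forall>y\<in>S. f (x + y) = f x + f y) \<and>
     (\<forall>c. \<forall>x\<in>S. f (c *\<^sub>Q x) = c *\<^sub>Q f x) \<and>
     (\<forall>x\<in>S. \<forall>y\<in>S. f (x \<diamondop> y) = f x \<diamondop> f y)}\<rparr>"

definition eigenspace :: "'v \<Rightarrow> rat \<Rightarrow> 'v set" where
  "eigenspace a l = {u. a \<diamondop> u = l *\<^sub>Q u}"

text \<open>Eigenspaces for distinct eigenvalues are independent, so these sums are direct.\<close>

definition eigen_sum :: "'v \<Rightarrow> rat set \<Rightarrow> 'v set" where
  "eigen_sum a N = span (\<Union>l\<in>N. eigenspace a l)"

definition primitive_axis :: "'v \<Rightarrow> bool" where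
  "primitive_axis a \<longleftrightarrow>
     a \<noteq> 0 \<and> a \<diamondop> a = a \<and>
     eigen_sum a {1, 0, 1/4, 1/32} = UNIV \<and>
     eigenspace a 1 = span {a} \<and>
     (\<forall>l\<in>{1, 0, 1/4, 1/32}. \<forall>m\<in>{1, 0, 1/4, 1/32}.
        \<forall>u\<in>eigenspace a l. \<forall>v\<in>eigenspace a m.
          u \<diamondop> v \<in> eigen_sum a (monster_fusion l m))"

definition miyamoto :: "'v \<Rightarrow> 'v \<Rightarrow> 'v" where
  "miyamoto a = (THE f. Vector_Spaces.linear scale scale f \<and>
     (\<forall>u\<in>eigenspace a (1/32). f u = - u) \<and>
     (\<forall>l\<in>{1, 0, 1/4}. \<forall>u\<in>eigenspace a l. f u = u))"

definition miyamoto_group :: "'v set \<Rightarrow> ('v \<Rightarrow> 'v) monoid" where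
  "miyamoto_group X =
     (aut_group UNIV)\<lparr>carrier := generate (aut_group UNIV) (miyamoto ` X)\<rparr>"

definition basis_of_gen :: "'v list \<Rightarrow> 'v \<Rightarrow> 'v \<Rightarrow> bool" where
  "basis_of_gen bs a b \<longleftrightarrow>
     distinct bs \<and> \<not> dependent (set bs) \<and> span (set bs) = gen_subalgebra {a, b}"

text \<open>The Norton--Sakuma algebras generated by \<open>a\<close> and \<open>b\<close>, by their multiplication tables
  (Ivanov, Pasechnik, Seress, Shpectorov, \<open>Majorana representations of the symmetric
  group of degree 4\<close>). Here \<open>e i\<close> is the axis $a_i$, with $a_0 = a$,
  $a_1 = b$ and indices read modulo \<open>n\<close> in type \<open>nX\<close>; \<open>r\<close> is
  $a_\rho$, $a_{\rho^2}$, $a_{\rho^3}$ in types 2A, 4B, 6A, and \<open>u\<close>, \<open>w\<close>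
  are the 3A- and 5A-axes.\<close>

definition norton_sakuma_2A :: "'v \<Rightarrow> 'v \<Rightarrow> 'v \<Rightarrow> bool" where
  "norton_sakuma_2A a b r \<longleftrightarrow>
     basis_of_gen [a, b, r] a b \<and>
     a \<diamondop> a = a \<and> b \<diamondop> b = b \<and> r \<diamondop> r = r \<and>
     a \<diamondop> b = (1/8) *\<^sub>Q (a + b - r) \<and>
     a \<diamondop> r = (1/8) *\<^sub>Q (a + r - b) \<and>
     b \<diamondop> r = (1/8) *\<^sub>Q (b + r - a)"

definition norton_sakuma_3A :: "'v \<Rightarrow> 'v \<Rightarrow> 'v \<Rightarrow> bool" where
  "norton_sakuma_3A a b u \<longleftrightarrow> (\<exists>e :: int \<Rightarrow> 'v.
     e 0 = a \<and> e 1 = b \<and> (\<forall>i. e (i + 3) = e i) \<and>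
     basis_of_gen [e (-1), e 0, e 1, u] a b \<and>
     u \<diamondop> u = u \<and>
     (\<forall>i. e i \<diamondop> e i = e i \<and>
          e i \<diamondop> e (i + 1) =
            (1/32) *\<^sub>Q (2 *\<^sub>Q e i + 2 *\<^sub>Q e (i + 1) + e (i - 1)) - (135/2048) *\<^sub>Q u \<and>
          e i \<diamondop> u = (1/9) *\<^sub>Q (2 *\<^sub>Q e i - e (i + 1) - e (i - 1)) + (5/32) *\<^sub>Q u))"

definition norton_sakuma_4B :: "'v \<Rightarrow> 'v \<Rightarrow> 'v \<Rightarrow> bool" where
  "norton_sakuma_4B a b r \<longleftrightarrow> (\<exists>e :: int \<Rightarrow> 'v.
     e 0 = a \<and> e 1 = b \<and> (\<forall>i. e (i + 4) = e i) \<and>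
     basis_of_gen [e (-1), e 0, e 1, e 2, r] a b \<and>
     r \<diamondop> r = r \<and>
     (\<forall>i. e i \<diamondop> e i = e i \<and>
          e i \<diamondop> e (i + 1) = (1/64) *\<^sub>Q (e i + e (i + 1) - e (i - 1) - e (i + 2) + r) \<and>
          e i \<diamondop> e (i + 2) = (1/8) *\<^sub>Q (e i + e (i + 2) - r) \<and>
          e i \<diamondop> r = (1/8) *\<^sub>Q (e i + r - e (i + 2))))"

definition norton_sakuma_5A :: "'v \<Rightarrow> 'v \<Rightarrow> 'v \<Rightarrow> bool" where
  "norton_sakuma_5A a b w \<longleftrightarrow> (\<exists>e :: int \<Rightarrow> 'v.
     e 0 = a \<and> e 1 = b \<and> (\<forall>i. e (i + 5) = e i) \<and>
     basis_of_gen [e (-2), e (-1), e 0, e 1, e 2, w] a b \<and>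
     w \<diamondop> w = (175/2^19) *\<^sub>Q (e (-2) + e (-1) + e 0 + e 1 + e 2) \<and>
     (\<forall>i. e i \<diamondop> e i = e i \<and>
          e i \<diamondop> e (i + 1) =
            (1/128) *\<^sub>Q (3 *\<^sub>Q e i + 3 *\<^sub>Q e (i + 1) - e (i - 1) - e (i + 2) - e (i - 2)) + w \<and>
          e i \<diamondop> e (i + 2) =
            (1/128) *\<^sub>Q (3 *\<^sub>Q e i + 3 *\<^sub>Q e (i + 2) - e (i + 1) - e (i - 1) - e (i - 2)) - w \<and>
          e i \<diamondop> w =
            (7/4096) *\<^sub>Q (e (i + 1) + e (i - 1) - e (i + 2) - e (i - 2)) + (7/32) *\<^sub>Q w))"

definition norton_sakuma_6A :: "'v \<Rightarrow> 'v \<Rightarrow> 'v \<Rightarrow> 'v \<Rightarrow> bool" where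
  "norton_sakuma_6A a b r u \<longleftrightarrow> (\<exists>e :: int \<Rightarrow> 'v.
     e 0 = a \<and> e 1 = b \<and> (\<forall>i. e (i + 6) = e i) \<and>
     basis_of_gen [e (-2), e (-1), e 0, e 1, e 2, e 3, r, u] a b \<and>
     r \<diamondop> r = r \<and> u \<diamondop> u = u \<and> r \<diamondop> u = 0 \<and>
     (\<forall>i. e i \<diamondop> e i = e i \<and>
          e i \<diamondop> e (i + 1) =
            (1/64) *\<^sub>Q (e i + e (i + 1) - e (i - 2) - e (i - 1) - e (i + 2) - e (i + 3) + r)
            + (45/2048) *\<^sub>Q u \<and>
          e i \<diamondop> e (i + 2) =
            (1/32) *\<^sub>Q (2 *\<^sub>Q e i + 2 *\<^sub>Q e (i + 2) + e (i - 2)) - (135/2048) *\<^sub>Q u \<and>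
          e i \<diamondop> e (i + 3) = (1/8) *\<^sub>Q (e i + e (i + 3) - r) \<and>
          e i \<diamondop> r = (1/8) *\<^sub>Q (e i + r - e (i + 3)) \<and>
          e i \<diamondop> u = (1/9) *\<^sub>Q (2 *\<^sub>Q e i - e (i + 2) - e (i - 2)) + (5/32) *\<^sub>Q u))"

end


section \<open>The algebra $A_{286}$\<close>

text \<open>In types 2A, 4B, 6A the element $a_{\rho^k}$ of the Norton--Sakuma algebra is the axis
  in \<open>X\<close> whose Miyamoto involution is $\rho^k$, where $\rho = \tau_a\tau_b$; this is the
  meaning of the notation $a_{\rho^k}$ in the cited table.\<close>

locale seress_algebra_286 = comm_algebra scale mul
  for scale :: "rat \<Rightarrow> 'v::ab_group_add \<Rightarrow> 'v" (infixr \<open>*\<^sub>Q\<close> 75)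
    and mul :: "'v \<Rightarrow> 'v \<Rightarrow> 'v" (infixl \<open>\<diamondop>\<close> 72) +
  fixes form :: "'v \<Rightarrow> 'v \<Rightarrow> rat"
    and X :: "'v set"
  assumes dim_286: "dim UNIV = 286"
    and card_axes: "card X = 165"
    and axes: "a \<in> X \<Longrightarrow> primitive_axis a"
    and generated: "gen_subalgebra X = UNIV"
    and miyamoto_group_M11: "miyamoto_group X \<cong> M11"
    and axes_invariant: "g \<in> carrier (miyamoto_group X) \<Longrightarrow> g ` X = X"
    and miyamoto_bij: "bij_betw miyamoto X
      {g \<in> carrier (miyamoto_group X). group.ord (miyamoto_group X) g = 2}"
    and form_sym: "form x y = form y x"
    and form_add_left: "form (x + y) z = form x z + form y z"
    and form_scale_left: "form (c *\<^sub>Q x) y = c * form x y"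
    and form_pos_def: "x \<noteq> 0 \<Longrightarrow> form x x > 0"
    and form_frobenius: "form (x \<diamondop> y) z = form x (y \<diamondop> z)"
    and form_axis: "a \<in> X \<Longrightarrow> form a a = 1"
    and shape_2A: "\<lbrakk>a \<in> X; b \<in> X; a \<noteq> b;
        group.ord (miyamoto_group X) (miyamoto a \<circ> miyamoto b) = 2\<rbrakk>
      \<Longrightarrow> form a b = 1/8 \<and>
        (\<exists>r\<in>X. miyamoto r = miyamoto a \<circ> miyamoto b \<and> norton_sakuma_2A a b r)"
    and shape_3A: "\<lbrakk>a \<in> X; b \<in> X; a \<noteq> b;
        group.ord (miyamoto_group X) (miyamoto a \<circ> miyamoto b) = 3\<rbrakk>
      \<Longrightarrow> form a b = 13/256 \<and> (\<exists>u. norton_sakuma_3A a b u)"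
    and shape_4B: "\<lbrakk>a \<in> X; b \<in> X; a \<noteq> b;
        group.ord (miyamoto_group X) (miyamoto a \<circ> miyamoto b) = 4\<rbrakk>
      \<Longrightarrow> form a b = 1/64 \<and>
        (\<exists>r\<in>X. miyamoto r = (miyamoto a \<circ> miyamoto b) ^^ 2 \<and> norton_sakuma_4B a b r)"
    and shape_5A: "\<lbrakk>a \<in> X; b \<in> X; a \<noteq> b;
        group.ord (miyamoto_group X) (miyamoto a \<circ> miyamoto b) = 5\<rbrakk>
      \<Longrightarrow> form a b = 3/128 \<and> (\<exists>w. norton_sakuma_5A a b w)"
    and shape_6A: "\<lbrakk>a \<in> X; b \<in> X; a \<noteq> b;
        group.ord (miyamoto_group X) (miyamoto a \<circ> miyamoto b) = 6\<rbrakk>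
      \<Longrightarrow> form a b = 5/256 \<and>
        (\<exists>r\<in>X. \<exists>u. miyamoto r = (miyamoto a \<circ> miyamoto b) ^^ 3 \<and> norton_sakuma_6A a b r u)"

end

theory Submission
  imports Defs "HOL-Library.Product_Plus"
begin

text \<open>The group $U_3(2){:}2$ acts on the nine isotropic points of the Hermitian form as the group of all
  maps $z \mapsto cz + d$ and $z \mapsto c\bar z + d$ on $\mathbb{F}_9$, the affine plane over
  $\mathbb{F}_3$. Its 21 involutions are the nine point reflections and the twelve reflections in
  lines. The dihedral subalgebras determine all products of the 21 axes once one 3A-axis is added for
  each of the four parallel classes of lines; the 25 vectors span a subalgebra and satisfy one linear
  relation, forced by a vanishing norm, so the dimension is 24.

  Each axis is primitive for its own multiplication, so by the Frobenius property an automorphism of the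
  subalgebra multiplies the form by a constant and the Casimir element by the inverse constant. On an
  explicit frame of orthogonal and tight families with a sparse multiplication table the Casimir element
  is explicit; comparing its action shows that the constant is 1, so the Casimir element is fixed. Its
  eigenspaces and a twisted Casimir element show that the four 3A-axes are permuted. After composition
  with an element of the group they are fixed, the idempotents attached to the lines are then permuted
  compatibly with the affine structure, and after a further composition the automorphism fixes a
  spanning set.\<close>

section \<open>The affine plane over the field with three elements\<close>

text \<open>Two kinds of products lie in no dihedral subalgebra. For \<open>u j\<close> times
  \<open>u k\<close> the fusion law of one point axis decides (resurrection). For
  \<open>b k c\<close> times \<open>u j\<close> with skew classes, \<open>u j - u (perp j)\<close>
  is negated by the Miyamoto involution of \<open>b k c\<close>, and the sum is known from the
  linear relation.

  An automorphism of the subalgebra is given neither as a permutation of axes nor as an isometry, so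
  it is controlled through canonical elements. The point axes and the 3A-axes span twelve
  dimensions, where the 3A-axes are orthogonal idempotents whose sum acts as the identity. The
  idempotents \<open>f D1\<close> and \<open>f D3\<close> annihilate this part; \<open>dl\<close>
  and \<open>x\<close> span the other ten dimensions. The Casimir element acts on these three parts
  by 5/2, 55/26 and 59/26, so each part is invariant, and in the second one only \<open>f D1\<close>
  and \<open>f D3\<close> are idempotents of the right norm. Twisting the Casimir element by one of
  them isolates two of the four 3A-axes. If the automorphism scales the form by r, it also scales
  the Casimir element by r; comparing norms gives r * r = r.\<close>

datatype f3 = N0 | N1 | N2

instantiation f3 :: comm_ring_1
begin

definition [simp]: "0 = N0"
definition [simp]: "1 = N1"

fun plus_f3 :: "f3 \<Rightarrow> f3 \<Rightarrow> f3" where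
  "N0 + y = y" | "x + N0 = x" | "N1 + N1 = N2" | "N2 + N2 = N1" | "N1 + N2 = N0" | "N2 + N1 = N0"

fun times_f3 :: "f3 \<Rightarrow> f3 \<Rightarrow> f3" where
  "N0 * y = N0" | "x * N0 = N0" | "N1 * y = y" | "x * N1 = x" | "N2 * N2 = N1"

fun uminus_f3 :: "f3 \<Rightarrow> f3" where
  "- N0 = N0" | "- N1 = N2" | "- N2 = N1"

definition "x - (y :: f3) = x + - y"

instance
proof
  fix a b c :: f3
  show "a + b + c = a + (b + c)" "a * b * c = a * (b * c)" "(a + b) * c = a * c + b * c"
    by (cases a; cases b; cases c; simp)+
  show "a + b = b + a" "a * b = b * a"
    by (cases a; cases b; simp)+
  show "0 + a = a" "1 * a = a" "- a + a = 0"
    by (cases a; simp)+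
  show "a - b = a + - b"
    by (simp add: minus_f3_def)
  show "(0 :: f3) \<noteq> 1"
    by simp
qed

end

lemma f3_add_N0 [simp]: "x + N0 = x" and f3_mult_N1 [simp]: "x * N1 = x" "N1 * x = x"
  and f3_mult_N0 [simp]: "x * N0 = N0"
  by (cases x; simp)+

lemma f3_diff [simp]: "x - N0 = x" "x - N1 = x + N2" "x - N2 = x + N1" "N0 - x = - x"
  by (cases x; simp add: minus_f3_def)+

lemma UNIV_f3: "UNIV = {N0, N1, N2}"
  by (auto intro: f3.exhaust)

instance f3 :: finite
  by standard (simp add: UNIV_f3)

lemma all_f3: "(\<forall>x. P x) \<longleftrightarrow> P N0 \<and> P N1 \<and> P N2"
  by (metis f3.exhaust)

lemma sum_f3: "(\<Sum>x\<in>UNIV. f x) = f N0 + f N1 + f N2"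
  by (simp add: UNIV_f3 add.assoc)

type_synonym pt = "f3 \<times> f3"

text \<open>The four parallel classes of lines: a line \<open>(k, c)\<close> is the set of points \<open>p\<close> with
  \<open>lam k p = c\<close>. The orthogonality is that of the form $x^2 + y^2$.\<close>

datatype dir = D1 | D2 | D3 | D4

lemma UNIV_dir: "UNIV = {D1, D2, D3, D4}"
  by (auto intro: dir.exhaust)

instance dir :: finite
  by standard (simp add: UNIV_dir)

lemma sum_dir: "(\<Sum>x\<in>UNIV. f x) = f D1 + f D2 + f D3 + f D4"
  by (simp add: UNIV_dir add.assoc)

fun perp :: "dir \<Rightarrow> dir" where
  "perp D1 = D2" | "perp D2 = D1" | "perp D3 = D4" | "perp D4 = D3"

fun lam :: "dir \<Rightarrow> pt \<Rightarrow> f3" where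
  "lam D1 (x, y) = x" | "lam D2 (x, y) = y" | "lam D3 (x, y) = x + y" | "lam D4 (x, y) = x - y"

text \<open>\<open>nrm k\<close> spans the lines of direction \<open>perp k\<close>; it is negated by \<open>rho k c\<close> below.\<close>

fun nrm :: "dir \<Rightarrow> pt" where
  "nrm D1 = (N1, N0)" | "nrm D2 = (N0, N1)" | "nrm D3 = (N1, N1)" | "nrm D4 = (N1, N2)"

lemma perp_perp [simp]: "perp (perp k) = k" and perp_neq [simp]: "perp k \<noteq> k" "k \<noteq> perp k"
  by (cases k; simp)+

text \<open>Point reflection in \<open>p\<close>, that is 2p - q with 2 = -1.\<close>

definition sig :: "pt \<Rightarrow> pt \<Rightarrow> pt" where
  "sig p = (\<lambda>q. - p - q)"

text \<open>Reflection that fixes every point of the line \<open>(k, c)\<close>.\<close>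

fun rho :: "dir \<Rightarrow> f3 \<Rightarrow> pt \<Rightarrow> pt" where
  "rho D1 c (x, y) = (- c - x, y)"
| "rho D2 c (x, y) = (x, - c - y)"
| "rho D3 c (x, y) = (c - y, c - x)"
| "rho D4 c (x, y) = (c + y, x - c)"

text \<open>Identifying the plane with $\mathbb{F}_9 = \mathbb{F}_3[i]$, the maps \<open>kmap c s d\<close> are
  $z \mapsto cz + d$ and $z \mapsto c\bar{z} + d$.\<close>

fun kmap :: "pt \<Rightarrow> bool \<Rightarrow> pt \<Rightarrow> pt \<Rightarrow> pt" where
  "kmap (c1, c2) s (d1, d2) (x, y) =
    (let y' = (if s then - y else y) in (c1 * x - c2 * y' + d1, c2 * x + c1 * y' + d2))"

definition Kset :: "(pt \<Rightarrow> pt) set" where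
  "Kset = {kmap c s d | c s d. c \<noteq> 0}"

definition Kgrp :: "(pt \<Rightarrow> pt) monoid" where
  "Kgrp = \<lparr>carrier = Kset, mult = (\<circ>), one = id\<rparr>"

section \<open>The configuration of 21 axes\<close>

context comm_algebra
begin

lemma mul_add_right: "z \<diamondop> (x + y) = z \<diamondop> x + z \<diamondop> y"
  by (metis mul_add_left mul_commute)

lemma mul_scale_right: "x \<diamondop> (c *\<^sub>Q y) = c *\<^sub>Q (x \<diamondop> y)"
  by (metis mul_scale_left mul_commute)

lemma mul_zero [simp]: "0 \<diamondop> x = 0" "x \<diamondop> 0 = 0"
  by (metis mul_scale_left scale_zero_left, metis mul_scale_right scale_zero_left)

lemma mul_minus_left: "(- x) \<diamondop> y = - (x \<diamondop> y)"
  by (metis mul_scale_left scale_minus_left scale_one)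

lemma mul_diff_left: "(x - y) \<diamondop> z = x \<diamondop> z - y \<diamondop> z"
  by (metis add_uminus_conv_diff mul_add_left mul_minus_left)

lemma mul_diff_right: "z \<diamondop> (x - y) = z \<diamondop> x - z \<diamondop> y"
  by (metis mul_diff_left mul_commute)

lemma mul_minus_right: "y \<diamondop> (- x) = - (y \<diamondop> x)"
  by (metis mul_minus_left mul_commute)

lemma mul_sum_left: "(\<Sum>i\<in>I. f i) \<diamondop> y = (\<Sum>i\<in>I. f i \<diamondop> y)"
  by (induction I rule: infinite_finite_induct) (auto simp: mul_add_left)

lemma mul_sum_right: "y \<diamondop> (\<Sum>i\<in>I. f i) = (\<Sum>i\<in>I. y \<diamondop> f i)"
  by (induction I rule: infinite_finite_induct) (auto simp: mul_add_right)

lemmas mul_lin = mul_add_left mul_add_right mul_diff_left mul_diff_right mul_scale_left mul_scale_right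

end

text \<open>Collects the facts about the 21 axes from which the dimension and the automorphism group
  follow. \<open>a p\<close> belongs to the reflection in the point \<open>p\<close>,
  \<open>b k c\<close> to the reflection in the line \<open>(k, c)\<close>, and \<open>u k\<close>
  is the 3A-axis of the translations along \<open>nrm k\<close>, shared by the points of every line
  in that direction and by the three lines of class \<open>k\<close>. \<open>act_rho\<close> says
  that vectors negated by a Miyamoto involution are 1/32-eigenvectors.\<close>

locale m9_config = comm_algebra scale mul
  for scale :: "rat \<Rightarrow> 'v::ab_group_add \<Rightarrow> 'v" (infixr \<open>*\<^sub>Q\<close> 75)
    and mul :: "'v \<Rightarrow> 'v \<Rightarrow> 'v" (infixl \<open>\<diamondop>\<close> 72) +
  fixes form :: "'v \<Rightarrow> 'v \<Rightarrow> rat"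
    and a :: "pt \<Rightarrow> 'v" and b :: "dir \<Rightarrow> f3 \<Rightarrow> 'v" and u :: "dir \<Rightarrow> 'v"
    and act :: "(pt \<Rightarrow> pt) \<Rightarrow> 'v \<Rightarrow> 'v"
  assumes form_sym: "form x y = form y x"
    and form_add_left: "form (x + y) z = form x z + form y z"
    and form_scale_left: "form (r *\<^sub>Q x) y = r * form x y"
    and form_pos_def: "x \<noteq> 0 \<Longrightarrow> form x x > 0"
    and form_frobenius: "form (x \<diamondop> y) z = form x (y \<diamondop> z)"
    and axis_a: "primitive_axis (a p)"
    and axis_b: "primitive_axis (b k c)"
    and form_axis_a: "form (a p) (a p) = 1"
    and form_axis_b: "form (b k c) (b k c) = 1"
    and form_aa: "p \<noteq> q \<Longrightarrow> form (a p) (a q) = 13/256"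
    and form_ab_in: "form (a p) (b k (lam k p)) = 1/8"
    and form_ab_out: "lam k p \<noteq> c \<Longrightarrow> form (a p) (b k c) = 5/256"
    and form_bb_par: "c \<noteq> d \<Longrightarrow> form (b k c) (b k d) = 13/256"
    and form_bb_perp: "form (b k c) (b (perp k) d) = 1/8"
    and form_bb_skew: "j \<noteq> k \<Longrightarrow> j \<noteq> perp k \<Longrightarrow> form (b k c) (b j d) = 1/64"
    and mul_aa: "p \<noteq> q \<Longrightarrow> lam (perp k) p = lam (perp k) q \<Longrightarrow>
      a p \<diamondop> a q = (1/16) *\<^sub>Q (a p + a q) + (1/32) *\<^sub>Q a (- p - q) - (135/2048) *\<^sub>Q u k"
    and mul_ab_in: "a p \<diamondop> b k (lam k p) =
      (1/8) *\<^sub>Q (a p + b k (lam k p) - b (perp k) (lam (perp k) p))"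
    and mul_ab_out: "lam k p \<noteq> c \<Longrightarrow> a p \<diamondop> b k c =
      (1/64) *\<^sub>Q (a p + b k c - a (p + nrm k) - a (p - nrm k) - b k (lam k p)
        - b k (- c - lam k p) + b (perp k) (lam (perp k) p)) + (45/2048) *\<^sub>Q u k"
    and mul_bb_par: "c \<noteq> d \<Longrightarrow> b k c \<diamondop> b k d =
      (1/16) *\<^sub>Q (b k c + b k d) + (1/32) *\<^sub>Q b k (- c - d) - (135/2048) *\<^sub>Q u k"
    and mul_bb_perp: "b k (lam k p) \<diamondop> b (perp k) (lam (perp k) p) =
      (1/8) *\<^sub>Q (b k (lam k p) + b (perp k) (lam (perp k) p) - a p)"
    and mul_bb_skew: "j \<noteq> k \<Longrightarrow> j \<noteq> perp k \<Longrightarrow> b k (lam k p) \<diamondop> b j (lam j p) =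
      (1/64) *\<^sub>Q (b k (lam k p) + b j (lam j p) - b (perp k) (lam (perp k) p)
        - b (perp j) (lam (perp j) p) + a p)"
    and mul_au: "a p \<diamondop> u k = (1/9) *\<^sub>Q (2 *\<^sub>Q a p - a (p + nrm k) - a (p - nrm k)) + (5/32) *\<^sub>Q u k"
    and mul_bu: "b k c \<diamondop> u k =
      (1/9) *\<^sub>Q (2 *\<^sub>Q b k c - b k (c + 1) - b k (c - 1)) + (5/32) *\<^sub>Q u k"
    and mul_bu_perp: "b (perp k) c \<diamondop> u k = 0"
    and mul_uu: "u k \<diamondop> u k = u k"
    and act_add: "g \<in> Kset \<Longrightarrow> act g (x + y) = act g x + act g y"
    and act_scale: "g \<in> Kset \<Longrightarrow> act g (r *\<^sub>Q x) = r *\<^sub>Q act g x"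
    and act_mul: "g \<in> Kset \<Longrightarrow> act g (x \<diamondop> y) = act g x \<diamondop> act g y"
    and act_comp: "g \<in> Kset \<Longrightarrow> g' \<in> Kset \<Longrightarrow> act (g \<circ> g') x = act g (act g' x)"
    and act_id: "act id x = x"
    and act_inj: "g \<in> Kset \<Longrightarrow> inj (act g)"
    and act_a: "g \<in> Kset \<Longrightarrow> act g (a p) = a (g p)"
    and act_b: "g \<in> Kset \<Longrightarrow> g \<circ> rho k c = rho j d \<circ> g \<Longrightarrow> act g (b k c) = b j d"
    and act_rho: "act (rho k c) x = - x \<Longrightarrow> b k c \<diamondop> x = (1/32) *\<^sub>Q x"
begin

lemma form_add_right: "form z (x + y) = form z x + form z y"
  by (metis form_add_left form_sym)

lemma form_scale_right: "form y (c *\<^sub>Q x) = c * form y x"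
  by (metis form_scale_left form_sym)

lemma form_zero [simp]: "form 0 x = 0" "form x 0 = 0"
  using form_scale_left[of 0 0 x] form_scale_right[of x 0 0] by auto

lemma form_minus_left: "form (- x) y = - form x y"
  by (metis form_scale_left mult_minus1 scale_minus_left scale_one)

lemma form_diff_left: "form (x - y) z = form x z - form y z"
  by (metis form_add_left form_minus_left add_uminus_conv_diff)

lemma form_diff_right: "form z (x - y) = form z x - form z y"
  by (metis form_diff_left form_sym)

lemma form_minus_right: "form y (- x) = - form y x"
  by (metis form_minus_left form_sym)

lemma form_sum_left: "form (\<Sum>i\<in>I. f i) y = (\<Sum>i\<in>I. form (f i) y)"
  by (induction I rule: infinite_finite_induct) (auto simp: form_add_left)

lemma form_sum_right: "form y (\<Sum>i\<in>I. f i) = (\<Sum>i\<in>I. form y (f i))"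
  by (induction I rule: infinite_finite_induct) (auto simp: form_add_right)

lemmas form_lin = form_add_left form_add_right form_diff_left form_diff_right
  form_scale_left form_scale_right

lemma form_eq_0: "form x x = 0 \<Longrightarrow> x = 0"
  using form_pos_def by fastforce

text \<open>Since \<open>a p\<close> is idempotent, moving it across the form in the pairing of its
  product with \<open>u k\<close> against \<open>a p\<close> gives a linear equation for the unknown
  value.\<close>

lemma form_au: "form (a p) (u k) = 1/4"
proof -
  have "p + nrm k \<noteq> p" "p - nrm k \<noteq> p"
    by (cases k; simp add: zero_prod_def prod_eq_iff)+
  then have "form (a p \<diamondop> u k) (a p) = (1/9) * (2 - 13/256 - 13/256) + (5/32) * form (u k) (a p)"
    unfolding mul_au form_lin by (simp add: form_aa form_axis_a)
  moreover have "form (a p \<diamondop> u k) (a p) = form (u k) (a p)"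
    using axis_a[of p] unfolding primitive_axis_def
    by (metis form_frobenius mul_commute)
  ultimately show ?thesis
    by (simp add: form_sym[of "a p"])
qed

lemma form_uu: "form (u k) (u k) = 8/5"
proof -
  have "form (a 0 \<diamondop> u k) (u k) = (1/9) * (2/4 - 1/4 - 1/4) + (5/32) * form (u k) (u k)"
    unfolding mul_au form_lin by (simp add: form_au)
  moreover have "form (a 0 \<diamondop> u k) (u k) = form (a 0) (u k)"
    by (simp add: form_frobenius mul_uu)
  ultimately show ?thesis
    by (simp add: form_au)
qed

lemma mul_a_self: "a p \<diamondop> a p = a p" and mul_b_self: "b k c \<diamondop> b k c = b k c"
  using axis_a axis_b by (simp_all add: primitive_axis_def)

text \<open>The product of two point axes along \<open>nrm k\<close> involves \<open>u k\<close>.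
  Pairing it with \<open>u j\<close> and associating the other way leaves only known values beside
  the unknown one.\<close>

lemma form_uu_distinct:
  assumes "j \<noteq> k"
  shows "form (u j) (u k) = 0"
proof -
  define q where "q = nrm k"
  have q: "q \<noteq> 0" "lam (perp k) 0 = lam (perp k) q"
    by (cases k; simp add: q_def zero_prod_def)+
  have 1: "form (a 0 \<diamondop> a q) (u j) = (1/16) * (1/4 + 1/4) + (1/32) * (1/4) - (135/2048) * form (u k) (u j)"
    unfolding mul_aa[OF q(1)[symmetric] q(2)] form_lin by (simp add: form_au)
  have "0 + nrm j \<noteq> q" "0 - nrm j \<noteq> q"
    using assms by (cases j; cases k; simp add: q_def zero_prod_def)+
  then have 2: "form (a 0 \<diamondop> u j) (a q) = 5/128"
    unfolding mul_au form_lin using q by (simp add: form_aa form_au form_sym[of "u j"])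
  have "form (a 0 \<diamondop> a q) (u j) = form (a 0 \<diamondop> u j) (a q)"
    by (metis form_frobenius form_sym mul_commute)
  with 1 2 show ?thesis
    by (simp add: form_sym)
qed

end

section \<open>Linear combinations, and the products of the 3A-axes\<close>

fun ladd :: "rat list \<Rightarrow> rat list \<Rightarrow> rat list" where
  "ladd (x # xs) (y # ys) = (x + y) # ladd xs ys"
| "ladd [] ys = ys"
| "ladd xs [] = xs"

fun lscale :: "rat \<Rightarrow> rat list \<Rightarrow> rat list" where
  "lscale c (x # xs) = (c * x) # lscale c xs"
| "lscale c [] = []"

lemma sum_pt: "(\<Sum>p\<in>UNIV. f p) = f (N0, N0) + f (N0, N1) + f (N0, N2)
    + (f (N1, N0) + f (N1, N1) + f (N1, N2)) + (f (N2, N0) + f (N2, N1) + f (N2, N2))"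
  for f :: "pt \<Rightarrow> 'b :: comm_monoid_add"
proof -
  have "(\<Sum>p\<in>UNIV. f p) = (\<Sum>x\<in>UNIV. \<Sum>y\<in>UNIV. f (x, y))"
    by (simp add: sum.cartesian_product flip: UNIV_Times_UNIV)
  then show ?thesis
    by (simp add: sum_f3)
qed

context comm_algebra
begin

fun lc :: "rat list \<Rightarrow> 'v list \<Rightarrow> 'v" where
  "lc (c # cs) (v # vs) = c *\<^sub>Q v + lc cs vs"
| "lc [] vs = 0"
| "lc cs [] = 0"

lemma lc_add: "lc cs vs + lc ds vs = lc (ladd cs ds) vs"
proof (induction cs ds arbitrary: vs rule: ladd.induct)
  case (1 x xs y ys)
  then show ?case
    by (cases vs) (auto simp: scale_left_distrib algebra_simps simp flip: 1)
qed auto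

lemma lc_scale: "r *\<^sub>Q lc cs vs = lc (lscale r cs) vs"
proof (induction r cs arbitrary: vs rule: lscale.induct)
  case (1 c x xs)
  then show ?case
    by (cases vs) (auto simp: scale_right_distrib)
qed auto

lemma lc_minus: "- lc cs vs = lc (lscale (-1) cs) vs"
  by (simp flip: lc_scale)

lemma lc_diff: "lc cs vs - lc ds vs = lc (ladd cs (lscale (-1) ds)) vs"
  by (simp flip: lc_add lc_minus)

lemmas lc_simps = lc_add lc_scale lc_minus lc_diff

lemma eigenspace_iff: "v \<in> eigenspace x l \<longleftrightarrow> x \<diamondop> v = l *\<^sub>Q v"
  by (simp add: eigenspace_def)

lemma subspace_eigenspace: "subspace (eigenspace x l)"
  by (auto simp: subspace_def eigenspace_def mul_add_right mul_scale_right scale_right_distrib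
      scale_left_commute)

lemma eigen_sum_single: "eigen_sum x {l} = eigenspace x l"
  by (simp add: eigen_sum_def span_eq_iff[THEN iffD2, OF subspace_eigenspace])

lemma axis_fusion:
  assumes "primitive_axis x" "l \<in> {1, 0, 1/4, 1/32}" "m \<in> {1, 0, 1/4, 1/32}"
    and "x \<diamondop> v = l *\<^sub>Q v" "x \<diamondop> w = m *\<^sub>Q w"
  shows "v \<diamondop> w \<in> eigen_sum x (monster_fusion l m)"
  using assms unfolding primitive_axis_def eigenspace_def by blast

lemma axis_fusion_00:
  assumes "primitive_axis x" "x \<diamondop> v = 0" "x \<diamondop> w = 0"
  shows "x \<diamondop> (v \<diamondop> w) = 0"
  using axis_fusion[OF assms(1), of 0 0 v w] assms
  by (simp add: monster_fusion_def doubleton_eq_iff eigen_sum_single eigenspace_iff)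

lemma axis_fusion_04:
  assumes "primitive_axis x" "x \<diamondop> v = 0" "x \<diamondop> w = (1/4) *\<^sub>Q w"
  shows "x \<diamondop> (v \<diamondop> w) = (1/4) *\<^sub>Q (v \<diamondop> w)"
  using axis_fusion[OF assms(1), of 0 "1/4" v w] assms
  by (simp add: monster_fusion_def doubleton_eq_iff eigen_sum_single eigenspace_iff)

end

context m9_config
begin

text \<open>Equality case of Cauchy-Schwarz: both sides have norm 32/5 and so does their inner
  product, hence the difference \<open>v\<close> has norm zero. This is the one linear relation
  among the 25 spanning vectors.\<close>

lemma sum_u: "(\<Sum>k\<in>UNIV. u k) = (32/45) *\<^sub>Q (\<Sum>p\<in>UNIV. a p)"
proof -
  define v where "v = (\<Sum>k\<in>UNIV. u k) - (32/45) *\<^sub>Q (\<Sum>p\<in>UNIV. a p)"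
  have 1: "form (\<Sum>k\<in>UNIV. u k) (\<Sum>k\<in>UNIV. u k) = 4 * (8/5)"
    by (simp add: form_sum_left form_sum_right sum_dir form_add_left form_add_right form_uu form_uu_distinct)
  have 2: "form (\<Sum>k\<in>UNIV. u k) (\<Sum>p\<in>UNIV. a p) = 36/4"
    "form (\<Sum>p\<in>UNIV. a p) (\<Sum>k\<in>UNIV. u k) = 36/4"
    by (simp_all add: form_sum_left form_sum_right sum_dir form_au form_sym[of "u _"] sum_pt
        form_add_left form_add_right)
  have 3: "form (\<Sum>p\<in>UNIV. a p) (\<Sum>p\<in>UNIV. a p) = 9 * (45/32)"
    by (simp add: form_sum_left form_sum_right form_axis_a form_aa sum_pt
        form_add_left form_add_right)
  have "form v v = 0"
    unfolding v_def form_lin by (simp add: 1 2 3)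
  then have "v = 0"
    by (rule form_eq_0)
  then show ?thesis
    by (simp add: v_def)
qed

text \<open>Candidate for the subalgebra generated by the nine point axes. That it contains the
  products of two 3A-axes is not visible in any dihedral subalgebra.\<close>

definition AU :: "'v set" where
  "AU = span (range a \<union> range u)"

lemma AU_a: "a p \<in> AU" and AU_u: "u k \<in> AU"
  by (auto simp: AU_def intro: span_base)

lemma AU_closed:
  "x \<in> AU \<Longrightarrow> y \<in> AU \<Longrightarrow> x + y \<in> AU"
  "x \<in> AU \<Longrightarrow> y \<in> AU \<Longrightarrow> x - y \<in> AU"
  "x \<in> AU \<Longrightarrow> r *\<^sub>Q x \<in> AU"
  by (auto simp: AU_def span_add span_diff span_scale)

lemma ex_direction:
  assumes "p \<noteq> q"
  obtains k where "lam k p = lam k q"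
proof -
  obtain x y x' y' where "p = (x, y)" "q = (x', y')"
    by fastforce
  then have "\<exists>k. lam k p = lam k q"
    using assms by (cases x; cases y; cases x'; cases y'; simp; metis lam.simps f3_add_N0 plus_f3.simps f3_diff uminus_f3.simps)
  with that show thesis
    by blast
qed

lemma AU_aa: "a p \<diamondop> a q \<in> AU"
proof (cases "p = q")
  case True
  then show ?thesis
    by (simp add: mul_a_self AU_a)
next
  case False
  then obtain k where "lam k p = lam k q"
    by (rule ex_direction)
  with mul_aa[OF False, of "perp k"] show ?thesis
    by (simp add: AU_closed AU_a AU_u)
qed

lemma AU_au: "a p \<diamondop> u k \<in> AU"
  unfolding mul_au by (intro AU_closed AU_a AU_u)

lemma AU_mul_a:
  assumes "x \<in> AU"
  shows "a p \<diamondop> x \<in> AU"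
  using assms unfolding AU_def
proof (induction rule: span_induct_alt)
  case base
  then show ?case by (simp add: span_zero)
next
  case (step c x y)
  then have "a p \<diamondop> x \<in> AU"
    using AU_aa AU_au step(1) by blast
  with step show ?case
    by (simp add: mul_add_right mul_scale_right span_add span_scale AU_def)
qed

text \<open>Resurrection. \<open>z k\<close> and \<open>w k\<close> are eigenvectors of the axis
  \<open>x\<close> for 0 and 1/4 that agree with \<open>u k\<close> up to point axes, so their
  difference \<open>d\<close> consists of point axes. By the fusion law \<open>x\<close> kills the
  product of \<open>z j\<close> and \<open>z k\<close> and multiplies that of \<open>z j\<close> and
  \<open>w k\<close> by 1/4. Hence \<open>x\<close> times the product of \<open>z j\<close> and
  \<open>d\<close>, which is known to lie in \<open>AU\<close>, is -1/4 times the product of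
  \<open>z j\<close> and \<open>w k\<close>.\<close>

lemma AU_uu: "u j \<diamondop> u k \<in> AU" if "j \<noteq> k"
proof -
  define x where "x = a 0"
  \<comment> \<open>The two eigenvectors inside the 3A-algebra spanned by \<open>x\<close>,
    \<open>a (nrm k)\<close>, \<open>a (- nrm k)\<close> and \<open>u k\<close>.\<close>
  define z where "z k = u k - (10/27) *\<^sub>Q x + (32/27) *\<^sub>Q (a (nrm k) + a (- nrm k))" for k
  define w where "w k = u k - (8/45) *\<^sub>Q x - (32/45) *\<^sub>Q (a (nrm k) + a (- nrm k))" for k
  have ev: "x \<diamondop> z k = 0" "x \<diamondop> w k = (1/4) *\<^sub>Q w k" for k
  proof -
    define vs where "vs = [x, a (nrm k), a (- nrm k), u k]"
    have vs: "x = lc [1,0,0,0] vs" "a (nrm k) = lc [0,1,0,0] vs" "a (- nrm k) = lc [0,0,1,0] vs"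
      "u k = lc [0,0,0,1] vs"
      by (simp_all add: vs_def)
    have neq: "0 \<noteq> nrm k" "0 \<noteq> - nrm k" "lam (perp k) 0 = lam (perp k) (nrm k)"
      "lam (perp k) 0 = lam (perp k) (- nrm k)"
      by (cases k; simp add: zero_prod_def)+
    note xs = mul_aa[OF neq(1,3)] mul_aa[OF neq(2,4)]
    have xa: "x \<diamondop> a (nrm k) = lc [1/16,1/16,1/32,-135/2048] vs"
       "x \<diamondop> a (- nrm k) = lc [1/16,1/32,1/16,-135/2048] vs"
      unfolding x_def xs unfolding minus_zero diff_0 minus_minus x_def[symmetric] vs
      by (simp_all add: lc_simps)
    have xu: "x \<diamondop> u k = lc [2/9,-1/9,-1/9,5/32] vs"
      unfolding x_def mul_au unfolding add_0_left diff_0 x_def[symmetric] vs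
      by (simp_all add: lc_simps)
    have xx: "x \<diamondop> x = lc [1,0,0,0] vs"
      using mul_a_self by (simp add: x_def vs_def)
    show "x \<diamondop> z k = 0"
      unfolding z_def mul_lin xa xu xx by (simp add: lc_simps) (simp add: vs_def)
    show "x \<diamondop> w k = (1/4) *\<^sub>Q w k"
      unfolding w_def mul_lin xa xu xx unfolding vs by (simp add: lc_simps)
  qed
  have ax: "primitive_axis x"
    by (simp add: x_def axis_a)
  define d where "d = z k - w k"
  have d: "d = - (26/135) *\<^sub>Q x + (256/135) *\<^sub>Q (a (nrm k) + a (- nrm k))"
  proof -
    define vs where "vs = [x, a (nrm k), a (- nrm k), u k]"
    have vs: "x = lc [1,0,0,0] vs" "a (nrm k) = lc [0,1,0,0] vs" "a (- nrm k) = lc [0,0,1,0] vs"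
      "u k = lc [0,0,0,1] vs"
      by (simp_all add: vs_def)
    show ?thesis
      unfolding d_def z_def w_def unfolding vs by (simp add: lc_simps)
  qed
  have zd: "z j \<diamondop> d \<in> AU"
  proof -
    have "u j \<diamondop> a q \<in> AU" for q
      using AU_au by (simp add: mul_commute)
    then show ?thesis
      unfolding d z_def x_def mul_lin by (intro AU_closed AU_aa) auto
  qed
  have "x \<diamondop> (z j \<diamondop> d) = - (1/4) *\<^sub>Q (z j \<diamondop> w k)"
    unfolding d_def mul_diff_right axis_fusion_00[OF ax ev(1) ev(1)] axis_fusion_04[OF ax ev]
    by simp
  then have "z j \<diamondop> w k = (- 4) *\<^sub>Q (x \<diamondop> (z j \<diamondop> d))"
    by simp
  moreover have "x \<diamondop> (z j \<diamondop> d) \<in> AU"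
    unfolding x_def using zd[unfolded x_def] by (intro AU_mul_a zd)
  ultimately have zw: "z j \<diamondop> w k \<in> AU"
    by (metis AU_closed(3))
  have "u j \<diamondop> u k = z j \<diamondop> w k + (8/45) *\<^sub>Q (z j \<diamondop> x) + (32/45) *\<^sub>Q (z j \<diamondop> (a (nrm k) + a (- nrm k)))
     + (10/27) *\<^sub>Q (x \<diamondop> u k) - (32/27) *\<^sub>Q ((a (nrm j) + a (- nrm j)) \<diamondop> u k)"
    unfolding z_def w_def mul_lin by (simp add: algebra_simps)
  moreover have "z j \<diamondop> a q \<in> AU" for q
  proof -
    have "u j \<diamondop> a q \<in> AU"
      using AU_au by (simp add: mul_commute)
    then show ?thesis
      unfolding z_def x_def mul_lin by (intro AU_closed AU_aa) auto
  qed
  ultimately show ?thesis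
    using zw by (simp add: x_def mul_add_left mul_add_right AU_closed AU_au)
qed

text \<open>The product lies in \<open>AU\<close>, so it is enough that it is orthogonal to
  \<open>AU\<close>. Orthogonality to the point axes is direct; for the 3A-axes the trilinear form
  \<open>t\<close> is totally symmetric and vanishes when exactly two indices agree, which leaves
  four unknowns.\<close>

lemma mul_uu_distinct: "u j \<diamondop> u k = 0" if "j \<noteq> k"
proof -
  have fa: "form (u j \<diamondop> u k) (a p) = 0" if "j \<noteq> k" for j k p
    using that unfolding form_frobenius mul_commute[of "u k"] mul_au form_lin
    by (simp add: form_sym[of "u j"] form_au form_uu_distinct[of k j])
  define t where "t i j k = form (u i \<diamondop> u j) (u k)" for i j k
  have t_swap1: "t i j k = t j i k" for i j k
    by (simp add: t_def mul_commute)
  have t_swap2: "t i j k = t i k j" for i j k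
    unfolding t_def by (subst mul_commute[of "u i" "u k"], subst form_frobenius, rule form_sym)
  have t01: "t i i j = 0" if "i \<noteq> j" for i j
    using that by (simp add: t_def mul_uu form_uu_distinct)
  then have t0: "t i i j = 0" "t i j i = 0" "t j i i = 0" if "i \<noteq> j" for i j
    using that t_swap1 t_swap2 by metis+
  \<comment> \<open>By \<open>sum_u\<close> the sum of the 3A-axes is a combination of point axes,
    to which the product is already orthogonal. These relations say that any two of the unknowns
    with a common index pair add up to zero, which forces all four to vanish.\<close>
  have sm: "t i j D1 + t i j D2 + t i j D3 + t i j D4 = 0" if "i \<noteq> j" for i j
  proof -
    have "(\<Sum>k\<in>UNIV. t i j k) = 0"
      unfolding t_def form_sum_right[symmetric] sum_u form_scale_right
      unfolding form_sum_right by (simp add: fa[OF that])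
    then show ?thesis
      by (simp add: sum_dir)
  qed
  have eqs: "t D1 D3 D2 = t D1 D2 D3" "t D1 D4 D2 = t D1 D2 D4" "t D1 D4 D3 = t D1 D3 D4"
    "t D2 D3 D1 = t D1 D2 D3" "t D2 D4 D1 = t D1 D2 D4" "t D3 D4 D1 = t D1 D3 D4"
    "t D2 D4 D3 = t D2 D3 D4" "t D3 D4 D2 = t D2 D3 D4"
    using t_swap1 t_swap2 by metis+
  have tt: "t D1 D2 D3 = 0" "t D1 D2 D4 = 0" "t D1 D3 D4 = 0" "t D2 D3 D4 = 0"
    using sm[of D1 D2] sm[of D1 D3] sm[of D1 D4] sm[of D2 D3] sm[of D2 D4] sm[of D3 D4]
    unfolding eqs by (simp_all add: t0)
  have t: "t j k i = 0" for i
    using that by (cases i; cases j; cases k; simp add: t0 tt eqs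
        t_swap1[of D2 D1] t_swap1[of D3 D1] t_swap1[of D4 D1] t_swap1[of D3 D2] t_swap1[of D4 D2] t_swap1[of D4 D3])
  have "form (u j \<diamondop> u k) y = 0" if "y \<in> AU" for y
    using that unfolding AU_def
  proof (induction rule: span_induct_alt)
    case (step c x y)
    with t \<open>j \<noteq> k\<close> show ?case
      by (auto simp: form_add_right form_scale_right fa t_def)
  qed auto
  from form_eq_0[OF this[OF AU_uu[OF that]]] show ?thesis .
qed

end

section \<open>The complete multiplication table\<close>

fun onl :: "dir \<Rightarrow> f3 \<Rightarrow> pt" where
  "onl D2 c = (0, c)" | "onl _ c = (c, 0)"

lemma f3_2 [simp]: "(2 :: f3) = N2"
  by (simp flip: one_add_one)

lemma KsetI: "g = kmap c s d \<Longrightarrow> c \<noteq> 0 \<Longrightarrow> g \<in> Kset"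
  unfolding Kset_def by blast

lemma rho_in_Kset: "rho k c \<in> Kset"
proof (cases k)
  case D1
  then show ?thesis
    by (intro KsetI[of _ "(N2, N0)" True "(- c, N0)"]) (cases c; auto simp: fun_eq_iff zero_prod_def all_f3)+
next
  case D2
  then show ?thesis
    by (intro KsetI[of _ "(N1, N0)" True "(N0, - c)"]) (cases c; auto simp: fun_eq_iff zero_prod_def all_f3)+
next
  case D3
  then show ?thesis
    by (intro KsetI[of _ "(N0, N2)" True "(c, c)"]) (cases c; auto simp: fun_eq_iff zero_prod_def all_f3)+
next
  case D4
  then show ?thesis
    by (intro KsetI[of _ "(N0, N1)" True "(c, - c)"]) (cases c; auto simp: fun_eq_iff zero_prod_def all_f3)+
qed

text \<open>A line reflection exchanges the two classes that are neither its own nor perpendicular.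
  Hence it exchanges the 3A-axes \<open>u j\<close> and \<open>u (perp j)\<close>.\<close>

lemma rho_conj_skew:
  assumes "j \<noteq> k" "j \<noteq> perp k"
  shows "rho k c \<circ> rho j d = rho (perp j) (lam (perp j) (rho k c (onl j d))) \<circ> rho k c"
  using assms by (cases k; cases j; cases c; cases d; simp add: fun_eq_iff all_f3)

lemmas idx_simps = plus_f3.simps uminus_f3.simps f3_add_N0 f3_diff minus_f3_def zero_f3_def one_f3_def
  zero_prod_def add_Pair diff_Pair uminus_Pair lam.simps nrm.simps perp.simps onl.simps f3.distinct dir.distinct
  simp_thms not_False_eq_True not_True_eq_False prod.inject if_True if_False

text \<open>Identities between linear combinations are decided by reifying them over a list of
  vectors and comparing coefficients.\<close>

datatype lex = LG nat | LP lex lex | LM lex lex | LS rat lex | LN lex | LZ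

fun co :: "nat \<Rightarrow> lex \<Rightarrow> rat" where
  "co i (LG j) = (if i = j then 1 else 0)"
| "co i (LP x y) = co i x + co i y"
| "co i (LM x y) = co i x - co i y"
| "co i (LS r x) = r * co i x"
| "co i (LN x) = - co i x"
| "co i LZ = 0"

context comm_algebra
begin

fun den :: "'v list \<Rightarrow> lex \<Rightarrow> 'v" where
  "den vs (LG j) = (if j < length vs then vs ! j else 0)"
| "den vs (LP x y) = den vs x + den vs y"
| "den vs (LM x y) = den vs x - den vs y"
| "den vs (LS r x) = r *\<^sub>Q den vs x"
| "den vs (LN x) = - den vs x"
| "den vs LZ = 0"

lemma den_sum: "den vs e = (\<Sum>i<length vs. co i e *\<^sub>Q (vs ! i))"
proof (induction e)
  case (LG j)
  have "(\<Sum>i<length vs. co i (LG j) *\<^sub>Q (vs ! i)) = (\<Sum>i<length vs. if i = j then vs ! i else 0)"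
    by (rule sum.cong) auto
  then show ?case
    by (simp add: sum.delta)
qed (auto simp: scale_left_distrib scale_left_diff_distrib sum.distrib sum_subtractf scale_sum_right
    sum_negf)

lemma den_eqI:
  assumes "list_all (\<lambda>i. co i e = co i e') [0..<length vs]"
  shows "den vs e = den vs e'"
  using assms unfolding den_sum list_all_iff by (auto intro!: sum.cong)

lemma den_fold:
  "den vs x + den vs y = den vs (LP x y)"
  "den vs x - den vs y = den vs (LM x y)"
  "r *\<^sub>Q den vs x = den vs (LS r x)"
  "- den vs x = den vs (LN x)"
  by simp_all

lemma den_cong: "den vs e = den vs e" ..

end

context m9_config
begin

lemma act_diff: "g \<in> Kset \<Longrightarrow> act g (x - y) = act g x - act g y"
  by (metis act_add diff_add_cancel add_diff_cancel)

lemma u_eq: "c \<noteq> d \<Longrightarrow> u k = (2048/135) *\<^sub>Q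
    ((1/16) *\<^sub>Q (b k c + b k d) + (1/32) *\<^sub>Q b k (- c - d) - b k c \<diamondop> b k d)"
  using mul_bb_par[of c d k] by simp

lemma act_u:
  assumes "g \<in> Kset" "\<And>d. g \<circ> rho j d = rho i (h d) \<circ> g" "inj h"
  shows "act g (u j) = u i"
proof -
  have ne: "h N0 \<noteq> h N1" "h N0 \<noteq> h N2" "h N1 \<noteq> h N2"
    using assms(3) by (auto simp: inj_def)
  \<comment> \<open>Three distinct elements of the field sum to zero, so the third line in the
    product of the first two images is the image of the third line.\<close>
  then have h2: "- h N0 - h N1 = h N2"
    by (cases "h N0"; cases "h N1"; cases "h N2"; simp)
  have "act g (b j d) = b i (h d)" for d
    by (rule act_b) (use assms in auto)
  then have "act g (u j) = (2048/135) *\<^sub>Q ((1/16) *\<^sub>Q (b i (h N0) + b i (h N1)) + (1/32) *\<^sub>Q b i (h N2)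
      - b i (h N0) \<diamondop> b i (h N1))"
    by (simp add: u_eq[of N0 N1 j] act_add act_scale act_diff act_mul assms(1))
  then show ?thesis
    using u_eq[OF ne(1), of i] h2 by simp
qed

definition sb :: "dir \<Rightarrow> 'v" where
  "sb k = b k N0 + b k N1 + b k N2"

definition sa :: 'v where
  "sa = (\<Sum>p\<in>UNIV. a p)"

text \<open>The points of the line \<open>(k, c)\<close> are reached from \<open>onl k c\<close>
  along \<open>nrm (perp k)\<close>.\<close>

definition aline :: "dir \<Rightarrow> f3 \<Rightarrow> 'v" where
  "aline k c = a (onl k c) + a (onl k c + nrm (perp k)) + a (onl k c - nrm (perp k))"

text \<open>\<open>u D4\<close> is left out because the linear relation expresses it by the others.
  Comparison of coefficients is sound for any list, but decides every identity only for an
  independent one.\<close>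

definition gens :: "'v list" where
  "gens = [a (N0, N0), a (N0, N1), a (N0, N2), a (N1, N0), a (N1, N1), a (N1, N2), a (N2, N0), a (N2, N1), a (N2, N2),
    b D1 N0, b D1 N1, b D1 N2, b D2 N0, b D2 N1, b D2 N2, b D3 N0, b D3 N1, b D3 N2, b D4 N0, b D4 N1, b D4 N2,
    u D1, u D2, u D3]"

lemma gens_den:
  "a (N0, N0) = den gens (LG 0)"
  "a (N0, N1) = den gens (LG 1)"
  "a (N0, N2) = den gens (LG 2)"
  "a (N1, N0) = den gens (LG 3)"
  "a (N1, N1) = den gens (LG 4)"
  "a (N1, N2) = den gens (LG 5)"
  "a (N2, N0) = den gens (LG 6)"
  "a (N2, N1) = den gens (LG 7)"
  "a (N2, N2) = den gens (LG 8)"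
  "b D1 N0 = den gens (LG 9)"
  "b D1 N1 = den gens (LG 10)"
  "b D1 N2 = den gens (LG 11)"
  "b D2 N0 = den gens (LG 12)"
  "b D2 N1 = den gens (LG 13)"
  "b D2 N2 = den gens (LG 14)"
  "b D3 N0 = den gens (LG 15)"
  "b D3 N1 = den gens (LG 16)"
  "b D3 N2 = den gens (LG 17)"
  "b D4 N0 = den gens (LG 18)"
  "b D4 N1 = den gens (LG 19)"
  "b D4 N2 = den gens (LG 20)"
  "u D1 = den gens (LG 21)"
  "u D2 = den gens (LG 22)"
  "u D3 = den gens (LG 23)"
  by (simp_all add: gens_def)

lemma u_D4: "u D4 = (32/45) *\<^sub>Q sa - u D1 - u D2 - u D3"
  using sum_u by (simp add: sum_dir sa_def algebra_simps)

lemma length_gens: "[0..<length gens] = [0, 1, 2, 3, 4, 5, 6, 7, 8, 9, 10, 11, 12, 13, 14, 15, 16, 17, 18, 19, 20, 21, 22, 23]"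
  by (simp add: gens_def upt_rec)

lemma mul_ab_in': "lam k p = c \<Longrightarrow> a p \<diamondop> b k c =
    (1/8) *\<^sub>Q (a p + b k c - b (perp k) (lam (perp k) p))"
  using mul_ab_in[of p k] by simp

lemma mul_b_a: "b k c \<diamondop> a p = a p \<diamondop> b k c"
  by (rule mul_commute)

lemmas eval_den = gens_den den_fold u_D4 sa_def sum_pt

lemma mul_b_sa: "b k c \<diamondop> sa = (3/32) *\<^sub>Q (aline k c - sb (perp k)) + (15/32) *\<^sub>Q b k c
    - (3/32) *\<^sub>Q (b k (c + 1) + b k (c - 1)) + (135/1024) *\<^sub>Q u k"
  unfolding sa_def sum_pt mul_lin mul_b_a aline_def sb_def
  by (cases k; cases c; simp only: mul_ab_in' mul_ab_out idx_simps;
      simp only: eval_den cong: den_cong; rule den_eqI; simp add: length_gens)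

lemma mul_sa_a: "a p \<diamondop> sa = (45/32) *\<^sub>Q a p"
proof -
  obtain x y where p: "p = (x, y)"
    by fastforce
  have sa: "sa = (45/32) *\<^sub>Q (u D1 + u D2 + u D3 + u D4)"
    using sum_u by (simp add: sum_dir sa_def)
  show ?thesis
    unfolding p by (subst sa; cases x; cases y; simp only: mul_lin mul_au idx_simps;
      simp only: eval_den cong: den_cong; rule den_eqI; simp add: length_gens)
qed

text \<open>The reflection \<open>rho k c\<close> exchanges \<open>u j\<close> and
  \<open>u (perp j)\<close>, so their difference is a 1/32-eigenvector of \<open>b k c\<close>.
  Their sum equals a multiple of \<open>sa\<close> minus \<open>u k\<close> and
  \<open>u (perp k)\<close>, whose products with \<open>b k c\<close> are known. Half of sum plus
  difference gives the claim.\<close>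

lemma mul_bu_skew:
  assumes "j \<noteq> k" "j \<noteq> perp k"
  shows "b k c \<diamondop> u j = (1/30) *\<^sub>Q (aline k c - sb (perp k)) + (1/18) *\<^sub>Q b k c
    + (1/45) *\<^sub>Q (b k (c + 1) + b k (c - 1)) - (1/32) *\<^sub>Q u k + (1/64) *\<^sub>Q (u j - u (perp j))"
proof -
  have *: "act (rho k c) (u j) = u (perp j)" if "j \<noteq> k" "j \<noteq> perp k" for j
  proof (rule act_u[OF rho_in_Kset rho_conj_skew[OF that]])
    show "inj (\<lambda>d. lam (perp j) (rho k c (onl j d)))"
      using that unfolding inj_def all_f3 by (cases j; cases k; cases c; simp)
  qed
  have pj: "perp j \<noteq> k" "perp j \<noteq> perp k"
    using assms by (metis perp_perp)+
  have "act (rho k c) (u j - u (perp j)) = - (u j - u (perp j))"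
    using *[OF assms] *[OF pj] by (simp add: act_diff rho_in_Kset)
  then have 1: "b k c \<diamondop> u j - b k c \<diamondop> u (perp j) = (1/32) *\<^sub>Q (u j - u (perp j))"
    by (simp add: act_rho flip: mul_diff_right)
  have "u k + u (perp k) + u j + u (perp j) = (32/45) *\<^sub>Q sa"
    using sum_u assms unfolding sum_dir sa_def[symmetric] by (cases j; cases k; simp add: ac_simps)
  then have "b k c \<diamondop> (u k + u (perp k) + u j + u (perp j)) = b k c \<diamondop> ((32/45) *\<^sub>Q sa)"
    by simp
  then have 2: "b k c \<diamondop> u j + b k c \<diamondop> u (perp j) = (32/45) *\<^sub>Q (b k c \<diamondop> sa) - b k c \<diamondop> u k"
    using mul_bu_perp[of "perp k" c] by (simp add: mul_lin algebra_simps)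
  define y where "y = b k c \<diamondop> u j"
  define y' where "y' = b k c \<diamondop> u (perp j)"
  have "y = (1/2) *\<^sub>Q ((y + y') + (y - y'))"
  proof -
    have "(y + y') + (y - y') = (1 + 1) *\<^sub>Q y"
      unfolding scale_left_distrib scale_one by simp
    then show ?thesis
      by simp
  qed
  also have "\<dots> = (1/2) *\<^sub>Q ((32/45) *\<^sub>Q (b k c \<diamondop> sa) - b k c \<diamondop> u k + (1/32) *\<^sub>Q (u j - u (perp j)))"
    using 1 2 by (simp add: y_def y'_def)
  also have "\<dots> = (1/30) *\<^sub>Q (aline k c - sb (perp k)) + (1/18) *\<^sub>Q b k c
    + (1/45) *\<^sub>Q (b k (c + 1) + b k (c - 1)) - (1/32) *\<^sub>Q u k + (1/64) *\<^sub>Q (u j - u (perp j))"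
  proof -
    define vs where "vs = [aline k c, sb (perp k), b k c, b k (c + 1), b k (c - 1), u k, u j, u (perp j)]"
    have vs: "aline k c = den vs (LG 0)" "sb (perp k) = den vs (LG 1)" "b k c = den vs (LG 2)"
      "b k (c + 1) = den vs (LG 3)" "b k (c - 1) = den vs (LG 4)" "u k = den vs (LG 5)"
      "u j = den vs (LG 6)" "u (perp j) = den vs (LG 7)"
      by (simp_all add: vs_def)
    show ?thesis
      unfolding mul_b_sa mul_bu unfolding vs den_fold
      by (rule den_eqI) (simp add: vs_def)
  qed
  finally show ?thesis
    by (simp add: y_def)
qed

lemma mul_u_a: "u k \<diamondop> a p = a p \<diamondop> u k" and mul_u_b: "u j \<diamondop> b k c = b k c \<diamondop> u j"
  by (rule mul_commute)+

lemma mul_sa_comm: "sa \<diamondop> a p = a p \<diamondop> sa" "sa \<diamondop> b k c = b k c \<diamondop> sa" "sa \<diamondop> u j = u j \<diamondop> sa"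
  by (rule mul_commute)+

lemma mul_bu_perp': "b D1 c \<diamondop> u D2 = 0" "b D2 c \<diamondop> u D1 = 0" "b D3 c \<diamondop> u D4 = 0" "b D4 c \<diamondop> u D3 = 0"
  using mul_bu_perp[of D1] mul_bu_perp[of D2] mul_bu_perp[of D3] mul_bu_perp[of D4] by simp_all

text \<open>The intersection point of the two lines is made explicit, so that the rule applies to
  arbitrary pairs of labels: \<open>(c, d)\<close> for the first pair of classes,
  \<open>(- c - d, d - c)\<close> for the second.\<close>

lemma mul_bb_perp':
  "b D1 c \<diamondop> b D2 d = (1/8) *\<^sub>Q (b D1 c + b D2 d - a (c, d))"
  "b D3 c \<diamondop> b D4 d = (1/8) *\<^sub>Q (b D3 c + b D4 d - a (- c - d, d - c))"
proof -
  show "b D1 c \<diamondop> b D2 d = (1/8) *\<^sub>Q (b D1 c + b D2 d - a (c, d))"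
    using mul_bb_perp[of D1 "(c, d)"] by simp
  have "lam D3 (- c - d, d - c) = c" "lam D4 (- c - d, d - c) = d"
    by (cases c; cases d; simp)+
  then show "b D3 c \<diamondop> b D4 d = (1/8) *\<^sub>Q (b D3 c + b D4 d - a (- c - d, d - c))"
    using mul_bb_perp[of D3 "(- c - d, d - c)"] by simp
qed

lemma mul_bb_skew':
  "lam k p = c \<Longrightarrow> lam j p = d \<Longrightarrow> j \<noteq> k \<Longrightarrow> j \<noteq> perp k \<Longrightarrow> b k c \<diamondop> b j d =
      (1/64) *\<^sub>Q (b k c + b j d - b (perp k) (lam (perp k) p)
        - b (perp j) (lam (perp j) p) + a p)"
  using mul_bb_skew[of j k p] by simp

lemma mul_bb_skew'':
  "b D1 c \<diamondop> b D3 d = (1/64) *\<^sub>Q (b D1 c + b D3 d - b D2 (d - c) - b D4 (- c - d) + a (c, d - c))"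
  "b D1 c \<diamondop> b D4 d = (1/64) *\<^sub>Q (b D1 c + b D4 d - b D2 (c - d) - b D3 (- c - d) + a (c, c - d))"
  "b D2 c \<diamondop> b D3 d = (1/64) *\<^sub>Q (b D2 c + b D3 d - b D1 (d - c) - b D4 (c + d) + a (d - c, c))"
  "b D2 c \<diamondop> b D4 d = (1/64) *\<^sub>Q (b D2 c + b D4 d - b D1 (d + c) - b D3 (d - c) + a (d + c, c))"
proof -
  have *: "c + (d - c) = d" "c - (c - d) = d" "d - c + c = d" "d + c - c = d"
    "c - (d - c) = - c - d" "c + (c - d) = - c - d" "d - c - c = c + d" "d + c + c = d - c"
    by (cases c; cases d; simp)+
  show "b D1 c \<diamondop> b D3 d = (1/64) *\<^sub>Q (b D1 c + b D3 d - b D2 (d - c) - b D4 (- c - d) + a (c, d - c))"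
    using mul_bb_skew'[of D1 "(c, d - c)" c D3 d] by (simp add: * del: f3_diff)
  show "b D1 c \<diamondop> b D4 d = (1/64) *\<^sub>Q (b D1 c + b D4 d - b D2 (c - d) - b D3 (- c - d) + a (c, c - d))"
    using mul_bb_skew'[of D1 "(c, c - d)" c D4 d] by (simp add: * del: f3_diff)
  show "b D2 c \<diamondop> b D3 d = (1/64) *\<^sub>Q (b D2 c + b D3 d - b D1 (d - c) - b D4 (c + d) + a (d - c, c))"
    using mul_bb_skew'[of D2 "(d - c, c)" c D3 d] by (simp add: * del: f3_diff)
  show "b D2 c \<diamondop> b D4 d = (1/64) *\<^sub>Q (b D2 c + b D4 d - b D1 (d + c) - b D3 (d - c) + a (d + c, c))"
    using mul_bb_skew'[of D2 "(d + c, c)" c D4 d] by (simp add: * del: f3_diff)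
qed

lemma mul_bb_comm: "b D2 c \<diamondop> b D1 d = b D1 d \<diamondop> b D2 c" "b D3 c \<diamondop> b D1 d = b D1 d \<diamondop> b D3 c"
  "b D4 c \<diamondop> b D1 d = b D1 d \<diamondop> b D4 c" "b D3 c \<diamondop> b D2 d = b D2 d \<diamondop> b D3 c"
  "b D4 c \<diamondop> b D2 d = b D2 d \<diamondop> b D4 c" "b D4 c \<diamondop> b D3 d = b D3 d \<diamondop> b D4 c"
  by (rule mul_commute)+

lemmas table = mul_a_self mul_b_self mul_uu mul_uu_distinct mul_aa[where k = D1] mul_aa[where k = D2]
  mul_aa[where k = D3] mul_aa[where k = D4] mul_ab_in' mul_ab_out mul_b_a mul_bb_par mul_bb_perp'
  mul_bb_skew'' mul_bb_comm mul_au mul_u_a mul_u_b mul_bu mul_bu_perp' mul_bu_skew mul_b_sa mul_sa_a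
  mul_sa_comm aline_def sb_def

end

section \<open>Products in an orthogonal basis\<close>

context m9_config
begin

text \<open>Deviation of a line sum from the average over its parallel class; together with the
  \<open>u k\<close> these vectors span the part generated by the point axes.\<close>

definition w :: "dir \<Rightarrow> f3 \<Rightarrow> 'v" where
  "w k c = aline k c - (1/3) *\<^sub>Q sa"

text \<open>The component of \<open>sb k + sb (perp k)\<close> orthogonal to all point axes and
  3A-axes; the factor 16/33 makes it idempotent.\<close>

definition f :: "dir \<Rightarrow> 'v" where
  "f k = (16/33) *\<^sub>Q (sb k + sb (perp k) - (2/15) *\<^sub>Q sa - (9/32) *\<^sub>Q (u k + u (perp k)))"

text \<open>The component of \<open>sb k - sb (perp k)\<close> orthogonal to the \<open>u\<close>
  and \<open>w\<close> vectors.\<close>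

definition dl :: "dir \<Rightarrow> 'v" where
  "dl k = sb k - sb (perp k) - (15/32) *\<^sub>Q (u k - u (perp k))"

text \<open>What is left of \<open>b k c\<close> after its class average and its component along the
  \<open>w\<close> vectors are removed.\<close>

definition x :: "dir \<Rightarrow> f3 \<Rightarrow> 'v" where
  "x k c = b k c - (1/3) *\<^sub>Q sb k - (1/9) *\<^sub>Q w k c"

lemma mul_u_sa: "u j \<diamondop> sa = (45/32) *\<^sub>Q u j"
proof -
  have sa: "sa = (45/32) *\<^sub>Q (u D1 + u D2 + u D3 + u D4)"
    using sum_u by (simp add: sum_dir sa_def)
  show ?thesis
    unfolding sa by (cases j) (simp_all add: mul_lin mul_uu mul_uu_distinct)
qed

lemma mul_sa_sa: "sa \<diamondop> sa = (45/32) *\<^sub>Q sa"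
proof -
  have "sa \<diamondop> sa = (\<Sum>p\<in>UNIV. a p \<diamondop> sa)"
    unfolding mul_sum_left[symmetric] by (simp add: sa_def)
  then show ?thesis
    unfolding mul_sa_a scale_sum_right[symmetric] by (simp add: sa_def)
qed

lemma den_eq_0I: "list_all (\<lambda>i. co i e = 0) [0..<length vs] \<Longrightarrow> den vs e = 0"
  using den_eqI[of e LZ vs] by simp

lemmas eval_den' = eval_den add_0_left add_0_right diff_0 diff_0_right scale_zero_right
lemmas table' = table mul_u_sa mul_sa_sa

text \<open>This and the following evaluations are carried out for one representative of each orbit
  of the affine group; collineations transport them to the other lines and points.\<close>

lemma eval_fa: "f D1 \<diamondop> a (N0, N0) = 0"
  unfolding f_def mul_commute[of _ "a (N0, N0)"]
  apply (simp only: mul_lin table' idx_simps)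
  apply (simp only: eval_den' cong: den_cong)
  apply (rule den_eq_0I)
  apply (simp add: length_gens)
  done

lemma eval_fu: "f D1 \<diamondop> u D1 = 0" "f D1 \<diamondop> u D3 = 0"
  unfolding f_def
  apply (simp_all only: mul_lin table' idx_simps)
  apply (simp_all only: eval_den' cong: den_cong)
  apply (rule den_eq_0I; simp add: length_gens)+
  done

lemma eval_fb: "f D1 \<diamondop> b D1 N0 = (11/32) *\<^sub>Q f D1 + (1/10) *\<^sub>Q dl D1 + (3/5) *\<^sub>Q x D1 N0"
   "f D1 \<diamondop> b D3 N0 = 0"
  unfolding f_def dl_def x_def w_def
  apply (simp_all only: mul_lin table' idx_simps)
  apply (simp_all only: eval_den' cong: den_cong)
  apply (rule den_eqI den_eq_0I; simp add: length_gens)+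
  done

lemma eval_ww: "w D1 N0 \<diamondop> w D1 N0 = (405/1024) *\<^sub>Q (u D1 + u D3 + u D4) + (3/8) *\<^sub>Q w D1 N0"
    "w D1 N0 \<diamondop> w D2 N0 = (9/32) *\<^sub>Q (w D3 N0 + w D4 N0)"
  unfolding w_def
  apply (simp_all only: mul_lin table' idx_simps)
  apply (simp_all only: eval_den' cong: den_cong)
  apply (rule den_eqI; simp add: length_gens)+
  done

lemma eval_xx: "x D1 N0 \<diamondop> x D1 N0 = (65/512) *\<^sub>Q u D1 + (13/1024) *\<^sub>Q (u D3 + u D4) + (13/432) *\<^sub>Q w D1 N0
    + (99/512) *\<^sub>Q f D1 + (7/96) *\<^sub>Q dl D1 + (7/24) *\<^sub>Q x D1 N0"
  unfolding w_def x_def f_def dl_def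
  apply (simp_all only: mul_lin table' idx_simps)
  apply (simp_all only: eval_den' cong: den_cong)
  apply (rule den_eqI; simp add: length_gens)
  done

lemma eval_wdl: "w D1 N0 \<diamondop> dl D1 = (9/16) *\<^sub>Q x D1 N0"
  unfolding w_def x_def f_def dl_def
  apply (simp_all only: mul_lin table' idx_simps)
  apply (simp_all only: eval_den' cong: den_cong)
  apply (rule den_eqI; simp add: length_gens)
  done

lemma eval_dldl: "dl D1 \<diamondop> dl D1 = (117/256) *\<^sub>Q (u D3 + u D4) + (297/256) *\<^sub>Q f D1"
  unfolding w_def x_def f_def dl_def
  apply (simp_all only: mul_lin table' idx_simps)
  apply (simp_all only: eval_den' cong: den_cong)
  apply (rule den_eqI; simp add: length_gens)
  done

end

section \<open>Transport of products by collineations\<close>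

lemma kmap_inj:
  assumes "c \<noteq> 0"
  shows "inj (kmap c s d)"
proof (rule injI)
  fix p q
  assume *: "kmap c s d p = kmap c s d q"
  obtain c1 c2 d1 d2 x y x' y' where eqs: "c = (c1, c2)" "d = (d1, d2)" "p = (x, y)" "q = (x', y')"
    by (metis surj_pair)
  define y1 where "y1 = (if s then - y else y)"
  define y2 where "y2 = (if s then - y' else y')"
  have "c1 * x - c2 * y1 = c1 * x' - c2 * y2" "c2 * x + c1 * y1 = c2 * x' + c1 * y2"
    using * by (simp_all add: eqs y1_def y2_def Let_def)
  moreover define X Y where "X = x - x'" and "Y = y1 - y2"
  moreover have "c1 * X - c2 * Y = (c1 * x - c2 * y1) - (c1 * x' - c2 * y2)"
    "c2 * X + c1 * Y = (c2 * x + c1 * y1) - (c2 * x' + c1 * y2)"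
    unfolding X_def Y_def by (simp_all add: algebra_simps)
  ultimately have "c1 * X - c2 * Y = 0" "c2 * X + c1 * Y = 0"
    by (metis right_minus_eq)+
  with assms have "X = N0 \<and> Y = N0"
    unfolding eqs zero_prod_def by (cases c1; cases c2; cases X; cases Y; simp)
  then have "x = x'" "y1 = y2"
    unfolding X_def Y_def by (metis eq_iff_diff_eq_0 zero_f3_def)+
  then show "p = q"
    by (simp add: eqs y1_def y2_def split: if_splits)
qed

lemma Kset_bij: "g \<in> Kset \<Longrightarrow> bij g"
  using kmap_inj finite_UNIV_inj_surj[of g] by (auto simp: Kset_def bij_def)

text \<open>\<open>line_map g s h\<close>: the collineation \<open>g\<close> maps the line \<open>(k, c)\<close> to \<open>(s k, h k c)\<close>.\<close>

definition line_map :: "(pt \<Rightarrow> pt) \<Rightarrow> (dir \<Rightarrow> dir) \<Rightarrow> (dir \<Rightarrow> f3 \<Rightarrow> f3) \<Rightarrow> bool" where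
  "line_map g s h \<longleftrightarrow> g \<in> Kset \<and> (\<forall>k. s (perp k) = perp (s k)) \<and> (\<forall>k. inj (h k)) \<and>
    (\<forall>k p. lam (s k) (g p) = h k (lam k p)) \<and> (\<forall>k c. g \<circ> rho k c = rho (s k) (h k c) \<circ> g)"

lemma exists_lam: "\<exists>p. lam k p = d"
  by (rule exI[of _ "case k of D2 \<Rightarrow> (N0, d) | _ \<Rightarrow> (d, N0)"]) (cases k; simp)

lemma line_mapI:
  assumes "g = kmap c t d" "c \<noteq> 0" "\<And>k. s (perp k) = perp (s k)"
    and "\<And>k p. lam (s k) (g p) = h k (lam k p)"
    and "\<And>k c. g \<circ> rho k c = rho (s k) (h k c) \<circ> g"
  shows "line_map g s h"
  unfolding line_map_def
proof (intro conjI allI)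
  show g: "g \<in> Kset"
    using assms(1,2) by (rule KsetI)
  fix k
  have "\<exists>d. y = h k d" for y
  proof -
    obtain q where q: "lam (s k) q = y"
      using exists_lam by metis
    obtain p where "q = g p"
      using Kset_bij[OF g] by (metis bij_pointE)
    with q assms(4) show ?thesis
      by metis
  qed
  then have "surj (h k)"
    by (simp add: surj_def)
  then show "inj (h k)"
    by (simp add: finite_UNIV_surj_inj)
qed (use assms in auto)

text \<open>Multiplication by \<open>drot k\<close> in the field with nine elements sends class
  \<open>j\<close> to class \<open>dsh k j\<close>, and \<open>dsg k j\<close> is the sign by which
  it changes the linear form \<open>lam\<close>. In particular \<open>dsh k D1 = k\<close>.\<close>

fun dsh :: "dir \<Rightarrow> dir \<Rightarrow> dir" where
  "dsh D1 k = k"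
| "dsh D2 k = perp k"
| "dsh D3 D1 = D3" | "dsh D3 D2 = D4" | "dsh D3 D3 = D2" | "dsh D3 D4 = D1"
| "dsh D4 D1 = D4" | "dsh D4 D2 = D3" | "dsh D4 D3 = D1" | "dsh D4 D4 = D2"

fun dsg :: "dir \<Rightarrow> dir \<Rightarrow> f3" where
  "dsg D1 _ = N1"
| "dsg D2 D1 = N1" | "dsg D2 D2 = N2" | "dsg D2 D3 = N2" | "dsg D2 D4 = N1"
| "dsg D3 D1 = N2" | "dsg D3 _ = N1"
| "dsg D4 D3 = N1" | "dsg D4 _ = N2"

fun drot :: "dir \<Rightarrow> pt" where
  "drot D1 = (N1, N0)" | "drot D2 = (N0, N1)" | "drot D3 = (N1, N1)" | "drot D4 = (N1, N2)"

lemma line_map_dsh: "line_map (kmap (drot k) False p) (dsh k) (\<lambda>j d. dsg k j * d + lam (dsh k j) p)"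
proof (rule line_mapI[OF refl])
  show "drot k \<noteq> 0"
    by (cases k; simp add: zero_prod_def)
  show "dsh k (perp j) = perp (dsh k j)" for j
    by (cases k; cases j; simp)
  obtain p1 p2 where p: "p = (p1, p2)"
    by fastforce
  show lam: "lam (dsh k j) (kmap (drot k) False p q) = dsg k j * lam j q + lam (dsh k j) p" for j q
    unfolding p by (cases q; cases k; cases j; cases "fst q"; cases "snd q"; cases p1; cases p2; simp)
  show "kmap (drot k) False p \<circ> rho j c =
     rho (dsh k j) (dsg k j * c + lam (dsh k j) p) \<circ> kmap (drot k) False p" for j c
    unfolding p fun_eq_iff split_paired_all
    by (cases k; cases j; cases c; cases p1; cases p2; simp add: all_f3)
qed

text \<open>These collineations carry class \<open>D1\<close> to any class and the origin to any
  point, so an identity checked at the origin for \<open>D1\<close> holds in general.\<close>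

lemma line_map_all:
  obtains g h where "line_map g (dsh k) h" "g 0 = p" "h D1 N0 = lam k p" "h D3 N0 = lam (dsh k D3) p"
    "h D2 N0 = lam (perp k) p"
proof
  show "line_map (kmap (drot k) False p) (dsh k) (\<lambda>j d. dsg k j * d + lam (dsh k j) p)"
    by (rule line_map_dsh)
  show "kmap (drot k) False p 0 = p"
    by (cases p; cases "drot k") (simp add: zero_prod_def)
qed (cases k; simp)+

context m9_config
begin

text \<open>Free of the base point and of the spanning vector, so equivariance becomes a reindexing
  of the points of a line.\<close>

lemma aline_sum: "aline k c = (\<Sum>p | lam k p = c. a p)"
proof -
  have "(\<Sum>p | lam k p = c. a p) = (\<Sum>p\<in>UNIV. if lam k p = c then a p else 0)"
    by (simp add: sum.If_cases)
  then show ?thesis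
    unfolding sum_pt aline_def by (cases k; cases c; simp add: zero_prod_def ac_simps)
qed

context
  fixes g s h
  assumes lm: "line_map g s h"
begin

lemma lmK: "g \<in> Kset" and lm_perp: "s (perp k) = perp (s k)" and lm_inj: "inj (h k)"
  and lm_lam: "lam (s k) (g p) = h k (lam k p)"
  and lm_rho: "g \<circ> rho k c = rho (s k) (h k c) \<circ> g"
  using lm unfolding line_map_def by blast+

lemma act_zero: "act g 0 = 0"
  using act_diff[OF lmK, of 0 0] by simp

lemma act_sum: "act g (\<Sum>i\<in>I. F i) = (\<Sum>i\<in>I. act g (F i))"
  by (induction I rule: infinite_finite_induct) (auto simp: act_add lmK act_zero)

lemma act_b': "act g (b k c) = b (s k) (h k c)"
  by (rule act_b[OF lmK lm_rho])

lemma act_u': "act g (u k) = u (s k)"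
  by (rule act_u[OF lmK lm_rho lm_inj])

lemma act_sa: "act g sa = sa"
  using sum.reindex_bij_betw[OF Kset_bij[OF lmK], of a] by (simp add: sa_def act_sum act_a lmK)

lemma act_sb: "act g (sb k) = sb (s k)"
proof -
  have "bij (h k)"
    using lm_inj[of k] finite_UNIV_inj_surj[of "h k"] by (simp add: bij_def)
  then have "(\<Sum>c\<in>UNIV. b (s k) (h k c)) = (\<Sum>c\<in>UNIV. b (s k) c)"
    by (rule sum.reindex_bij_betw)
  then show ?thesis
    by (simp add: sb_def act_add lmK act_b' sum_f3)
qed

lemma act_aline: "act g (aline k c) = aline (s k) (h k c)"
proof -
  have "bij_betw g {p. lam k p = c} {p. lam (s k) p = h k c}"
    using Kset_bij[OF lmK] lm_inj[of k] unfolding bij_betw_def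
    by (auto simp: lm_lam inj_eq intro!: inj_on_subset[of g UNIV]) (metis (mono_tags, lifting) UNIV_I image_iff lm_lam mem_Collect_eq inj_eq)
  then have "(\<Sum>p | lam k p = c. a (g p)) = (\<Sum>p | lam (s k) p = h k c. a p)"
    by (rule sum.reindex_bij_betw)
  then show ?thesis
    by (simp add: aline_sum act_sum act_a lmK)
qed

lemma act_w: "act g (w k c) = w (s k) (h k c)"
  by (simp add: w_def act_diff act_scale lmK act_aline act_sa)

lemma act_f: "act g (f k) = f (s k)"
  by (simp add: f_def act_diff act_scale act_add lmK act_sb act_sa act_u' lm_perp)

lemma act_dl: "act g (dl k) = dl (s k)"
  by (simp add: dl_def act_diff act_scale act_add lmK act_sb act_sa act_u' lm_perp)

lemma act_x: "act g (x k c) = x (s k) (h k c)"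
  by (simp add: x_def act_diff act_scale act_add lmK act_sb act_b' act_w)

lemmas act_all = act_mul[OF lmK] act_add[OF lmK] act_diff[OF lmK] act_scale[OF lmK] act_zero
  act_a[OF lmK] act_b' act_u' act_w act_f act_dl act_x act_sa act_sb

end

text \<open>By \<open>sum_u\<close> this is the sum of the four 3A-axes; it acts as the identity on
  the \<open>u\<close> and \<open>w\<close> vectors.\<close>

definition es :: 'v where
  "es = (32/45) *\<^sub>Q sa"

lemma es_eq: "j \<noteq> k \<Longrightarrow> j \<noteq> perp k \<Longrightarrow> es = u k + u (perp k) + u j + u (perp j)"
  using sum_u unfolding sum_dir sa_def[symmetric] es_def by (cases j; cases k; simp add: ac_simps)

lemma f_perp [simp]: "f (perp k) = f k"
  by (simp add: f_def add.commute)

lemma dl_perp [simp]: "dl (perp k) = - dl k"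
  by (simp add: dl_def algebra_simps)

lemma f_a: "f k \<diamondop> a p = 0"
proof -
  obtain g h where lm: "line_map g (dsh k) h" "g 0 = p"
    by (metis line_map_all)
  have "act g (f D1 \<diamondop> a (N0, N0)) = act g 0"
    by (simp add: eval_fa)
  then show ?thesis
    using lm(2) by (cases k) (simp_all add: act_all[OF lm(1)] zero_prod_def)
qed

lemma f_u: "f k \<diamondop> u j = 0"
proof -
  have 1: "f k \<diamondop> u k = 0" "f k \<diamondop> u (dsh k D3) = 0" for k
  proof -
    obtain g h where lm: "line_map g (dsh k) h"
      by (metis line_map_all)
    have "act g (f D1 \<diamondop> u D1) = act g 0" "act g (f D1 \<diamondop> u D3) = act g 0"
      by (simp_all add: eval_fu)
    then show "f k \<diamondop> u k = 0" "f k \<diamondop> u (dsh k D3) = 0"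
      by (cases k; simp add: act_all[OF lm])+
  qed
  show ?thesis
    using 1[of D1] 1[of D2] 1[of D3] 1[of D4] f_perp[of D1] f_perp[of D3]
    by (cases j; cases k; simp)
qed

lemma f_b: "f k \<diamondop> b k c = (11/32) *\<^sub>Q f k + (1/10) *\<^sub>Q dl k + (3/5) *\<^sub>Q x k c"
proof -
  obtain p where p: "lam k p = c"
    using exists_lam by metis
  obtain g h where lm: "line_map g (dsh k) h" "h D1 N0 = lam k p"
    by (metis line_map_all)
  have "act g (f D1 \<diamondop> b D1 N0) = act g ((11/32) *\<^sub>Q f D1 + (1/10) *\<^sub>Q dl D1 + (3/5) *\<^sub>Q x D1 N0)"
    by (simp add: eval_fb)
  then show ?thesis
    using lm(2) p by (cases k) (simp_all add: act_all[OF lm(1)])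
qed

lemma f_b_skew:
  assumes "j \<noteq> k" "j \<noteq> perp k"
  shows "f k \<diamondop> b j c = 0"
proof -
  have 1: "f k \<diamondop> b (dsh k D3) c = 0" for k
  proof -
    obtain p where p: "lam (dsh k D3) p = c"
      using exists_lam by metis
    obtain g h where lm: "line_map g (dsh k) h" "h D3 N0 = lam (dsh k D3) p"
      by (metis line_map_all)
    have "act g (f D1 \<diamondop> b D3 N0) = act g 0"
      by (simp add: eval_fb)
    then show ?thesis
      using lm(2) p by (cases k) (simp_all add: act_all[OF lm(1)])
  qed
  show ?thesis
    using 1[of D1] 1[of D2] 1[of D3] 1[of D4] f_perp[of D1] f_perp[of D3] assms
    by (cases j; cases k; simp)
qed

lemma w_w: "w k c \<diamondop> w k c = (405/1024) *\<^sub>Q (es - u (perp k)) + (3/8) *\<^sub>Q w k c"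
proof -
  obtain p where p: "lam k p = c"
    using exists_lam by metis
  obtain g h where lm: "line_map g (dsh k) h" "h D1 N0 = lam k p"
    by (metis line_map_all)
  have e: "u D1 + u D3 + u D4 = es - u D2"
    using es_eq[of D3 D1] by (simp add: algebra_simps)
  have es: "act g es = es"
    by (simp add: es_def act_all[OF lm(1)])
  have "act g (w D1 N0 \<diamondop> w D1 N0) = act g ((405/1024) *\<^sub>Q (es - u D2) + (3/8) *\<^sub>Q w D1 N0)"
    unfolding e[symmetric] by (simp add: eval_ww)
  then show ?thesis
    using lm(2) p by (cases k) (simp_all add: act_all[OF lm(1)] es)
qed

text \<open>The lines x = i and y = j meet in \<open>(i, j)\<close>, and the right-hand side
  consists of the other two lines through that point. The algebra thus remembers the incidence
  structure of the plane.\<close>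

lemma w_w_D1_D2: "w D1 i \<diamondop> w D2 j = (9/32) *\<^sub>Q (w D3 (i + j) + w D4 (i - j))"
proof -
  note lm = line_map_dsh[of D1 "(i, j)"]
  have "act (kmap (drot D1) False (i, j)) (w D1 N0 \<diamondop> w D2 N0) =
      act (kmap (drot D1) False (i, j)) ((9/32) *\<^sub>Q (w D3 N0 + w D4 N0))"
    by (simp add: eval_ww)
  then show ?thesis
    unfolding act_all[OF lm] by simp
qed

text \<open>The terms linear in \<open>dl k\<close> and \<open>x k c\<close> later exclude an
  automorphism that changes the sign of both.\<close>

lemma x_x: "x k c \<diamondop> x k c = (65/512) *\<^sub>Q u k + (13/1024) *\<^sub>Q (es - u k - u (perp k)) + (13/432) *\<^sub>Q w k c
    + (99/512) *\<^sub>Q f k + (7/96) *\<^sub>Q dl k + (7/24) *\<^sub>Q x k c"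
proof -
  obtain p where p: "lam k p = c"
    using exists_lam by metis
  obtain g h where lm: "line_map g (dsh k) h" "h D1 N0 = lam k p"
    by (metis line_map_all)
  have e: "u D3 + u D4 = es - u D1 - u D2"
    using es_eq[of D3 D1] by (simp add: algebra_simps)
  have es: "act g es = es"
    by (simp add: es_def act_all[OF lm(1)])
  have "act g (x D1 N0 \<diamondop> x D1 N0) = act g ((65/512) *\<^sub>Q u D1 + (13/1024) *\<^sub>Q (es - u D1 - u D2)
      + (13/432) *\<^sub>Q w D1 N0 + (99/512) *\<^sub>Q f D1 + (7/96) *\<^sub>Q dl D1 + (7/24) *\<^sub>Q x D1 N0)"
    unfolding e[symmetric] by (simp add: eval_xx)
  then show ?thesis
    using lm(2) p by (cases k) (simp_all add: act_all[OF lm(1)] es)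
qed

lemma dl_dl: "dl k \<diamondop> dl k = (117/256) *\<^sub>Q (es - u k - u (perp k)) + (297/256) *\<^sub>Q f k"
proof -
  obtain g h where lm: "line_map g (dsh k) h"
    by (metis line_map_all)
  have e: "u D3 + u D4 = es - u D1 - u D2"
    using es_eq[of D3 D1] by (simp add: algebra_simps)
  have es: "act g es = es"
    by (simp add: es_def act_all[OF lm])
  have "act g (dl D1 \<diamondop> dl D1) = act g ((117/256) *\<^sub>Q (es - u D1 - u D2) + (297/256) *\<^sub>Q f D1)"
    unfolding e[symmetric] by (simp add: eval_dldl)
  then show ?thesis
    by (cases k) (simp_all add: act_all[OF lm] es)
qed

lemma w_dl: "w k c \<diamondop> dl k = (9/16) *\<^sub>Q x k c"
proof -
  obtain p where p: "lam k p = c"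
    using exists_lam by metis
  obtain g h where lm: "line_map g (dsh k) h" "h D1 N0 = lam k p"
    by (metis line_map_all)
  have "act g (w D1 N0 \<diamondop> dl D1) = act g ((9/16) *\<^sub>Q x D1 N0)"
    by (simp add: eval_wdl)
  then show ?thesis
    using lm(2) p by (cases k) (simp_all add: act_all[OF lm(1)])
qed

end

section \<open>Multiplication by the idempotents \<open>u k\<close> and \<open>f k\<close>\<close>

context m9_config
begin

lemma sum_aline: "aline k N0 + aline k N1 + aline k N2 = sa"
  unfolding sa_def sum_pt aline_def by (cases k; simp add: zero_prod_def ac_simps)

lemma sum_w: "w k N0 + w k N1 + w k N2 = 0"
proof -
  have "w k N0 + w k N1 + w k N2 = (aline k N0 + aline k N1 + aline k N2) - (1/3 + 1/3 + 1/3) *\<^sub>Q sa"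
    unfolding w_def scale_left_distrib by (simp add: algebra_simps)
  then show ?thesis
    by (simp add: sum_aline)
qed

lemma sum_x: "x k N0 + x k N1 + x k N2 = 0"
proof -
  have "x k N0 + x k N1 + x k N2 = sb k - (1/3 + 1/3 + 1/3) *\<^sub>Q sb k - (1/9) *\<^sub>Q (w k N0 + w k N1 + w k N2)"
    unfolding x_def scale_left_distrib by (simp add: sb_def[of k] algebra_simps)
  then show ?thesis
    by (simp add: sum_w)
qed

lemma u_aline: "u (perp k) \<diamondop> aline k c = (15/32) *\<^sub>Q u (perp k)"
  unfolding aline_def
  by (cases k; cases c; simp only: mul_lin table' idx_simps; simp only: eval_den' cong: den_cong;
      rule den_eqI; simp add: length_gens)

lemma u_w_perp: "u (perp k) \<diamondop> w k c = 0"
  by (simp add: w_def mul_lin u_aline mul_u_sa)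

lemma u_w: "j \<noteq> perp k \<Longrightarrow> u j \<diamondop> w k c = (1/3) *\<^sub>Q w k c"
  unfolding w_def aline_def
  by (cases k; cases j; cases c; simp only: mul_lin table' idx_simps; (simp only: eval_den' cong: den_cong)?;
      (rule den_eqI)?; simp add: length_gens)

lemma u_b: "u k \<diamondop> b k c = (5/32) *\<^sub>Q u k + (1/27) *\<^sub>Q w k c + (1/3) *\<^sub>Q x k c"
proof -
  define vs where "vs = [u k, w k c, b k c, b k (c + 1), b k (c - 1)]"
  have vs: "u k = den vs (LG 0)" "w k c = den vs (LG 1)" "b k c = den vs (LG 2)"
      "b k (c + 1) = den vs (LG 3)" "b k (c - 1) = den vs (LG 4)"
    by (simp_all add: vs_def)
  have sb: "sb k = b k c + b k (c + 1) + b k (c - 1)"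
    by (cases c) (simp_all add: sb_def ac_simps)
  show ?thesis
    unfolding mul_u_b mul_bu x_def sb unfolding vs den_fold
    by (rule den_eqI) (simp add: vs_def)
qed

lemma u_b_perp: "u (perp k) \<diamondop> b k c = 0"
  using mul_bu_perp[of "perp k"] by (simp add: mul_commute)

lemma u_b_skew:
  assumes "j \<noteq> k" "j \<noteq> perp k"
  shows "u j \<diamondop> b k c = (1/32) *\<^sub>Q u j + (1/27) *\<^sub>Q w k c + (1/30) *\<^sub>Q dl k + (1/30) *\<^sub>Q x k c"
proof -
  define vs where "vs = [u k, u (perp k), u j, aline k c, b k c, b k (c + 1), b k (c - 1), sb (perp k), u (perp j)]"
  have vs: "u k = den vs (LG 0)" "u (perp k) = den vs (LG 1)" "u j = den vs (LG 2)" "aline k c = den vs (LG 3)"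
    "b k c = den vs (LG 4)" "b k (c + 1) = den vs (LG 5)" "b k (c - 1) = den vs (LG 6)"
    "sb (perp k) = den vs (LG 7)" "u (perp j) = den vs (LG 8)"
    by (simp_all add: vs_def)
  have sb: "sb k = b k c + b k (c + 1) + b k (c - 1)"
    by (cases c) (simp_all add: sb_def ac_simps)
  have "sa = (45/32) *\<^sub>Q es"
    by (simp add: es_def)
  then have sa: "sa = (45/32) *\<^sub>Q (u k + u (perp k) + u j + u (perp j))"
    using es_eq[OF assms] by simp
  show ?thesis
    unfolding mul_u_b mul_bu_skew[OF assms] x_def w_def dl_def sb sa unfolding vs den_fold
    by (rule den_eqI) (simp add: vs_def)
qed

lemma u_sb: "u k \<diamondop> sb k = (15/32) *\<^sub>Q u k"
proof -
  have "u k \<diamondop> sb k = (5/32 + 5/32 + 5/32) *\<^sub>Q u k + (1/27) *\<^sub>Q (w k N0 + w k N1 + w k N2)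
     + (1/3) *\<^sub>Q (x k N0 + x k N1 + x k N2)"
    unfolding sb_def mul_add_right u_b scale_left_distrib scale_right_distrib by (simp add: ac_simps)
  then show ?thesis
    by (simp add: sum_w sum_x)
qed

lemma u_sb_perp: "u (perp k) \<diamondop> sb k = 0"
  by (simp add: sb_def mul_add_right u_b_perp)

lemma u_sb_skew:
  assumes "j \<noteq> k" "j \<noteq> perp k"
  shows "u j \<diamondop> sb k = (3/32) *\<^sub>Q u j + (1/10) *\<^sub>Q dl k"
proof -
  have "u j \<diamondop> sb k = (1/32 + 1/32 + 1/32) *\<^sub>Q u j + (1/27) *\<^sub>Q (w k N0 + w k N1 + w k N2)
     + (1/30 + 1/30 + 1/30) *\<^sub>Q dl k + (1/30) *\<^sub>Q (x k N0 + x k N1 + x k N2)"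
    unfolding sb_def mul_add_right u_b_skew[OF assms] scale_left_distrib scale_right_distrib
    by (simp add: ac_simps)
  then show ?thesis
    by (simp add: sum_w sum_x)
qed

lemma u_x: "u k \<diamondop> x k c = (1/3) *\<^sub>Q x k c"
  unfolding x_def[of k c] mul_diff_right mul_scale_right u_b u_sb u_w[of k k c, OF perp_neq(2)]
  by (simp add: x_def[of k c] algebra_simps)

lemma u_x_perp: "u (perp k) \<diamondop> x k c = 0"
  by (simp add: x_def mul_lin u_b_perp u_sb_perp u_w_perp)

lemma u_x_skew:
  assumes "j \<noteq> k" "j \<noteq> perp k"
  shows "u j \<diamondop> x k c = (1/30) *\<^sub>Q x k c"
proof -
  have "u j \<diamondop> x k c = (1/32) *\<^sub>Q u j + (1/27) *\<^sub>Q w k c + (1/30) *\<^sub>Q dl k + (1/30) *\<^sub>Q x k c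
     - (1/3) *\<^sub>Q ((3/32) *\<^sub>Q u j + (1/10) *\<^sub>Q dl k) - (1/9) *\<^sub>Q ((1/3) *\<^sub>Q w k c)"
    unfolding x_def[of k c] mul_diff_right mul_scale_right u_b_skew[OF assms] u_sb_skew[OF assms]
      u_w[OF assms(2)] by (simp add: x_def)
  then show ?thesis
    by (simp add: scale_right_distrib)
qed

lemma u_dl: "u k \<diamondop> dl k = 0"
  using mul_uu_distinct[of k "perp k"] u_sb[of k] u_sb_perp[of "perp k"]
  by (simp add: dl_def mul_diff_right mul_scale_right mul_uu)

lemma u_dl_perp: "u (perp k) \<diamondop> dl k = 0"
  using u_dl[of "perp k"] by (simp add: mul_minus_right)

lemma u_dl_skew:
  assumes "j \<noteq> k" "j \<noteq> perp k"
  shows "u j \<diamondop> dl k = (1/5) *\<^sub>Q dl k"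
proof -
  have p: "j \<noteq> perp k" "j \<noteq> perp (perp k)"
    using assms by auto
  have "u j \<diamondop> dl k = (1/10) *\<^sub>Q dl k + (1/10) *\<^sub>Q dl k"
    unfolding dl_def[of k] mul_diff_right mul_scale_right u_sb_skew[OF assms] u_sb_skew[OF p]
    using assms by (simp add: mul_uu_distinct dl_def[of k, symmetric])
  then show ?thesis
    by (simp flip: scale_left_distrib)
qed

lemma f_sa: "f k \<diamondop> sa = 0"
  by (simp add: sa_def mul_sum_right f_a)

lemma f_w: "f k \<diamondop> w j c = 0"
  by (simp add: w_def aline_def mul_lin f_a f_sa)

lemma f_sb: "f k \<diamondop> sb k = (33/32) *\<^sub>Q f k + (3/10) *\<^sub>Q dl k"
proof -
  have "f k \<diamondop> sb k = (11/32 + 11/32 + 11/32) *\<^sub>Q f k + (1/10 + 1/10 + 1/10) *\<^sub>Q dl k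
     + (3/5) *\<^sub>Q (x k N0 + x k N1 + x k N2)"
    unfolding sb_def mul_add_right f_b scale_left_distrib scale_right_distrib by (simp add: ac_simps)
  then show ?thesis
    by (simp add: sum_x)
qed

lemma f_sb_perp: "f k \<diamondop> sb (perp k) = (33/32) *\<^sub>Q f k - (3/10) *\<^sub>Q dl k"
  using f_sb[of "perp k"] by simp

lemma f_sb_skew: "j \<noteq> k \<Longrightarrow> j \<noteq> perp k \<Longrightarrow> f k \<diamondop> sb j = 0"
  by (simp add: sb_def mul_add_right f_b_skew)

lemma f_x: "f k \<diamondop> x k c = (3/5) *\<^sub>Q x k c"
proof -
  have "f k \<diamondop> x k c = (11/32) *\<^sub>Q f k + (1/10) *\<^sub>Q dl k + (3/5) *\<^sub>Q x k c
     - (1/3) *\<^sub>Q ((33/32) *\<^sub>Q f k + (3/10) *\<^sub>Q dl k)"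
    unfolding x_def[of k c] mul_diff_right mul_scale_right f_b f_sb f_w by (simp add: x_def)
  then show ?thesis
    by (simp add: scale_right_distrib)
qed

lemma f_x_skew: "j \<noteq> k \<Longrightarrow> j \<noteq> perp k \<Longrightarrow> f k \<diamondop> x j c = 0"
  by (simp add: x_def mul_lin f_b_skew f_sb_skew f_w)

lemma f_dl: "f k \<diamondop> dl k = (3/5) *\<^sub>Q dl k"
proof -
  have "f k \<diamondop> dl k = (3/10 + 3/10) *\<^sub>Q dl k"
    unfolding dl_def[of k] mul_diff_right mul_scale_right f_sb f_sb_perp f_u scale_left_distrib
    by (simp add: dl_def[of k, symmetric])
  then show ?thesis by simp
qed

lemma f_dl_skew:
  assumes "j \<noteq> k" "j \<noteq> perp k"
  shows "f k \<diamondop> dl j = 0"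
proof -
  have "perp j \<noteq> k" "perp j \<noteq> perp k"
    using assms by (metis perp_perp)+
  then show ?thesis
    unfolding dl_def[of j] using assms by (simp add: mul_lin f_sb_skew f_u)
qed

lemma f_f: "f k \<diamondop> f k = f k"
proof -
  have "f k \<diamondop> f k = f k \<diamondop> ((16/33) *\<^sub>Q (sb k + sb (perp k) - (2/15) *\<^sub>Q sa - (9/32) *\<^sub>Q (u k + u (perp k))))"
    by (simp add: f_def[of k])
  also have "\<dots> = (16/33) *\<^sub>Q ((33/32 + 33/32) *\<^sub>Q f k)"
    unfolding mul_scale_right mul_diff_right mul_add_right f_sb f_sb_perp f_sa f_u scale_left_distrib
    by simp
  finally show ?thesis by simp
qed

lemma f_f_skew:
  assumes "j \<noteq> k" "j \<noteq> perp k"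
  shows "f k \<diamondop> f j = 0"
proof -
  have "perp j \<noteq> k" "perp j \<noteq> perp k"
    using assms by (metis perp_perp)+
  then show ?thesis
    unfolding f_def[of j] using assms by (simp add: mul_lin f_sb_skew f_sa f_u)
qed

lemma es_u: "es \<diamondop> u k = u k"
  by (simp add: es_def mul_scale_left mul_sa_comm mul_u_sa)

lemma es_sum: "es = (\<Sum>k\<in>UNIV. u k)"
  by (simp add: sum_u es_def sa_def)

text \<open>Inverts the definitions of \<open>f\<close>, \<open>dl\<close> and \<open>x\<close>, so
  that the line axes are seen to lie in the span of the new vectors; \<open>a_eq\<close> does the
  same for the point axes.\<close>

lemma b_eq: "b k c = (1/8) *\<^sub>Q u k - (1/32) *\<^sub>Q u (perp k) + (1/32) *\<^sub>Q es + (1/9) *\<^sub>Q w k c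
    + (11/32) *\<^sub>Q f k + (1/6) *\<^sub>Q dl k + x k c"
proof -
  define vs where "vs = [u k, u (perp k), sa, sb k, sb (perp k), b k c, w k c]"
  have vs: "u k = den vs (LG 0)" "u (perp k) = den vs (LG 1)" "sa = den vs (LG 2)"
    "sb k = den vs (LG 3)" "sb (perp k) = den vs (LG 4)" "b k c = den vs (LG 5)" "w k c = den vs (LG 6)"
    by (simp_all add: vs_def)
  show ?thesis
    unfolding x_def f_def dl_def es_def unfolding vs den_fold
    by (rule den_eqI) (simp add: vs_def)
qed

lemma a_eq: "a p = (5/32) *\<^sub>Q es + (1/3) *\<^sub>Q (w D1 (lam D1 p) + w D2 (lam D2 p) + w D3 (lam D3 p) + w D4 (lam D4 p))"
  unfolding w_def aline_def es_def
  by (cases p; cases "fst p"; cases "snd p"; simp only: mul_lin table' idx_simps fst_conv snd_conv; simp only: eval_den' cong: den_cong;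
      rule den_eqI; simp add: length_gens)

end

section \<open>A tight frame and the dimension\<close>

text \<open>Indexes a symmetric but redundant system: three \<open>w\<close> and three
  \<open>x\<close> vectors per class in a plane, each \<open>f\<close> vector listed twice, and each
  \<open>dl\<close> vector together with its negative.\<close>

datatype ni = Iu dir | Iw dir f3 | If dir | Id dir | Ix dir f3

lemma UNIV_ni: "UNIV = range Iu \<union> (range (\<lambda>(k, c). Iw k c) \<union> (range If \<union> (range Id \<union> range (\<lambda>(k, c). Ix k c))))"
  by (auto; metis (mono_tags, lifting) case_prod_conv ni.exhaust range_eqI)

instance ni :: finite
  by standard (simp add: UNIV_ni)

lemma sum_ni: "(\<Sum>i\<in>UNIV. g i) = (\<Sum>k\<in>UNIV. g (Iu k)) + ((\<Sum>k\<in>UNIV. \<Sum>c\<in>UNIV. g (Iw k c))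
   + ((\<Sum>k\<in>UNIV. g (If k)) + ((\<Sum>k\<in>UNIV. g (Id k)) + (\<Sum>k\<in>UNIV. \<Sum>c\<in>UNIV. g (Ix k c)))))"
  for g :: "ni \<Rightarrow> 'b :: comm_monoid_add"
proof -
  have r: "(\<Sum>i\<in>range (\<lambda>(k, c). h k c). g i) = (\<Sum>k\<in>UNIV. \<Sum>c\<in>UNIV. g (h k c))"
    if "inj (\<lambda>(k, c). h k c)" for h :: "dir \<Rightarrow> f3 \<Rightarrow> ni"
  proof -
    have "(\<Sum>i\<in>range (\<lambda>(k, c). h k c). g i) = (\<Sum>(k, c)\<in>UNIV \<times> UNIV. g (h k c))"
      unfolding sum.reindex[OF that] comp_def by (simp add: case_prod_beta')
    then show ?thesis
      by (simp only: sum.cartesian_product)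
  qed
  have i: "inj (\<lambda>(k, c). Iw k c)" "inj (\<lambda>(k, c). Ix k c)" "inj Iu" "inj If" "inj Id"
    by (auto simp: inj_def)
  show ?thesis
    unfolding UNIV_ni r[OF i(1), symmetric] r[OF i(2), symmetric]
    by (subst sum.union_disjoint; force?)+ (simp add: sum.reindex[OF i(3)] sum.reindex[OF i(4)] sum.reindex[OF i(5)])
qed

text \<open>Weights of the reconstruction formula for vectors of norm n: 1/n for the orthogonal
  \<open>u\<close>, 1/(2n) for the doubled \<open>f\<close> and \<open>dl\<close>, and 2/(3n) for
  three vectors at 120 degrees in a plane.\<close>

fun rw :: "ni \<Rightarrow> rat" where
  "rw (Iu _) = 5/8" | "rw (Iw _ _) = 256/729" | "rw (If _) = 55/208" | "rw (Id _) = 16/117"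
| "rw (Ix _ _) = 128/117"

context m9_config
begin

text \<open>Multiplication by a fixed element is self-adjoint for a Frobenius form.\<close>

lemma eigen_orth:
  assumes "t \<diamondop> y = l *\<^sub>Q y" "t \<diamondop> z = m *\<^sub>Q z" "l \<noteq> m"
  shows "form y z = 0"
proof -
  have "form (t \<diamondop> y) z = form y (t \<diamondop> z)"
    by (metis form_frobenius form_sym mul_commute)
  with assms show ?thesis
    by (simp add: form_scale_left form_scale_right)
qed

lemma form_u_w: "form (u j) (w k c) = 0"
  using u_w_perp[of k c] u_w[of j k c] mul_uu[of j]
  by (cases "j = perp k") (auto intro: eigen_orth[of "u j" _ 1 _ 0] eigen_orth[of "u j" _ 1 _ "1/3"])

lemma form_u_x: "form (u j) (x k c) = 0"
proof -
  consider "j = k" | "j = perp k" | "j \<noteq> k" "j \<noteq> perp k" by blast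
  then show ?thesis
    using mul_uu[of j]
    by cases (auto intro: eigen_orth[of "u j" _ 1 _ 0] eigen_orth[of "u j" _ 1 _ "1/3"]
        eigen_orth[of "u j" _ 1 _ "1/30"] simp: u_x u_x_perp u_x_skew)
qed

lemma form_u_dl: "form (u j) (dl k) = 0"
proof -
  consider "j = k" | "j = perp k" | "j \<noteq> k" "j \<noteq> perp k" by blast
  then show ?thesis
    using mul_uu[of j]
    by cases (auto intro: eigen_orth[of "u j" _ 1 _ 0] eigen_orth[of "u j" _ 1 _ "1/5"]
        simp: u_dl u_dl_perp u_dl_skew)
qed

lemma form_u_f: "form (u j) (f k) = 0"
  using mul_uu[of j] f_u[of k j] by (auto intro: eigen_orth[of "u j" _ 1 _ 0] simp: mul_commute)

lemma form_w_w_distinct: "j \<noteq> k \<Longrightarrow> form (w j c) (w k d) = 0"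
  by (rule eigen_orth[of "u (perp k)" _ "1/3" _ 0]) (auto simp: u_w_perp u_w, metis perp_perp u_w)

lemma form_w_f: "form (w j c) (f k) = 0"
  by (rule eigen_orth[of "f k" _ 0 _ 1]) (auto simp: f_w f_f)

lemma form_w_x: "form (w j c) (x k d) = 0"
  by (rule eigen_orth[of "f k" _ 0 _ "3/5"]) (auto simp: f_w f_x)

lemma form_w_dl: "form (w j c) (dl k) = 0"
  by (rule eigen_orth[of "f k" _ 0 _ "3/5"]) (auto simp: f_w f_dl)

lemma form_f_x: "form (f k) (x j c) = 0"
proof (cases "j = k \<or> j = perp k")
  case True
  then show ?thesis
    using f_x[of j c] f_f[of j] by (auto intro!: eigen_orth[of "f k" _ 1 _ "3/5"])
next
  case False
  then show ?thesis
    using f_x_skew[of j k c] f_f[of k] by (intro eigen_orth[of "f k" _ 1 _ 0]) auto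
qed

lemma form_f_dl: "form (f k) (dl j) = 0"
proof (cases "j = k \<or> j = perp k")
  case True
  then show ?thesis
    using f_dl[of j] f_f[of j] by (auto intro!: eigen_orth[of "f k" _ 1 _ "3/5"])
next
  case False
  then show ?thesis
    using f_dl_skew[of j k] f_f[of k] by (intro eigen_orth[of "f k" _ 1 _ 0]) auto
qed

lemma form_f_f_skew: "j \<noteq> k \<Longrightarrow> j \<noteq> perp k \<Longrightarrow> form (f k) (f j) = 0"
  by (intro eigen_orth[of "f k" _ 1 _ 0]) (auto simp: f_f f_f_skew)

lemma form_dl_x: "form (dl k) (x j c) = 0"
proof -
  consider "j = k" | "j = perp k" | "j \<noteq> k" "j \<noteq> perp k" by blast
  then show ?thesis
  proof cases
    case 1
    then show ?thesis
      by (intro eigen_orth[of "u k" _ 0 _ "1/3"]) (auto simp: u_dl u_x)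
  next
    case 2
    then show ?thesis
      by (intro eigen_orth[of "u (perp k)" _ 0 _ "1/3"]) (auto simp: u_dl_perp u_x)
  next
    case 3
    then show ?thesis
      by (intro eigen_orth[of "f k" _ "3/5" _ 0]) (auto simp: f_dl f_x_skew)
  qed
qed

lemma form_x_x_distinct: "j \<noteq> k \<Longrightarrow> form (x k c) (x j d) = 0"
proof (cases "j = perp k")
  case True
  then show ?thesis
    using u_x_perp[of "perp k" d] by (intro eigen_orth[of "u k" _ "1/3" _ 0]) (auto simp: u_x)
next
  case False
  then show "j \<noteq> k \<Longrightarrow> ?thesis"
    by (intro eigen_orth[of "f k" _ "3/5" _ 0]) (auto simp: f_x f_x_skew)
qed

lemma form_dl_dl_skew: "j \<noteq> k \<Longrightarrow> j \<noteq> perp k \<Longrightarrow> form (dl k) (dl j) = 0"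
  by (intro eigen_orth[of "f k" _ "3/5" _ 0]) (auto simp: f_dl f_dl_skew)

lemma form_u_cross': "form (w k c) (u j) = 0" "form (x k c) (u j) = 0" "form (dl k) (u j) = 0" "form (f k) (u j) = 0"
  by (subst form_sym, rule form_u_w form_u_x form_u_dl form_u_f)+

lemma form_cross': "form (f k) (w j c) = 0" "form (x k d) (w j c) = 0" "form (dl k) (w j c) = 0"
    "form (x j c) (f k) = 0" "form (dl j) (f k) = 0" "form (x j c) (dl k) = 0"
  by (subst form_sym, rule form_w_f form_w_x form_w_dl form_f_x form_f_dl form_dl_x)+

lemma form_es_u: "form es (u j) = 8/5"
  unfolding es_sum form_sum_left by (cases j; simp add: sum_dir form_uu form_uu_distinct)

lemma ex_skew: "\<exists>j. j \<noteq> k \<and> j \<noteq> perp k"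
  by (cases k; simp; metis dir.distinct)

text \<open>Norms are read off from squares: pairing the square of a vector with an idempotent that
  has it as an eigenvector gives the eigenvalue times the norm. The next three lemmas use the same
  device.\<close>

lemma form_w_w: "form (w k c) (w k c) = 243/128"
proof -
  have "form (w k c \<diamondop> w k c) (u k) = form (w k c) (u k \<diamondop> w k c)"
    by (simp add: form_frobenius mul_commute)
  then show ?thesis
    by (simp add: w_w u_w form_lin form_es_u form_uu_distinct form_u_cross')
qed

lemma form_x_x: "form (x k c) (x k c) = 39/64"
proof -
  have "form (x k c \<diamondop> x k c) (u k) = form (x k c) (u k \<diamondop> x k c)"
    by (simp add: form_frobenius mul_commute)
  then show ?thesis
    by (simp add: x_x u_x form_lin form_es_u form_uu form_uu_distinct form_u_cross')
qed

lemma form_dl_dl: "form (dl k) (dl k) = 117/32"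
proof -
  obtain j where j: "j \<noteq> k" "j \<noteq> perp k"
    using ex_skew by blast
  have "form (dl k \<diamondop> dl k) (u j) = form (dl k) (u j \<diamondop> dl k)"
    by (simp add: form_frobenius mul_commute)
  with j show ?thesis
    by (simp add: dl_dl u_dl_skew form_lin form_es_u form_uu form_uu_distinct form_u_cross')
qed

lemma form_f_f: "form (f k) (f k) = 104/55"
proof -
  have "form (dl k \<diamondop> dl k) (f k) = form (dl k) (f k \<diamondop> dl k)"
    by (simp add: form_frobenius mul_commute)
  then show ?thesis
    by (simp add: dl_dl f_dl form_lin form_u_f es_sum form_sum_left form_dl_dl)
qed

text \<open>Three vectors of equal norm with sum zero form angles of 120 degrees.\<close>

lemma form_triple:
  assumes "y0 + y1 + y2 = 0" "form y0 y0 = n" "form y1 y1 = n" "form y2 y2 = n"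
  shows "form y0 y1 = - n/2" "form y0 y2 = - n/2" "form y1 y2 = - n/2"
proof -
  have y: "y2 = - (y0 + y1)" "y1 = - (y0 + y2)" "y0 = - (y1 + y2)"
    using assms(1) by (simp_all add: eq_neg_iff_add_eq_0 ac_simps del: minus_add_distrib)
  have neg: "form (- z) (- z) = form z z" for z
    by (simp add: form_minus_left form_minus_right)
  have e: "form (y + z) (y + z) = form y y + 2 * form y z + form z z" for y z
    by (simp add: form_add_left form_add_right form_sym[of z y])
  have "form y2 y2 = form (y0 + y1) (y0 + y1)"
    unfolding y(1) by (rule neg)
  then show "form y0 y1 = - n/2"
    unfolding e assms by linarith
  have "form y1 y1 = form (y0 + y2) (y0 + y2)"
    unfolding y(2) by (rule neg)
  then show "form y0 y2 = - n/2"
    unfolding e assms by linarith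
  have "form y0 y0 = form (y1 + y2) (y1 + y2)"
    unfolding y(3) by (rule neg)
  then show "form y1 y2 = - n/2"
    unfolding e assms by linarith
qed

lemma form_w: "form (w j c) (w k d) = (if j = k then if c = d then 243/128 else - 243/256 else 0)"
proof (cases "j = k")
  case True
  note t = form_triple[OF sum_w[of k] form_w_w form_w_w form_w_w]
  show ?thesis
    unfolding True using t form_sym[of "w k N1" "w k N0"] form_sym[of "w k N2" "w k N0"]
      form_sym[of "w k N2" "w k N1"] form_w_w[of k]
    by (cases c; cases d; simp)
qed (simp add: form_w_w_distinct)

lemma form_x: "form (x j c) (x k d) = (if j = k then if c = d then 39/64 else - 39/128 else 0)"
proof (cases "j = k")
  case True
  note t = form_triple[OF sum_x[of k] form_x_x form_x_x form_x_x]
  show ?thesis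
    unfolding True using t form_sym[of "x k N1" "x k N0"] form_sym[of "x k N2" "x k N0"]
      form_sym[of "x k N2" "x k N1"] form_x_x[of k]
    by (cases c; cases d; simp)
qed (simp add: form_x_x_distinct)

lemma form_f: "form (f j) (f k) = (if j = k \<or> j = perp k then 104/55 else 0)"
  using form_f_f[of k] form_f_f_skew[of j k] form_sym[of "f j" "f k"] by auto

lemma form_dl: "form (dl j) (dl k) = (if j = k then 117/32 else if j = perp k then - 117/32 else 0)"
  using form_dl_dl[of k] form_dl_dl_skew[of j k] form_sym[of "dl j" "dl k"] by (auto simp: form_minus_left)

lemma form_u: "form (u j) (u k) = (if j = k then 8/5 else 0)"
  by (simp add: form_uu form_uu_distinct)

lemmas form_cross = form_u_w form_u_x form_u_dl form_u_f form_w_f form_w_x form_w_dl form_f_x form_f_dl form_dl_x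
lemmas nice_form = form_u form_w form_x form_f form_dl form_cross form_u_cross' form_cross'

fun nv :: "ni \<Rightarrow> 'v" where
  "nv (Iu k) = u k" | "nv (Iw k c) = w k c" | "nv (If k) = f k" | "nv (Id k) = dl k"
| "nv (Ix k c) = x k c"

definition SP :: "'v set" where
  "SP = span (range nv)"

lemma nv_SP [simp]: "nv i \<in> SP"
  by (auto simp: SP_def intro: span_base)

lemma w_N2: "w k N2 = - w k N0 - w k N1"
proof -
  have "w k N2 = (w k N0 + w k N1 + w k N2) - w k N0 - w k N1"
    by (simp add: algebra_simps)
  then show ?thesis
    by (simp add: sum_w)
qed

lemma x_N2: "x k N2 = - x k N0 - x k N1"
proof -
  have "x k N2 = (x k N0 + x k N1 + x k N2) - x k N0 - x k N1"
    by (simp add: algebra_simps)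
  then show ?thesis
    by (simp add: sum_x)
qed

lemma frame_nv: "(\<Sum>i\<in>UNIV. (rw i * form (nv j) (nv i)) *\<^sub>Q nv i) = nv j"
proof (cases j)
  case (Iw k c)
  note e = w_N2
  show ?thesis
  proof -
    define vs where "vs = [w D1 N0, w D1 N1, w D2 N0, w D2 N1, w D3 N0, w D3 N1, w D4 N0, w D4 N1]"
    have vs: "w D1 N0 = den vs (LG 0)" "w D1 N1 = den vs (LG 1)" "w D2 N0 = den vs (LG 2)" "w D2 N1 = den vs (LG 3)" "w D3 N0 = den vs (LG 4)" "w D3 N1 = den vs (LG 5)" "w D4 N0 = den vs (LG 6)" "w D4 N1 = den vs (LG 7)"
      by (simp_all add: vs_def)
    show ?thesis
      unfolding Iw sum_ni
      by (cases k; cases c; simp add: sum_dir sum_f3 nice_form; simp only: e; simp only: vs den_fold;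
        rule den_eqI; simp add: vs_def)
  qed
next
  case (Ix k c)
  note e = x_N2
  show ?thesis
  proof -
    define vs where "vs = [x D1 N0, x D1 N1, x D2 N0, x D2 N1, x D3 N0, x D3 N1, x D4 N0, x D4 N1]"
    have vs: "x D1 N0 = den vs (LG 0)" "x D1 N1 = den vs (LG 1)" "x D2 N0 = den vs (LG 2)" "x D2 N1 = den vs (LG 3)" "x D3 N0 = den vs (LG 4)" "x D3 N1 = den vs (LG 5)" "x D4 N0 = den vs (LG 6)" "x D4 N1 = den vs (LG 7)"
      by (simp_all add: vs_def)
    show ?thesis
      unfolding Ix sum_ni
      by (cases k; cases c; simp add: sum_dir sum_f3 nice_form; simp only: e; simp only: vs den_fold;
        rule den_eqI; simp add: vs_def)
  qed
next
  case (Iu k)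
  then show ?thesis
    unfolding sum_ni by (cases k; simp add: sum_dir sum_f3 nice_form)
next
  case (If k)
  have "f D2 = f D1" "f D4 = f D3"
    using f_perp[of D1] f_perp[of D3] by simp_all
  then show ?thesis
    unfolding If sum_ni by (cases k; simp add: sum_dir sum_f3 nice_form flip: scale_left_distrib)
next
  case (Id k)
  have "dl D2 = - dl D1" "dl D4 = - dl D3"
    using dl_perp[of D1] dl_perp[of D3] by simp_all
  moreover have "- ((1/2) *\<^sub>Q y) - (1/2) *\<^sub>Q y = - y" for y
    using scale_left_distrib[of "1/2" "1/2" y] by (simp add: algebra_simps)
  ultimately show ?thesis
    unfolding Id sum_ni by (cases k; simp add: sum_dir sum_f3 nice_form form_minus_left form_minus_right flip: scale_left_distrib)
qed

lemma frame_SP: "y \<in> SP \<Longrightarrow> (\<Sum>i\<in>UNIV. (rw i * form y (nv i)) *\<^sub>Q nv i) = y"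
  unfolding SP_def
proof (induction rule: span_induct_alt)
  case base
  then show ?case by simp
next
  case (step c y z)
  then obtain j where y: "y = nv j" by blast
  have "(\<Sum>i\<in>UNIV. (rw i * form (c *\<^sub>Q y + z) (nv i)) *\<^sub>Q nv i) =
    c *\<^sub>Q (\<Sum>i\<in>UNIV. (rw i * form y (nv i)) *\<^sub>Q nv i) + (\<Sum>i\<in>UNIV. (rw i * form z (nv i)) *\<^sub>Q nv i)"
    by (simp add: form_lin scale_sum_right algebra_simps scale_left_distrib sum.distrib)
  with step.IH show ?case
    by (simp add: y frame_nv)
qed

end

section \<open>Orthogonal basis, dimension and generation\<close>

context m9_config
begin

lemma orthogonal_independent:
  assumes "finite J" "\<And>i j. i \<in> J \<Longrightarrow> j \<in> J \<Longrightarrow> i \<noteq> j \<Longrightarrow> form (v i) (v j) = 0"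
    and "\<And>i. i \<in> J \<Longrightarrow> form (v i) (v i) \<noteq> 0"
  shows "inj_on v J" "\<not> dependent (v ` J)"
proof -
  show inj: "inj_on v J"
    using assms by (metis inj_onI)
  show "\<not> dependent (v ` J)"
  proof
    assume "dependent (v ` J)"
    then obtain r y where r: "y \<in> v ` J" "r y \<noteq> 0" "(\<Sum>z\<in>v ` J. r z *\<^sub>Q z) = 0"
      using dependent_finite[of "v ` J"] assms(1) by auto
    then obtain i where i: "i \<in> J" "y = v i" by blast
    have "0 = form (\<Sum>z\<in>v ` J. r z *\<^sub>Q z) (v i)"
      by (simp add: r)
    also have "\<dots> = (\<Sum>j\<in>J. r (v j) * form (v j) (v i))"
      by (simp add: form_sum_left form_scale_left sum.reindex[OF inj])
    also have "\<dots> = (\<Sum>j\<in>J. if j = i then r (v i) * form (v i) (v i) else 0)"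
      by (rule sum.cong) (use assms(2) i in auto)
    finally show False
      using r i assms(1,3) by simp
  qed
qed

text \<open>In each plane spanned by three vectors with sum zero and equal norm, the first vector
  and the difference of the other two are orthogonal. With one copy of each doubled vector this
  gives 4 + 8 + 2 + 2 + 8 = 24 orthogonal vectors.\<close>

fun ov :: "ni \<Rightarrow> 'v" where
  "ov (Iw k N1) = w k N1 - w k N2" | "ov (Ix k N1) = x k N1 - x k N2" | "ov i = nv i"

fun ov_index :: "ni \<Rightarrow> bool" where
  "ov_index (Iu _) \<longleftrightarrow> True"
| "ov_index (Iw _ c) \<longleftrightarrow> c \<noteq> N2" | "ov_index (Ix _ c) \<longleftrightarrow> c \<noteq> N2"
| "ov_index (If k) \<longleftrightarrow> k = D1 \<or> k = D3" | "ov_index (Id k) \<longleftrightarrow> k = D1 \<or> k = D3"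

definition OJ :: "ni set" where
  "OJ = {i. ov_index i}"

lemma OJ_eq: "OJ = {Iu D1, Iu D2, Iu D3, Iu D4, If D1, If D3, Id D1, Id D3,
    Iw D1 N0, Iw D1 N1, Iw D2 N0, Iw D2 N1, Iw D3 N0, Iw D3 N1, Iw D4 N0, Iw D4 N1,
    Ix D1 N0, Ix D1 N1, Ix D2 N0, Ix D2 N1, Ix D3 N0, Ix D3 N1, Ix D4 N0, Ix D4 N1}" (is "_ = ?R")
proof (rule Set.set_eqI)
  fix i
  show "i \<in> OJ \<longleftrightarrow> i \<in> ?R"
  proof (cases i)
    case (Iu k) then show ?thesis by (cases k; simp add: OJ_def)
  next
    case (Iw k c) then show ?thesis by (cases k; cases c; simp add: OJ_def)
  next
    case (If k) then show ?thesis by (cases k; simp add: OJ_def)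
  next
    case (Id k) then show ?thesis by (cases k; simp add: OJ_def)
  next
    case (Ix k c) then show ?thesis by (cases k; cases c; simp add: OJ_def)
  qed
qed

lemma ov_orth:
  assumes "i \<in> OJ" "j \<in> OJ" "i \<noteq> j"
  shows "form (ov i) (ov j) = 0"
  using assms unfolding OJ_def
  by (cases i rule: ov.cases; cases j rule: ov.cases;
    simp add: nice_form form_diff_left form_diff_right; (elim disjE; simp)?)

lemma ov_norm: "form (ov i) (ov i) \<noteq> 0"
  by (cases i rule: ov.cases; simp add: nice_form form_diff_left form_diff_right)

lemma subspace_SP: "subspace SP"
  by (simp add: SP_def)

lemma SP_closed:
  "y \<in> SP \<Longrightarrow> z \<in> SP \<Longrightarrow> y + z \<in> SP"
  "y \<in> SP \<Longrightarrow> z \<in> SP \<Longrightarrow> y - z \<in> SP"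
  "y \<in> SP \<Longrightarrow> r *\<^sub>Q y \<in> SP"
  by (auto simp: SP_def span_add span_diff span_scale)

lemma SP_u [simp]: "u k \<in> SP" and SP_w [simp]: "w k c \<in> SP" and SP_f [simp]: "f k \<in> SP"
  and SP_dl [simp]: "dl k \<in> SP" and SP_x [simp]: "x k c \<in> SP"
  using nv_SP[of "Iu k"] nv_SP[of "Iw k c"] nv_SP[of "If k"] nv_SP[of "Id k"] nv_SP[of "Ix k c"] by simp_all

lemma span_ov: "span (ov ` OJ) = SP"
proof (rule antisym)
  have "ov i \<in> SP" for i
    by (cases i rule: ov.cases) (auto intro: SP_closed(2))
  then show "span (ov ` OJ) \<subseteq> SP"
    unfolding SP_def by (metis image_subsetI span_minimal subspace_span)
  have base: "ov i \<in> span (ov ` OJ)" if "i \<in> OJ" for i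
    using that by (intro span_base) auto
  have split: "y1 \<in> span (ov ` OJ) \<and> y2 \<in> span (ov ` OJ)"
    if "y2 = - y0 - y1" "y0 \<in> span (ov ` OJ)" "y1 - y2 \<in> span (ov ` OJ)" for y0 y1 y2
  proof -
    define vs where "vs = [y0, y1]"
    have vs: "y0 = den vs (LG 0)" "y1 = den vs (LG 1)"
      by (simp_all add: vs_def)
    have "y1 = (1/2) *\<^sub>Q ((y1 - y2) - y0)" "y2 = - ((1/2) *\<^sub>Q ((y1 - y2) + y0))"
      unfolding that(1) unfolding vs den_fold by (rule den_eqI; simp add: vs_def)+
    with that show ?thesis
      by (metis span_add span_diff span_scale span_neg)
  qed
  have w: "w k c \<in> span (ov ` OJ)" for k c
  proof -
    have 0: "w k N0 \<in> span (ov ` OJ)" "w k N1 - w k N2 \<in> span (ov ` OJ)"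
      using base[of "Iw k N0"] base[of "Iw k N1"] by (cases k; simp add: OJ_def)+
    then show ?thesis
      using split[OF w_N2 0] by (cases c) auto
  qed
  have x: "x k c \<in> span (ov ` OJ)" for k c
  proof -
    have 0: "x k N0 \<in> span (ov ` OJ)" "x k N1 - x k N2 \<in> span (ov ` OJ)"
      using base[of "Ix k N0"] base[of "Ix k N1"] by (cases k; simp add: OJ_def)+
    then show ?thesis
      using split[OF x_N2 0] by (cases c) auto
  qed
  have "nv i \<in> span (ov ` OJ)" for i
  proof (cases i)
    case (Iu k)
    then show ?thesis
      using base[of i] by (cases k) (auto simp: OJ_def)
  next
    case (If k)
    then show ?thesis
      using base[of "If D1"] base[of "If D3"] f_perp[of D1] f_perp[of D3] by (cases k) (auto simp: OJ_def)
  next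
    case (Id k)
    then show ?thesis
      using base[of "Id D1"] base[of "Id D3"] dl_perp[of D1] dl_perp[of D3]
      by (cases k) (auto simp: OJ_def intro: span_neg)
  qed (simp_all add: w x)
  then show "SP \<subseteq> span (ov ` OJ)"
    unfolding SP_def by (metis image_subsetI span_minimal subspace_span)
qed

lemma dim_SP: "dim SP = 24"
proof -
  have fin: "finite OJ"
    by (simp add: OJ_eq)
  note oi = orthogonal_independent[of OJ ov, OF fin ov_orth ov_norm]
  have "dim SP = card (ov ` OJ)"
    unfolding span_ov[symmetric] dim_span using oi(2) by (simp add: dim_eq_card_independent)
  also have "\<dots> = card OJ"
    by (rule card_image) (rule oi(1))
  also have "\<dots> = 24"
    by (simp add: OJ_eq)
  finally show ?thesis .
qed

lemma SP_es [simp]: "es \<in> SP"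
  unfolding es_sum by (intro subspace_sum subspace_SP) auto

lemma SP_a [simp]: "a p \<in> SP"
  by (subst a_eq) (intro SP_closed SP_es SP_w)

lemma SP_b [simp]: "b k c \<in> SP"
  by (subst b_eq) (intro SP_closed SP_es SP_w SP_u SP_f SP_dl SP_x)

definition ax :: "'v set" where
  "ax = range a \<union> range (\<lambda>(k, c). b k c)"

lemma ax_a [simp]: "a p \<in> ax" and ax_b [simp]: "b k c \<in> ax"
  by (auto simp: ax_def)

lemma SP_subset: "SP \<subseteq> span (ax \<union> range u)"
proof -
  have base: "a p \<in> span (ax \<union> range u)" "b k c \<in> span (ax \<union> range u)" "u k \<in> span (ax \<union> range u)" for p k c
    by (auto intro!: span_base)
  have sa: "sa \<in> span (ax \<union> range u)"
    unfolding sa_def by (intro span_sum base)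
  have nice: "w k c \<in> span (ax \<union> range u)" "sb k \<in> span (ax \<union> range u)" for k c
    unfolding w_def aline_def sb_def by (intro span_add span_diff span_scale base sa)+
  have "nv i \<in> span (ax \<union> range u)" for i
    by (cases i) (auto simp: f_def dl_def x_def intro!: span_add span_diff span_scale base sa nice)
  then show ?thesis
    unfolding SP_def by (metis image_subsetI span_minimal subspace_span)
qed

lemma SP_eq: "SP = span (ax \<union> range u)"
proof (rule antisym[OF SP_subset])
  show "span (ax \<union> range u) \<subseteq> SP"
    by (rule span_minimal) (auto simp: ax_def subspace_SP)
qed

lemma SP_mul_ax_u:
  assumes "y \<in> ax \<union> range u" "z \<in> ax \<union> range u"
  shows "y \<diamondop> z \<in> SP"
proof -
  have au: "a p \<diamondop> u k \<in> SP" for p k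
    unfolding mul_au by (intro SP_closed) auto
  have uu: "u j \<diamondop> u k \<in> SP" for j k
    by (cases "j = k") (auto simp: mul_uu mul_uu_distinct subspace_0 subspace_SP)
  have sb: "sb k \<in> SP" for k
    unfolding sb_def by (intro SP_closed) auto
  have al: "aline k c \<in> SP" for k c
    unfolding aline_def by (intro SP_closed) auto
  have bu: "b k c \<diamondop> u j \<in> SP" for k c j
  proof -
    consider "j = k" | "j = perp k" | "j \<noteq> k" "j \<noteq> perp k" by blast
    then show ?thesis
    proof cases
      case 1
      then show ?thesis
        unfolding 1 mul_bu by (intro SP_closed) auto
    next
      case 2
      then show ?thesis
        using mul_bu_perp[of "perp k" c] by (simp add: subspace_0 subspace_SP)
    next
      case 3
      then show ?thesis
        unfolding mul_bu_skew[OF 3] by (intro SP_closed sb al) auto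
    qed
  qed
  have aa: "a p \<diamondop> a q \<in> SP" for p q
  proof (cases "p = q")
    case True
    then show ?thesis by (simp add: mul_a_self)
  next
    case False
    then obtain k where k: "lam k p = lam k q"
      by (rule ex_direction)
    show ?thesis
      using mul_aa[OF False, of "perp k"] k by (auto intro!: SP_closed)
  qed
  have ab: "a p \<diamondop> b k c \<in> SP" for p k c
    by (cases "lam k p = c") (auto simp: mul_ab_in' mul_ab_out intro!: SP_closed)
  have bb: "b k c \<diamondop> b j d \<in> SP" for k c j d
  proof -
    consider "j = k" | "j = perp k" | "j \<noteq> k" "j \<noteq> perp k" by blast
    then show ?thesis
    proof cases
      case 1
      then show ?thesis
        by (cases "c = d") (auto simp: mul_b_self mul_bb_par intro!: SP_closed)
    next
      case 2
      then show ?thesis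
        using mul_bb_perp'(1)[of c d] mul_bb_perp'(1)[of d c] mul_bb_perp'(2)[of c d] mul_bb_perp'(2)[of d c]
        by (cases k) (auto simp: mul_bb_comm intro!: SP_closed)
    next
      case 3
      then show ?thesis
        by (cases k; cases j) (auto simp: mul_bb_skew'' mul_bb_comm intro!: SP_closed)
    qed
  qed
  from assms show ?thesis
    unfolding ax_def
    by (auto simp: aa ab au bb bu uu mul_b_a mul_u_a mul_u_b)
qed

lemma SP_mul [simp]:
  assumes "y \<in> SP" "z \<in> SP"
  shows "y \<diamondop> z \<in> SP"
proof -
  have 1: "y \<diamondop> z \<in> SP" if "y \<in> ax \<union> range u" "z \<in> SP" for y z
    using that(2) unfolding SP_eq
  proof (induction rule: span_induct_alt)
    case base
    then show ?case by (simp add: span_zero)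
  next
    case (step c v v')
    then show ?case
      using SP_mul_ax_u[OF that(1) step(1)] unfolding SP_eq
      by (auto simp: mul_lin intro!: span_add span_scale)
  qed
  from assms(1) show ?thesis
    unfolding SP_eq
  proof (induction rule: span_induct_alt)
    case base
    then show ?case by (simp add: span_zero)
  next
    case (step c v v')
    then show ?case
      using 1[OF step(1) assms(2)] unfolding SP_eq
      by (auto simp: mul_lin intro!: span_add span_scale)
  qed
qed

lemma gen_subalgebra_ax: "gen_subalgebra ax = SP"
proof (rule antisym)
  have "subalgebra SP" "ax \<subseteq> SP"
    by (auto simp: subalgebra_def subspace_SP ax_def)
  then show "gen_subalgebra ax \<subseteq> SP"
    unfolding gen_subalgebra_def by blast
  show "SP \<subseteq> gen_subalgebra ax"
    unfolding gen_subalgebra_def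
  proof clarify
    fix y S
    assume y: "y \<in> SP" and S: "subalgebra S" "ax \<subseteq> S"
    have "b k c \<in> S" for k c
      using S(2) by auto
    then have "u k \<in> S" for k
      using S u_eq[of N0 N1 k] unfolding subalgebra_def
      by (auto intro!: subspace_add subspace_diff subspace_scale)
    with S have "ax \<union> range u \<subseteq> S"
      by auto
    then have "span (ax \<union> range u) \<subseteq> S"
      using S by (intro span_minimal) (auto simp: subalgebra_def)
    with y show "y \<in> S"
      by (auto simp: SP_eq)
  qed
qed

end

section \<open>Automorphisms and Casimir elements\<close>

context m9_config
begin

text \<open>The polynomial s (s - 1/4) (s - 1/32) in the multiplication by \<open>t\<close>. It
  vanishes at all eigenvalues of an axis except 1, where its value is 93/128.\<close>

definition adpoly :: "'v \<Rightarrow> 'v \<Rightarrow> 'v" where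
  "adpoly t y = (let y1 = t \<diamondop> y - (1/32) *\<^sub>Q y; y2 = t \<diamondop> y1 - (1/4) *\<^sub>Q y1 in t \<diamondop> y2)"

lemma adpoly_lin: "adpoly t (r *\<^sub>Q y + z) = r *\<^sub>Q adpoly t y + adpoly t z"
  by (simp add: adpoly_def Let_def mul_lin algebra_simps scale_right_distrib scale_right_diff_distrib)

lemma adpoly_eigen:
  assumes "t \<diamondop> y = l *\<^sub>Q y"
  shows "adpoly t y = (l * (l - 1/4) * (l - 1/32)) *\<^sub>Q y"
proof -
  have 1: "t \<diamondop> y - (1/32) *\<^sub>Q y = (l - 1/32) *\<^sub>Q y"
    by (simp add: assms scale_left_diff_distrib)
  have 2: "t \<diamondop> ((l - 1/32) *\<^sub>Q y) - (1/4) *\<^sub>Q ((l - 1/32) *\<^sub>Q y) = ((l - 1/4) * (l - 1/32)) *\<^sub>Q y"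
    by (simp add: assms mul_scale_right flip: scale_left_diff_distrib) (simp add: field_simps)
  show ?thesis
    unfolding adpoly_def Let_def 1 2 by (simp add: mul_scale_right assms field_simps)
qed

lemma form_adpoly: "form (adpoly t y) z = form y (adpoly t z)"
proof -
  have m: "form (t \<diamondop> y) z = form y (t \<diamondop> z)" for y z
    by (metis form_frobenius mul_commute)
  show ?thesis
    unfolding adpoly_def Let_def by (simp add: form_lin m mul_lin algebra_simps)
qed

text \<open>Only the 1-eigenspace, a line, survives; self-adjointness then gives the coefficient. So
  93/128 times the orthogonal projection to the axis is expressed by products alone.\<close>

lemma adpoly_axis:
  assumes "primitive_axis t" "form t t = 1"
  shows "adpoly t y = (93/128 * form t y) *\<^sub>Q t"
proof -
  have tt: "t \<diamondop> t = 1 *\<^sub>Q t"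
    using assms by (simp add: primitive_axis_def)
  have "adpoly t y \<in> span {t}"
  proof -
    have "y \<in> span (\<Union>l\<in>{1, 0, 1/4, 1/32}. eigenspace t l)"
      using assms unfolding primitive_axis_def eigen_sum_def by auto
    then show ?thesis
    proof (induction rule: span_induct_alt)
      case base
      then show ?case
        using adpoly_eigen[of t 0 0] by (simp add: span_zero)
    next
      case (step c y z)
      then obtain l where l: "l \<in> {1, 0, 1/4, 1/32}" "t \<diamondop> y = l *\<^sub>Q y"
        unfolding eigenspace_def by blast
      have "adpoly t y \<in> span {t}"
      proof (cases "l = 1")
        case True
        then have "y \<in> span {t}"
          using l assms(1) by (auto simp: primitive_axis_def eigenspace_def)
        then show ?thesis
          by (simp add: adpoly_eigen[OF l(2)] span_scale)
      next
        case False
        then have z: "l * (l - 1/4) * (l - 1/32) = 0"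
          using l(1) by auto
        show ?thesis
          unfolding adpoly_eigen[OF l(2)] z by (simp add: span_zero)
      qed
      with step show ?case
        by (simp add: adpoly_lin span_add span_scale)
    qed
  qed
  then obtain r where r: "adpoly t y = r *\<^sub>Q t"
    by (auto simp: span_singleton)
  then have "r = form (adpoly t y) t"
    by (simp add: form_scale_left assms)
  also have "\<dots> = form y ((93/128) *\<^sub>Q t)"
    unfolding form_adpoly adpoly_eigen[OF tt] by simp
  finally show ?thesis
    by (simp add: r form_scale_right form_sym)
qed

lemma ax_axis: "t \<in> ax \<Longrightarrow> primitive_axis t" and ax_norm: "t \<in> ax \<Longrightarrow> form t t = 1"
  by (auto simp: ax_def axis_a axis_b form_axis_a form_axis_b)

lemma ax_SP: "t \<in> ax \<Longrightarrow> t \<in> SP"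
  by (auto simp: ax_def)

text \<open>No two axes are orthogonal, which lets the scaling factors at different axes be
  compared.\<close>

lemma form_ax_nonzero:
  assumes "t \<in> ax" "t' \<in> ax"
  shows "form t t' \<noteq> 0"
proof -
  have aa: "form (a p) (a q) \<noteq> 0" for p q
    using form_aa[of p q] form_axis_a[of q] by (cases "p = q") auto
  have ab: "form (a p) (b k c) \<noteq> 0" for p k c
    using form_ab_in[of p k] form_ab_out[of k p c] by (cases "lam k p = c") auto
  have bb: "form (b k c) (b j d) \<noteq> 0" for k c j d
  proof -
    consider "j = k" | "j = perp k" | "j \<noteq> k" "j \<noteq> perp k" by blast
    then show ?thesis
      using form_bb_par[of c d k] form_axis_b[of k c] form_bb_perp[of k c d] form_bb_skew[of j k c d]
      by cases (cases "c = d", auto)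
  qed
  from assms show ?thesis
    unfolding ax_def using aa ab bb by (auto simp: form_sym[of "b _ _" "a _"])
qed

definition saut :: "('v \<Rightarrow> 'v) \<Rightarrow> bool" where
  "saut h \<longleftrightarrow> bij_betw h SP SP \<and> (\<forall>y\<in>SP. \<forall>z\<in>SP. h (y + z) = h y + h z) \<and>
     (\<forall>r. \<forall>y\<in>SP. h (r *\<^sub>Q y) = r *\<^sub>Q h y) \<and> (\<forall>y\<in>SP. \<forall>z\<in>SP. h (y \<diamondop> z) = h y \<diamondop> h z)"

context
  fixes h
  assumes h: "saut h"
begin

lemma h_SP: "y \<in> SP \<Longrightarrow> h y \<in> SP"
  and h_add: "y \<in> SP \<Longrightarrow> z \<in> SP \<Longrightarrow> h (y + z) = h y + h z"
  and h_scale: "y \<in> SP \<Longrightarrow> h (r *\<^sub>Q y) = r *\<^sub>Q h y"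
  and h_mul: "y \<in> SP \<Longrightarrow> z \<in> SP \<Longrightarrow> h (y \<diamondop> z) = h y \<diamondop> h z"
  and h_inj: "y \<in> SP \<Longrightarrow> z \<in> SP \<Longrightarrow> h y = h z \<Longrightarrow> y = z"
  using h unfolding saut_def bij_betw_def inj_on_def by blast+

lemma h_surj: "y \<in> SP \<Longrightarrow> \<exists>z\<in>SP. y = h z"
  using h unfolding saut_def bij_betw_def by blast

lemma h_zero: "h 0 = 0"
  using h_scale[of 0 0] subspace_0[OF subspace_SP] by simp

lemma h_diff: "y \<in> SP \<Longrightarrow> z \<in> SP \<Longrightarrow> h (y - z) = h y - h z"
  using h_add[of "y - z" z] by (simp add: SP_closed)

lemma h_sum:
  assumes "\<And>i. i \<in> I \<Longrightarrow> F i \<in> SP"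
  shows "h (\<Sum>i\<in>I. F i) = (\<Sum>i\<in>I. h (F i))"
  using assms
proof (induction I rule: infinite_finite_induct)
  case (insert i I)
  then have "sum F I \<in> SP"
    by (intro subspace_sum subspace_SP) auto
  with insert show ?case
    by (simp add: h_add)
qed (simp_all add: h_zero)

lemmas h_all = h_add h_diff h_scale h_mul h_SP SP_closed SP_mul

text \<open>An automorphism carries the polynomial \<open>adpoly\<close> of an axis to that of its
  image, so the transported form is proportional to the given one at each axis. Symmetry makes the
  factors equal, and the Frobenius property extends the proportionality from axes to their products,
  hence to the \<open>u k\<close>.\<close>

lemma h_form: "\<exists>r. r > 0 \<and> (\<forall>y\<in>SP. \<forall>z\<in>SP. form (h y) (h z) = r * form y z)"
proof -
  define G where "G y z = form (h y) (h z)" for y z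
  \<comment> \<open>Only the idempotence of \<open>h t\<close> enters on the image side; primitivity
    is applied to \<open>t\<close> itself.\<close>
  have G1: "G t y = form t y * G t t" if t: "t \<in> ax" and y: "y \<in> SP" for t y
  proof -
    have tS: "t \<in> SP" using t by (rule ax_SP)
    have hp: "h (adpoly t y) = adpoly (h t) (h y)"
      using tS y by (simp add: adpoly_def Let_def h_all)
    have "h t \<diamondop> h t = 1 *\<^sub>Q h t"
      using ax_axis[OF t] tS by (simp add: primitive_axis_def flip: h_mul)
    from adpoly_eigen[OF this] have ht: "adpoly (h t) (h t) = (93/128) *\<^sub>Q h t"
      by simp
    have "(93/128) * G t y = form (adpoly (h t) (h t)) (h y)"
      by (simp add: ht G_def form_scale_left)
    also have "\<dots> = form (h t) (h (adpoly t y))"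
      by (simp add: form_adpoly hp)
    also have "\<dots> = (93/128 * form t y) * G t t"
      by (simp add: adpoly_axis[OF ax_axis[OF t] ax_norm[OF t]] h_scale tS form_scale_right G_def)
    finally show ?thesis by simp
  qed
  define r where "r = G (a 0) (a 0)"
  \<comment> \<open>Both orders of the pair \<open>t\<close>, \<open>a 0\<close> give the same value
    of \<open>G\<close>, and \<open>form t (a 0)\<close> can be cancelled.\<close>
  have G2: "G t t = r" if "t \<in> ax" for t
  proof -
    have "G t (a 0) = form t (a 0) * G t t" "G (a 0) t = form (a 0) t * r"
      using G1[OF that, of "a 0"] G1[of "a 0" t] that by (simp_all add: r_def ax_SP)
    then show ?thesis
      using form_ax_nonzero[OF that, of "a 0"] by (simp add: G_def form_sym)
  qed
  have G3: "G t y = r * form t y" if "t \<in> ax" "y \<in> SP" for t y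
    using G1[OF that] G2[OF that(1)] by simp
  have G4: "G (t \<diamondop> t') y = r * form (t \<diamondop> t') y" if "t \<in> ax" "t' \<in> ax" "y \<in> SP" for t t' y
  proof -
    have S: "t \<in> SP" "t' \<in> SP" using that by (simp_all add: ax_SP)
    have "G (t \<diamondop> t') y = G t (t' \<diamondop> y)"
      using S that by (simp add: G_def h_mul form_frobenius)
    then show ?thesis
      using G3[OF that(1), of "t' \<diamondop> y"] S that by (simp add: form_frobenius)
  qed
  have Glin: "G (s *\<^sub>Q y + z) v = s * G y v + G z v" if "y \<in> SP" "z \<in> SP" for y z v s
    using that by (simp add: G_def h_all form_lin)
  have Gsc: "G (s *\<^sub>Q y) v = s * G y v" if "y \<in> SP" for y v s
    using that by (simp add: G_def h_all form_lin)
  have G5: "G (u k) y = r * form (u k) y" if y: "y \<in> SP" for k y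
  proof -
    have "u k = (128/135) *\<^sub>Q b k N0 + ((128/135) *\<^sub>Q b k N1 +
        ((64/135) *\<^sub>Q b k N2 + ((-2048/135) *\<^sub>Q (b k N0 \<diamondop> b k N1) + 0)))"
    proof -
      define m where "m = b k N0 \<diamondop> b k N1"
      define vs where "vs = [b k N0, b k N1, b k N2, m]"
      have vs: "b k N0 = den vs (LG 0)" "b k N1 = den vs (LG 1)"
        "b k N2 = den vs (LG 2)" "m = den vs (LG 3)"
        by (simp_all add: vs_def)
      have u: "u k = (2048/135) *\<^sub>Q ((1/16) *\<^sub>Q (b k N0 + b k N1) + (1/32) *\<^sub>Q b k N2 - m)"
        using u_eq[of N0 N1 k] by (simp add: m_def)
      show ?thesis
        unfolding u m_def[symmetric] add_0_right by (simp only: vs den_fold, rule den_eqI, simp add: vs_def)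
    qed
    moreover have "G 0 y = 0"
      by (simp add: G_def h_zero)
    ultimately show ?thesis
      using y by (simp add: Glin Gsc SP_closed G3 G4 form_lin form_minus_left algebra_simps subspace_0[OF subspace_SP] del: scale_minus_left)
  qed
  have G6: "z \<in> SP \<and> G z y = r * form z y" if y: "y \<in> SP" and "z \<in> SP" for y z
    using that(2) unfolding SP_eq
  proof (induction rule: span_induct_alt)
    case base
    then show ?case by (simp add: G_def h_zero span_zero)
  next
    case (step c v v')
    have S: "v \<in> SP" "v' \<in> SP"
      using step by (auto simp: ax_SP SP_eq[symmetric])
    have "G v y = r * form v y"
      using step(1) G3[OF _ y] G5[OF y] by auto
    with S step(2) show ?case
      unfolding SP_eq[symmetric] by (simp add: SP_closed Glin form_lin distrib_left)
  qed
  have "h (a 0) \<noteq> 0"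
    using h_inj[of "a 0" 0] h_zero form_axis_a[of 0] subspace_0[OF subspace_SP] by auto
  then have "r > 0"
    unfolding r_def G_def by (rule form_pos_def)
  with G6 show ?thesis
    unfolding G_def by blast
qed

end

text \<open>The Casimir element, the sum of the squares of an orthonormal basis, written rationally
  over the weighted frame.\<close>

definition cas :: 'v where
  "cas = (\<Sum>i\<in>UNIV. rw i *\<^sub>Q (nv i \<diamondop> nv i))"

definition tcas :: "'v \<Rightarrow> 'v" where
  "tcas t = (\<Sum>i\<in>UNIV. rw i *\<^sub>Q (nv i \<diamondop> (t \<diamondop> nv i)))"

text \<open>The trace of a bilinear map with respect to the form does not depend on the frame:
  expand one argument in the first frame, exchange the sums, and contract with the second
  frame.\<close>

lemma casimir_unique:
  fixes v' :: "ni \<Rightarrow> 'v"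
  assumes fr: "\<And>y. y \<in> SP \<Longrightarrow> (\<Sum>i\<in>UNIV. (r' i * form y (v' i)) *\<^sub>Q v' i) = y" and v': "\<And>i. v' i \<in> SP"
    and Bsum: "\<And>F z. B (\<Sum>i\<in>UNIV. F (i :: ni)) z = (\<Sum>i\<in>UNIV. B (F i) z)"
      "\<And>F z. B z (\<Sum>i\<in>UNIV. F (i :: ni)) = (\<Sum>i\<in>UNIV. B z (F i))"
    and Bscale: "\<And>r y z. B (r *\<^sub>Q y) z = r *\<^sub>Q B y z" "\<And>r y z. B y (r *\<^sub>Q z) = r *\<^sub>Q B y z"
  shows "(\<Sum>j\<in>UNIV. r' j *\<^sub>Q B (v' j) (v' j)) = (\<Sum>i\<in>UNIV. rw i *\<^sub>Q (B (nv i) (nv i) :: 'v))"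
proof -
  have "(\<Sum>j\<in>UNIV. r' j *\<^sub>Q B (v' j) (v' j)) =
      (\<Sum>j\<in>UNIV. r' j *\<^sub>Q B (v' j) (\<Sum>i\<in>UNIV. (rw i * form (v' j) (nv i)) *\<^sub>Q nv i))"
    by (simp add: frame_SP v')
  also have "\<dots> = (\<Sum>j\<in>UNIV. \<Sum>i\<in>UNIV. (r' j * (rw i * form (v' j) (nv i))) *\<^sub>Q B (v' j) (nv i))"
    by (simp add: Bsum Bscale scale_sum_right)
  also have "\<dots> = (\<Sum>i\<in>UNIV. \<Sum>j\<in>UNIV. (r' j * (rw i * form (v' j) (nv i))) *\<^sub>Q B (v' j) (nv i))"
    by (rule sum.swap)
  also have "\<dots> = (\<Sum>i\<in>UNIV. rw i *\<^sub>Q B (\<Sum>j\<in>UNIV. (r' j * form (nv i) (v' j)) *\<^sub>Q v' j) (nv i))"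
    unfolding Bsum Bscale scale_sum_right by (intro sum.cong refl) (simp add: form_sym[of "nv _" "v' _"] mult_ac)
  also have "\<dots> = (\<Sum>i\<in>UNIV. rw i *\<^sub>Q B (nv i) (nv i))"
    by (simp add: fr)
  finally show ?thesis .
qed

lemma es_split: "es = u D1 + u D2 + u D3 + u D4"
  by (simp add: es_sum sum_dir)

lemma f_D: "f D2 = f D1" "f D4 = f D3" and dl_D: "dl D2 = - dl D1" "dl D4 = - dl D3"
  using f_perp[of D1] f_perp[of D3] dl_perp[of D1] dl_perp[of D3] by simp_all

end

section \<open>Explicit Casimir elements and their eigenvectors\<close>

context m9_config
begin

lemma cas_eq: "cas = (5/2) *\<^sub>Q es + (55/26) *\<^sub>Q (f D1 + f D3)"
proof -
  define vs where "vs = [u D1, u D2, u D3, u D4, f D1, f D3, dl D1, dl D3,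
    w D1 N0, w D1 N1, w D2 N0, w D2 N1, w D3 N0, w D3 N1, w D4 N0, w D4 N1,
    x D1 N0, x D1 N1, x D2 N0, x D2 N1, x D3 N0, x D3 N1, x D4 N0, x D4 N1]"
  have vs: "u D1 = den vs (LG 0)" "u D2 = den vs (LG 1)" "u D3 = den vs (LG 2)" "u D4 = den vs (LG 3)"
    "f D1 = den vs (LG 4)" "f D3 = den vs (LG 5)" "dl D1 = den vs (LG 6)" "dl D3 = den vs (LG 7)"
    "w D1 N0 = den vs (LG 8)" "w D1 N1 = den vs (LG 9)" "w D2 N0 = den vs (LG 10)" "w D2 N1 = den vs (LG 11)"
    "w D3 N0 = den vs (LG 12)" "w D3 N1 = den vs (LG 13)" "w D4 N0 = den vs (LG 14)" "w D4 N1 = den vs (LG 15)"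
    "x D1 N0 = den vs (LG 16)" "x D1 N1 = den vs (LG 17)" "x D2 N0 = den vs (LG 18)" "x D2 N1 = den vs (LG 19)"
    "x D3 N0 = den vs (LG 20)" "x D3 N1 = den vs (LG 21)" "x D4 N0 = den vs (LG 22)" "x D4 N1 = den vs (LG 23)"
    by (simp_all add: vs_def)
  have len: "[0..<length vs] = [0, 1, 2, 3, 4, 5, 6, 7, 8, 9, 10, 11, 12, 13, 14, 15, 16, 17, 18, 19, 20, 21, 22, 23]"
    by (simp add: vs_def upt_rec)
  show ?thesis
    unfolding cas_def sum_ni sum_dir sum_f3 rw.simps nv.simps w_w x_x f_f dl_dl mul_uu perp.simps f_D dl_D
      es_split w_N2 x_N2
    by (simp only: vs den_fold cong: den_cong, rule den_eqI, simp add: len)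
qed

text \<open>\<open>f k\<close> annihilates all \<open>u\<close> and \<open>w\<close> vectors and the
  \<open>f\<close>, \<open>dl\<close>, \<open>x\<close> vectors of the two skew classes, so only
  those of \<open>k\<close> and \<open>perp k\<close> contribute.\<close>

lemma tcas_eq: "tcas (f k) = (1/4) *\<^sub>Q (u k + u (perp k)) + (1/8) *\<^sub>Q (es - u k - u (perp k)) + (77/52) *\<^sub>Q f k"
proof -
  have u0: "u i \<diamondop> (f k \<diamondop> u i) = 0 *\<^sub>Q u D1" and w0: "w i c \<diamondop> (f k \<diamondop> w i c) = 0 *\<^sub>Q u D1" for i c
    by (simp_all add: f_u f_w)
  have f1: "f i \<diamondop> (f k \<diamondop> f i) = (if i = k \<or> i = perp k then 1 else 0) *\<^sub>Q f i" for i
    using f_f_skew[of i k] by (auto simp: f_f)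
  have dl1: "dl i \<diamondop> (f k \<diamondop> dl i) = (if i = k \<or> i = perp k then 3/5 else 0) *\<^sub>Q (dl i \<diamondop> dl i)" for i
    using f_dl_skew[of i k] f_dl[of k] by (auto simp: mul_scale_right mul_minus_left mul_minus_right)
  have x1: "x i c \<diamondop> (f k \<diamondop> x i c) = (if i = k \<or> i = perp k then 3/5 else 0) *\<^sub>Q (x i c \<diamondop> x i c)" for i c
    using f_x_skew[of i k] f_x[of k c] f_x[of "perp k" c] by (auto simp: mul_scale_right)
  define vs where "vs = [u D1, u D2, u D3, u D4, f D1, f D3, dl D1, dl D3,
    w D1 N0, w D1 N1, w D2 N0, w D2 N1, w D3 N0, w D3 N1, w D4 N0, w D4 N1,
    x D1 N0, x D1 N1, x D2 N0, x D2 N1, x D3 N0, x D3 N1, x D4 N0, x D4 N1]"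
  have vs: "u D1 = den vs (LG 0)" "u D2 = den vs (LG 1)" "u D3 = den vs (LG 2)" "u D4 = den vs (LG 3)"
    "f D1 = den vs (LG 4)" "f D3 = den vs (LG 5)" "dl D1 = den vs (LG 6)" "dl D3 = den vs (LG 7)"
    "w D1 N0 = den vs (LG 8)" "w D1 N1 = den vs (LG 9)" "w D2 N0 = den vs (LG 10)" "w D2 N1 = den vs (LG 11)"
    "w D3 N0 = den vs (LG 12)" "w D3 N1 = den vs (LG 13)" "w D4 N0 = den vs (LG 14)" "w D4 N1 = den vs (LG 15)"
    "x D1 N0 = den vs (LG 16)" "x D1 N1 = den vs (LG 17)" "x D2 N0 = den vs (LG 18)" "x D2 N1 = den vs (LG 19)"
    "x D3 N0 = den vs (LG 20)" "x D3 N1 = den vs (LG 21)" "x D4 N0 = den vs (LG 22)" "x D4 N1 = den vs (LG 23)"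
    by (simp_all add: vs_def)
  have len: "[0..<length vs] = [0, 1, 2, 3, 4, 5, 6, 7, 8, 9, 10, 11, 12, 13, 14, 15, 16, 17, 18, 19, 20, 21, 22, 23]"
    by (simp add: vs_def upt_rec)
  show ?thesis
    unfolding tcas_def sum_ni sum_dir sum_f3 rw.simps nv.simps u0 w0 f1 dl1 x1
    unfolding x_x dl_dl
    unfolding f_D dl_D es_split
    by (cases k; simp only: perp.simps dir.distinct simp_thms if_True if_False f_D dl_D w_N2 x_N2; simp only: vs den_fold cong: den_cong; rule den_eqI; simp add: len)
qed

lemma cas_eigen: "cas \<diamondop> u k = (5/2) *\<^sub>Q u k" "cas \<diamondop> w k c = (5/2) *\<^sub>Q w k c"
  "cas \<diamondop> f k = (55/26) *\<^sub>Q f k" "cas \<diamondop> dl k = (59/26) *\<^sub>Q dl k" "cas \<diamondop> x k c = (59/26) *\<^sub>Q x k c"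
proof -
  have fs: "f D1 + f D3 = f k + f j" if "j \<noteq> k" "j \<noteq> perp k" for j k
    using that by (cases j; cases k; simp add: f_D add.commute)
  obtain j where j: "j \<noteq> k" "j \<noteq> perp k"
    using ex_skew by blast
  then have j': "k \<noteq> j" "k \<noteq> perp j" "perp j \<noteq> k" "perp j \<noteq> perp k"
    by (metis perp_perp)+
  have es4: "es = u k + u (perp k) + u j + u (perp j)"
    by (rule es_eq[OF j])
  show "cas \<diamondop> u k = (5/2) *\<^sub>Q u k"
    by (simp add: cas_eq mul_lin es_u f_u)
  have "es \<diamondop> w k c = (1/3 + 1/3 + 1/3) *\<^sub>Q w k c"
    unfolding es4 scale_left_distrib using j j' by (simp add: mul_add_left u_w u_w_perp)
  then show "cas \<diamondop> w k c = (5/2) *\<^sub>Q w k c"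
    by (simp add: cas_eq mul_lin f_w)
  have "es \<diamondop> f k = 0"
    unfolding es4 using f_u[of k] by (simp add: mul_add_left mul_commute[of "u _" "f k"])
  then show "cas \<diamondop> f k = (55/26) *\<^sub>Q f k"
    unfolding cas_eq fs[OF j] using f_f_skew[OF j'(1,2)] by (simp add: mul_lin f_f)
  have "es \<diamondop> dl k = (1/5 + 1/5) *\<^sub>Q dl k"
    unfolding es4 scale_left_distrib using j j' by (simp add: mul_add_left u_dl u_dl_perp u_dl_skew)
  then have e: "es \<diamondop> dl k = (2/5) *\<^sub>Q dl k"
    by simp
  have "cas \<diamondop> dl k = (5/2 * (2/5) + 55/26 * (3/5)) *\<^sub>Q dl k"
    unfolding cas_eq fs[OF j] scale_left_distrib using j' by (simp add: mul_lin e f_dl f_dl_skew)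
  then show "cas \<diamondop> dl k = (59/26) *\<^sub>Q dl k"
    by simp
  have "es \<diamondop> x k c = (1/3 + (1/30 + 1/30)) *\<^sub>Q x k c"
    unfolding es4 scale_left_distrib using j j' by (simp add: mul_add_left u_x u_x_perp u_x_skew)
  then have e: "es \<diamondop> x k c = (2/5) *\<^sub>Q x k c"
    by simp
  have "cas \<diamondop> x k c = (5/2 * (2/5) + 55/26 * (3/5)) *\<^sub>Q x k c"
    unfolding cas_eq fs[OF j] scale_left_distrib using j' by (simp add: mul_lin e f_x f_x_skew)
  then show "cas \<diamondop> x k c = (59/26) *\<^sub>Q x k c"
    by simp
qed

text \<open>On the 5/2-eigenspace of \<open>cas\<close> the eigenvalue 1/4 belongs to
  \<open>u k\<close> and \<open>u (perp k)\<close> alone; the other values are 1/8, 1/6 and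
  5/24.\<close>

lemma tcas_eigen:
  "tcas (f k) \<diamondop> u k = (1/4) *\<^sub>Q u k"
  "j \<noteq> k \<Longrightarrow> j \<noteq> perp k \<Longrightarrow> tcas (f k) \<diamondop> u j = (1/8) *\<^sub>Q u j"
  "tcas (f k) \<diamondop> w k c = (1/6) *\<^sub>Q w k c"
  "j \<noteq> k \<Longrightarrow> j \<noteq> perp k \<Longrightarrow> tcas (f k) \<diamondop> w j c = (5/24) *\<^sub>Q w j c"
proof -
  show "tcas (f k) \<diamondop> u k = (1/4) *\<^sub>Q u k"
    by (simp add: tcas_eq mul_lin es_u mul_uu mul_uu_distinct f_u)
  show "tcas (f k) \<diamondop> u j = (1/8) *\<^sub>Q u j" if "j \<noteq> k" "j \<noteq> perp k"
    using that by (simp add: tcas_eq mul_lin es_u mul_uu_distinct f_u)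
  have es: "es \<diamondop> w j c = w j c" for j
    using cas_eigen(2)[of j c] by (simp add: cas_eq mul_lin f_w)
  have "tcas (f k) \<diamondop> w k c = (1/4) *\<^sub>Q ((1/3) *\<^sub>Q w k c) + (1/8) *\<^sub>Q (1 *\<^sub>Q w k c - (1/3) *\<^sub>Q w k c)"
    by (simp add: tcas_eq mul_lin es f_w u_w u_w_perp)
  then have "tcas (f k) \<diamondop> w k c = (1/6) *\<^sub>Q w k c"
    unfolding scale_left_distrib[symmetric] scale_left_diff_distrib[symmetric] scale_scale by simp
  then show "tcas (f k) \<diamondop> w k c = (1/6) *\<^sub>Q w k c"
    by simp
  show "tcas (f k) \<diamondop> w j c = (5/24) *\<^sub>Q w j c" if "j \<noteq> k" "j \<noteq> perp k"
  proof -
    have "k \<noteq> perp j" "perp k \<noteq> perp j"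
      using that by (metis perp_perp)+
    then have "tcas (f k) \<diamondop> w j c = (1/4 * (2/3) + 1/8 * (1/3)) *\<^sub>Q w j c"
    proof -
      have "tcas (f k) \<diamondop> w j c = (1/4) *\<^sub>Q ((1/3) *\<^sub>Q w j c + (1/3) *\<^sub>Q w j c) +
          (1/8) *\<^sub>Q (1 *\<^sub>Q w j c - (1/3) *\<^sub>Q w j c - (1/3) *\<^sub>Q w j c)"
        using \<open>k \<noteq> perp j\<close> \<open>perp k \<noteq> perp j\<close> by (simp add: tcas_eq mul_lin es f_w u_w)
      then show ?thesis
        unfolding scale_left_distrib[symmetric] scale_left_diff_distrib[symmetric] scale_scale by simp
    qed
    then show ?thesis by simp
  qed
qed

end

section \<open>Canonical idempotents under an automorphism\<close>

context m9_config
begin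

text \<open>Turns orthogonality to frame vectors into membership in the span of the remaining ones,
  even though the frame is redundant.\<close>

lemma frame_select:
  assumes "y \<in> SP" "\<And>i. i \<notin> I \<Longrightarrow> form y (nv i) = 0"
  shows "y = (\<Sum>i\<in>I. (rw i * form y (nv i)) *\<^sub>Q nv i)"
proof -
  have "(\<Sum>i\<in>I. (rw i * form y (nv i)) *\<^sub>Q nv i) = (\<Sum>i\<in>UNIV. (rw i * form y (nv i)) *\<^sub>Q nv i)"
    by (rule sum.mono_neutral_left) (use assms(2) in auto)
  then show ?thesis
    by (simp add: frame_SP assms(1))
qed

text \<open>Idempotence forces both coefficients to be 0 or 1, and the norm then allows exactly one
  of them to be 1.\<close>

lemma idempotent_pair:
  assumes y: "y = r *\<^sub>Q v + r' *\<^sub>Q v'" and yy: "y \<diamondop> y = y" and v: "v \<diamondop> v = v" "v' \<diamondop> v' = v'" "v \<diamondop> v' = 0"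
    and n: "form y y = n" "form v v = n" "form v' v' = n" "n \<noteq> 0"
  shows "y = v \<or> y = v'"
proof -
  have fo: "form v v' = 0"
    by (metis form_frobenius form_zero(2) v(1,3))
  have "y \<diamondop> y = (r * r) *\<^sub>Q v + (r' * r') *\<^sub>Q v'"
    unfolding y using v mul_commute[of v' v] by (simp add: mul_lin)
  then have e: "(r * r) *\<^sub>Q v + (r' * r') *\<^sub>Q v' = r *\<^sub>Q v + r' *\<^sub>Q v'"
    using yy y by simp
  have "r * r * n = r * n" "r' * r' * n = r' * n"
    using arg_cong[OF e, of "form v"] arg_cong[OF e, of "form v'"] fo n(2,3) form_sym[of v' v]
    by (simp_all add: form_add_right form_scale_right)
  with \<open>n \<noteq> 0\<close> have 1: "r = 0 \<or> r = 1" "r' = 0 \<or> r' = 1"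
    by auto
  have "form y y = r * r * n + r' * r' * n"
    unfolding y using fo n(2,3) form_sym[of v' v] by (simp add: form_lin)
  with n(1,4) have "r * r + r' * r' = 1"
    by (simp flip: distrib_right)
  with 1 show ?thesis
    using y by auto
qed

lemma u_inj: "u j = u k \<longleftrightarrow> j = k"
  using form_uu[of k] form_uu_distinct[of j k] by (cases "j = k") auto

lemma w_inj: "w k c = w k d \<longleftrightarrow> c = d"
  using form_w[of k c k d] form_w[of k d k d] by (auto split: if_splits)

lemma f_eq_iff: "f j = f k \<longleftrightarrow> j = k \<or> j = perp k"
  using form_f[of j k] form_f[of k k] by (auto split: if_splits)

context
  fixes h
  assumes h: "saut h"
begin

lemmas h_rules = h_add[OF h] h_diff[OF h] h_scale[OF h] h_mul[OF h] h_SP[OF h] SP_closed SP_mul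

text \<open>The image of the frame is again a frame, with weights divided by the scaling factor of
  the form.\<close>

lemma frame_image:
  assumes r: "r \<noteq> 0" "\<forall>y\<in>SP. \<forall>z\<in>SP. form (h y) (h z) = r * form y z" and y: "y \<in> SP"
  shows "(\<Sum>i\<in>UNIV. (rw i / r * form y (h (nv i))) *\<^sub>Q h (nv i)) = y"
proof -
  obtain z where z: "z \<in> SP" "y = h z"
    using h_surj[OF h y] by blast
  have fz: "form y (h (nv i)) = r * form z (nv i)" for i
    using r(2) z by simp
  have "y = h (\<Sum>i\<in>UNIV. (rw i * form z (nv i)) *\<^sub>Q nv i)"
    by (simp add: frame_SP z)
  also have "\<dots> = (\<Sum>i\<in>UNIV. (rw i * form z (nv i)) *\<^sub>Q h (nv i))"
    by (simp add: h_sum[OF h] h_rules)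
  also have "\<dots> = (\<Sum>i\<in>UNIV. (rw i / r * form y (h (nv i))) *\<^sub>Q h (nv i))"
    by (simp add: fz r(1))
  finally show ?thesis ..
qed

text \<open>Because the image frame has weights \<open>rw i / r\<close>, uniqueness of the Casimir
  element shows that \<open>h cas\<close> is \<open>r\<close> times \<open>cas\<close>.\<close>

lemma h_cas: "h cas = cas" and h_iso: "y \<in> SP \<Longrightarrow> z \<in> SP \<Longrightarrow> form (h y) (h z) = form y z"
proof -
  obtain r where r: "r > 0" "\<forall>y\<in>SP. \<forall>z\<in>SP. form (h y) (h z) = r * form y z"
    using h_form[OF h] by blast
  have "(\<Sum>i\<in>UNIV. (rw i / r) *\<^sub>Q (h (nv i) \<diamondop> h (nv i))) = cas"
    unfolding cas_def using r
    by (intro casimir_unique frame_image) (auto simp: h_rules mul_sum_left mul_sum_right mul_lin)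
  moreover have "h cas = (\<Sum>i\<in>UNIV. rw i *\<^sub>Q (h (nv i) \<diamondop> h (nv i)))"
    unfolding cas_def by (simp add: h_sum[OF h] h_rules)
  moreover have "\<dots> = r *\<^sub>Q (\<Sum>i\<in>UNIV. (rw i / r) *\<^sub>Q (h (nv i) \<diamondop> h (nv i)))"
    using r by (simp add: scale_sum_right)
  ultimately have hc: "h cas = r *\<^sub>Q cas"
    by simp
  have "cas \<in> SP"
    unfolding cas_eq by (intro SP_closed) auto
  \<comment> \<open>Computed from \<open>h cas\<close> being \<open>r\<close> times
    \<open>cas\<close>, the same value is r * r times the norm of \<open>cas\<close>; as
    \<open>cas\<close> is nonzero and r is positive, r is 1.\<close>
  then have "form (h cas) (h cas) = r * form cas cas"
    using r(2) by blast
  then have "r * r * form cas cas = r * form cas cas"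
    by (auto simp: hc form_scale_left form_scale_right)
  moreover have "cas \<noteq> 0"
    using cas_eigen(1)[of D1] form_uu[of D1] by auto
  ultimately have "r = 1"
    using r(1) form_pos_def[of cas] by auto
  then show "h cas = cas" "y \<in> SP \<Longrightarrow> z \<in> SP \<Longrightarrow> form (h y) (h z) = form y z"
    using hc r(2) by auto
qed

lemma h_tcas: "t \<in> SP \<Longrightarrow> h (tcas t) = tcas (h t)"
proof -
  assume t: "t \<in> SP"
  have "(\<Sum>i\<in>UNIV. (rw i / 1) *\<^sub>Q (h (nv i) \<diamondop> (h t \<diamondop> h (nv i)))) = tcas (h t)"
    unfolding tcas_def
    by (intro casimir_unique frame_image) (auto simp: h_iso h_rules mul_sum_left mul_sum_right mul_lin)
  moreover have "h (tcas t) = (\<Sum>i\<in>UNIV. rw i *\<^sub>Q (h (nv i) \<diamondop> (h t \<diamondop> h (nv i))))"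
    unfolding tcas_def using t by (simp add: h_sum[OF h] h_rules)
  ultimately show ?thesis
    by simp
qed

text \<open>An eigenvector equation is transported by the automorphism, and it makes the image
  orthogonal to the eigenvectors for other eigenvalues.\<close>

lemma h_orth:
  assumes "t \<diamondop> y = l *\<^sub>Q y" "h t \<diamondop> z = m *\<^sub>Q z" "l \<noteq> m" "t \<in> SP" "y \<in> SP"
  shows "form (h y) z = 0"
proof (rule eigen_orth[OF _ assms(2,3)])
  show "h t \<diamondop> h y = l *\<^sub>Q h y"
    using assms by (simp add: h_scale[OF h] flip: h_mul[OF h])
qed

text \<open>The image lies in the 55/26-eigenspace of \<open>cas\<close>, spanned by
  \<open>f D1\<close> and \<open>f D3\<close>, and it is an idempotent of the norm of these
  two.\<close>

lemma h_f: "h (f k) = f D1 \<or> h (f k) = f D3"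
proof -
  have cS: "cas \<in> SP"
    unfolding cas_eq by (intro SP_closed) auto
  have o: "form (h (f k)) z = 0" if "cas \<diamondop> z = m *\<^sub>Q z" "55/26 \<noteq> m" for z m
    using h_orth[OF cas_eigen(3) _ that(2) cS SP_f] that(1) by (simp add: h_cas)
  have "h (f k) = (\<Sum>i\<in>range If. (rw i * form (h (f k)) (nv i)) *\<^sub>Q nv i)"
  proof (rule frame_select)
    fix i assume "i \<notin> range If"
    then show "form (h (f k)) (nv i) = 0"
      by (cases i) (auto intro: o[OF cas_eigen(1)] o[OF cas_eigen(2)] o[OF cas_eigen(4)] o[OF cas_eigen(5)])
  qed (simp add: h_rules)
  also have "\<dots> = (\<Sum>j\<in>UNIV. (55/208 * form (h (f k)) (f j)) *\<^sub>Q f j)"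
    by (subst sum.reindex) (auto simp: inj_def)
  also have "\<dots> = (55/208 * form (h (f k)) (f D1) + 55/208 * form (h (f k)) (f D1)) *\<^sub>Q f D1
     + (55/208 * form (h (f k)) (f D3) + 55/208 * form (h (f k)) (f D3)) *\<^sub>Q f D3"
    by (simp only: sum_dir f_D scale_left_distrib add.assoc)
  finally have y: "h (f k) = (55/208 * form (h (f k)) (f D1) + 55/208 * form (h (f k)) (f D1)) *\<^sub>Q f D1
     + (55/208 * form (h (f k)) (f D3) + 55/208 * form (h (f k)) (f D3)) *\<^sub>Q f D3" .
  show ?thesis
    by (rule idempotent_pair[OF y, where n = "104/55"])
      (auto simp: f_f f_f_skew h_iso form_f_f simp flip: h_mul[OF h])
qed

text \<open>\<open>h\<close> maps \<open>tcas (f k)\<close> to \<open>tcas (f j)\<close>. The image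
  of \<open>u k\<close> is therefore in the joint eigenspace for 5/2 and 1/4, spanned by the
  orthogonal idempotents \<open>u j\<close> and \<open>u (perp j)\<close>.\<close>

lemma h_u_f: "\<exists>j. h (f k) = f j \<and> (h (u k) = u j \<or> h (u k) = u (perp j))"
proof -
  obtain j where j: "h (f k) = f j"
    using h_f[of k] by blast
  have cS: "cas \<in> SP"
    unfolding cas_eq by (intro SP_closed) auto
  have tS: "tcas (f k) \<in> SP"
    unfolding tcas_eq by (intro SP_closed) auto
  have o1: "form (h (u k)) z = 0" if "cas \<diamondop> z = m *\<^sub>Q z" "5/2 \<noteq> m" for z m
    using h_orth[OF cas_eigen(1) _ that(2) cS SP_u] that(1) by (simp add: h_cas)
  have o2: "form (h (u k)) z = 0" if "tcas (f j) \<diamondop> z = m *\<^sub>Q z" "1/4 \<noteq> m" for z m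
    using h_orth[OF tcas_eigen(1) _ that(2) tS SP_u] that(1) by (simp add: h_tcas j)
  have tw: "form (h (u k)) (w i c) = 0" for i c
  proof -
    consider "i = j" | "i = perp j" | "i \<noteq> j" "i \<noteq> perp j" by blast
    then show ?thesis
    proof cases
      case 1
      then show ?thesis using o2[OF tcas_eigen(3)] by simp
    next
      case 2
      then show ?thesis using o2[of "w i c" "1/6"] tcas_eigen(3)[of i c] by simp
    next
      case 3
      then show ?thesis using o2[OF tcas_eigen(4)] by simp
    qed
  qed
  have "h (u k) = (\<Sum>i\<in>{Iu j, Iu (perp j)}. (rw i * form (h (u k)) (nv i)) *\<^sub>Q nv i)"
  proof (rule frame_select)
    fix i assume "i \<notin> {Iu j, Iu (perp j)}"
    then show "form (h (u k)) (nv i) = 0"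
      by (cases i) (auto simp: tw intro: o2[OF tcas_eigen(2)] o1[OF cas_eigen(3)] o1[OF cas_eigen(4)] o1[OF cas_eigen(5)])
  qed (simp add: h_rules)
  then have y: "h (u k) = (5/8 * form (h (u k)) (u j)) *\<^sub>Q u j + (5/8 * form (h (u k)) (u (perp j))) *\<^sub>Q u (perp j)"
    by simp
  have "h (u k) = u j \<or> h (u k) = u (perp j)"
    by (rule idempotent_pair[OF y, where n = "8/5"])
      (auto simp: mul_uu mul_uu_distinct h_iso form_uu simp flip: h_mul[OF h])
  with j show ?thesis by blast
qed

text \<open>\<open>f k\<close> and \<open>f (perp k)\<close> coincide, so both 3A-axes of a
  perpendicular pair go to the same pair; injectivity leaves the other member.\<close>

lemma h_u_perp: "h (u k) = u j \<Longrightarrow> h (u (perp k)) = u (perp j)"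
proof -
  assume k: "h (u k) = u j"
  obtain i i' where i: "h (f k) = f i" "h (u k) = u i \<or> h (u k) = u (perp i)"
    "h (f (perp k)) = f i'" "h (u (perp k)) = u i' \<or> h (u (perp k)) = u (perp i')"
    using h_u_f by metis
  have "f i = f i'"
    using i by simp
  then have ii: "i' = i \<or> i' = perp i"
    unfolding f_eq_iff by (metis perp_perp)
  have ne: "h (u (perp k)) \<noteq> h (u k)"
    using h_inj[OF h, of "u (perp k)" "u k"] u_inj by auto
  show ?thesis
    using i(2,4) ii ne unfolding k by (elim disjE) (simp_all add: u_inj)
qed

end

end

section \<open>Reduction modulo the affine group\<close>

lemma kmap_comp: "\<exists>c'' d''. kmap c s d \<circ> kmap c' s' d' = kmap c'' (s \<noteq> s') d''"
proof -
  obtain c1 c2 d1 d2 c1' c2' d1' d2' where e: "c = (c1, c2)" "d = (d1, d2)" "c' = (c1', c2')" "d' = (d1', d2')"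
    by (metis surj_pair)
  \<comment> \<open>Signs as factors replace the conditional negation of the second coordinate, so
    that the composition becomes a ring identity with t * t = 1.\<close>
  define t where "t = (if s then N2 else N1)"
  define t' where "t' = (if s' then N2 else N1)"
  have ty: "(if s then - y else y) = t * y" "(if s' then - y else y) = t' * y"
    "(if s \<noteq> s' then - y else y) = t * (t' * y)" for y
    by (cases y; simp add: t_def t'_def)+
  have k: "kmap (p, q) s (m, n) (x, y) = (p * x - q * (t * y) + m, q * x + p * (t * y) + n)"
    and k': "kmap (p, q) s' (m, n) (x, y) = (p * x - q * (t' * y) + m, q * x + p * (t' * y) + n)"
    and k'': "kmap (p, q) (s \<noteq> s') (m, n) (x, y) = (p * x - q * (t * (t' * y)) + m, q * x + p * (t * (t' * y)) + n)"
    for p q m n x y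
    unfolding kmap.simps ty Let_def by (rule refl)+
  have tt: "t * t = 1"
    by (simp add: t_def)
  have tt2: "t * (t * z) = z" for z
    by (metis tt mult.assoc mult_1)
  have "kmap c s d \<circ> kmap c' s' d' = kmap (c1 * c1' - c2 * (t * c2'), c2 * c1' + c1 * (t * c2')) (s \<noteq> s')
      (c1 * d1' - c2 * (t * d2') + d1, c2 * d1' + c1 * (t * d2') + d2)"
    unfolding e by (rule ext) (clarsimp simp only: split_paired_all comp_apply k k' k'', simp add: algebra_simps tt tt2)
  then show ?thesis by blast
qed

lemma Kset_comp: "g \<in> Kset \<Longrightarrow> g' \<in> Kset \<Longrightarrow> g \<circ> g' \<in> Kset"
proof -
  assume g: "g \<in> Kset" "g' \<in> Kset"
  then obtain c s d where e: "g \<circ> g' = kmap c s d"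
    unfolding Kset_def using kmap_comp by blast
  \<comment> \<open>A zero linear part would make the composition constant, against
    injectivity.\<close>
  have "c \<noteq> 0"
  proof
    assume "c = 0"
    then have "(g \<circ> g') (N0, N0) = (g \<circ> g') (N1, N0)"
      unfolding e by (cases d) (simp add: zero_prod_def)
    moreover have "inj (g \<circ> g')"
      using Kset_bij[OF g(1)] Kset_bij[OF g(2)] by (intro inj_compose bij_is_inj)
    ultimately have "(N0, N0) = (N1, N0)"
      by (rule injD[rotated])
    then show False
      by simp
  qed
  with e show ?thesis
    by (rule KsetI)
qed

lemma id_Kset: "id \<in> Kset"
  by (rule KsetI[of _ "(N1, N0)" False "(N0, N0)"]) (auto simp: fun_eq_iff zero_prod_def)

lemma finite_Kset: "finite Kset"
  by (rule finite_subset[OF subset_UNIV]) simp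

text \<open>Left composition with \<open>g\<close> is injective on the finite set
  \<open>Kset\<close>, hence onto, and so reaches the identity.\<close>

lemma Kset_inverse: "g \<in> Kset \<Longrightarrow> \<exists>g'\<in>Kset. g' \<circ> g = id \<and> g \<circ> g' = id"
proof -
  assume g: "g \<in> Kset"
  have "inj_on (\<lambda>g'. g \<circ> g') Kset"
  proof (rule inj_onI, rule ext)
    fix g1 g2 p assume "g \<circ> g1 = g \<circ> g2"
    then have "g (g1 p) = g (g2 p)"
      by (metis comp_apply)
    then show "g1 p = g2 p"
      using Kset_bij[OF g] by (metis bij_is_inj injD)
  qed
  moreover have "(\<lambda>g'. g \<circ> g') ` Kset \<subseteq> Kset"
    using g Kset_comp by blast
  ultimately have "(\<lambda>g'. g \<circ> g') ` Kset = Kset"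
    by (rule endo_inj_surj[OF finite_Kset, rotated])
  then obtain g' where g': "g' \<in> Kset" "g \<circ> g' = id"
    using id_Kset by (metis imageE)
  then have "g' \<circ> g = id"
    using Kset_bij[OF g] by (metis bij_is_inj comp_assoc comp_id inv_o_cancel id_comp)
  with g' show ?thesis by blast
qed

lemma group_Kgrp: "group Kgrp"
  by (rule groupI) (auto simp: Kgrp_def Kset_comp id_Kset o_assoc dest: Kset_inverse)

fun srf :: "dir \<Rightarrow> dir" where
  "srf D1 = D1" | "srf D2 = D2" | "srf D3 = D4" | "srf D4 = D3"

lemma line_map_rho: "line_map (rho D1 N0) srf (\<lambda>k d. if k = D2 then d else - d)"
proof (rule line_mapI[of _ "(N2, N0)" True "(N0, N0)"])
  show "rho D1 N0 = kmap (N2, N0) True (N0, N0)"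
    unfolding fun_eq_iff split_paired_all by (simp add: all_f3)
  show "(N2, N0) \<noteq> 0"
    by (simp add: zero_prod_def)
  show "srf (perp k) = perp (srf k)" for k
    by (cases k; simp)
  show "lam (srf k) (rho D1 N0 p) = (if k = D2 then lam k p else - lam k p)" for k p
    by (cases p; cases k; cases "fst p"; cases "snd p"; simp)
  show "rho D1 N0 \<circ> rho k c = rho (srf k) (if k = D2 then c else - c) \<circ> rho D1 N0" for k c
    unfolding fun_eq_iff split_paired_all by (cases k; cases c; simp add: all_f3)
qed

text \<open>Homotheties and translations fix all four parallel classes; they are what remains to be
  matched once the 3A-axes are fixed.\<close>

lemma line_map_homothety:
  assumes "t \<noteq> N0"
  shows "line_map (kmap (t, N0) False q) (\<lambda>k. k) (\<lambda>k d. t * d + lam k q)"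
proof (rule line_mapI[OF refl])
  obtain q1 q2 where q: "q = (q1, q2)"
    by fastforce
  show "(t, N0) \<noteq> 0"
    using assms by (simp add: zero_prod_def)
  show "lam k (kmap (t, N0) False q p) = t * lam k p + lam k q" for k p
    unfolding q by (cases p; cases k; cases "fst p"; cases "snd p"; cases q1; cases q2; cases t; simp)
  show "kmap (t, N0) False q \<circ> rho k c = rho k (t * c + lam k q) \<circ> kmap (t, N0) False q" for k c
    unfolding q fun_eq_iff split_paired_all
    by (cases k; cases c; cases q1; cases q2; cases t; simp add: all_f3)
qed simp

section \<open>Automorphisms induced by the affine group\<close>

context m9_config
begin

lemma b_inj: "b k c = b j d \<longleftrightarrow> k = j \<and> c = d"
proof -
  consider "j = k" | "j = perp k" | "j \<noteq> k" "j \<noteq> perp k" by blast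
  then show ?thesis
    using form_bb_par[of c d k] form_axis_b[of k c] form_bb_perp[of k c d] form_bb_skew[of j k c d]
    by cases (cases "c = d", auto)
qed

lemma saut_comp:
  assumes "saut h" "saut h'"
  shows "saut (h \<circ> h')"
proof -
  note r = h_add[OF assms(1)] h_add[OF assms(2)] h_scale[OF assms(1)] h_scale[OF assms(2)]
    h_mul[OF assms(1)] h_mul[OF assms(2)] h_SP[OF assms(2)]
  have "bij_betw (h \<circ> h') SP SP"
    using assms by (intro bij_betw_trans) (auto simp: saut_def)
  then show ?thesis
    unfolding saut_def by (simp add: r)
qed

lemma saut_act:
  assumes lm: "line_map g s t"
  shows "saut (act g)"
proof -
  note A = act_all[OF lm]
  have inj: "inj (act g)"
    by (rule act_inj[OF lmK[OF lm]])
  define l where "l = (\<lambda>(k, c). (s k, t k c))"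
  have "inj l"
  proof (rule injI, clarsimp simp: l_def)
    fix k c j d assume "s k = s j" "t k c = t j d"
    then have "act g (b k c) = act g (b j d)"
      by (simp add: A)
    then show "k = j \<and> c = d"
      using inj b_inj by (metis injD)
  qed
  then have "surj l"
    by (rule finite_UNIV_inj_surj[rotated]) simp
  then have surj: "\<exists>j d. k = s j \<and> c = t j d" for k c
  proof -
    obtain p where "(k, c) = l p"
      using \<open>surj l\<close> by (rule surjE)
    then show ?thesis
      unfolding l_def by (cases p) auto
  qed
  have sp: "act g y \<in> span (act g ` Y)" if "y \<in> span Y" for y Y
    using that
  proof (induction rule: span_induct_alt)
    case base
    then show ?case by (simp add: A span_zero)
  next
    case (step c y z)
    then show ?case by (simp add: A span_add span_scale span_base)
  qed
  have sp2: "span (act g ` Y) \<subseteq> act g ` span Y" for Y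
  proof (rule span_minimal)
    show "act g ` Y \<subseteq> act g ` span Y"
      by (auto intro: span_base)
    show "subspace (act g ` span Y)"
      unfolding subspace_def
    proof (intro conjI ballI allI)
      show "0 \<in> act g ` span Y"
        using A(5) span_zero by (intro image_eqI[of _ _ 0]) auto
    qed (auto simp: A(2,4)[symmetric] intro!: imageI span_add span_scale)
  qed
  have im: "act g ` (ax \<union> range u) = ax \<union> range u"
  proof (rule antisym)
    show "act g ` (ax \<union> range u) \<subseteq> ax \<union> range u"
    proof (rule image_subsetI)
      fix y assume "y \<in> ax \<union> range u"
      then consider p where "y = a p" | k c where "y = b k c" | k where "y = u k"
        by (auto simp: ax_def)
      then show "act g y \<in> ax \<union> range u"
        by cases (simp_all add: A)
    qed
    have "a p \<in> act g ` (ax \<union> range u)" for p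
    proof -
      obtain q where "p = g q"
        using Kset_bij[OF lmK[OF lm]] by (metis bij_pointE)
      then have "a p = act g (a q)"
        by (simp add: A)
      then show ?thesis by auto
    qed
    moreover have "b k c \<in> act g ` (ax \<union> range u)" for k c
    proof -
      obtain j d where "k = s j" "c = t j d"
        using surj by blast
      then have "b k c = act g (b j d)"
        by (simp add: A)
      then show ?thesis by auto
    qed
    moreover have "u k \<in> act g ` (ax \<union> range u)" for k
    proof -
      obtain j where "k = s j"
        using surj by blast
      then have "u k = act g (u j)"
        by (simp add: A)
      then show ?thesis by auto
    qed
    ultimately have "y \<in> act g ` (ax \<union> range u)" if "(\<exists>p. y = a p) \<or> (\<exists>k c. y = b k c) \<or> (\<exists>k. y = u k)" for y
      using that by metis
    moreover have "(\<exists>p. y = a p) \<or> (\<exists>k c. y = b k c) \<or> (\<exists>k. y = u k)" if "y \<in> ax \<union> range u" for y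
      using that by (auto simp: ax_def)
    ultimately show "ax \<union> range u \<subseteq> act g ` (ax \<union> range u)"
      by (intro subsetI) metis
  qed
  have "act g ` SP = SP"
    using sp[of _ "ax \<union> range u"] sp2[of "ax \<union> range u"] unfolding im SP_eq
    by (intro antisym image_subsetI) simp_all
  moreover have "inj_on (act g) SP"
    using inj by (rule inj_on_subset) simp
  ultimately show ?thesis
    unfolding saut_def by (simp add: bij_betw_def A)
qed

definition realized :: "('v \<Rightarrow> 'v) \<Rightarrow> bool" where
  "realized h \<longleftrightarrow> (\<exists>g\<in>Kset. \<forall>y\<in>SP. h y = act g y)"

text \<open>Allows an automorphism to be normalised step by step by composing it with group
  elements.\<close>

lemma realized_act:
  assumes "g \<in> Kset" "realized (act g \<circ> h)"
  shows "realized h"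
proof -
  obtain g1 where g1: "g1 \<in> Kset" "\<forall>y\<in>SP. act g (h y) = act g1 y"
    using assms(2) by (auto simp: realized_def)
  obtain g' where g': "g' \<in> Kset" "g' \<circ> g = id"
    using Kset_inverse[OF assms(1)] by blast
  have "h y = act (g' \<circ> g1) y" if "y \<in> SP" for y
  proof -
    have "act g' (act g (h y)) = h y"
      using act_comp[OF g'(1) assms(1), of "h y"] by (simp add: g' act_id)
    with g1(2) that show ?thesis
      using act_comp[OF g'(1) g1(1), of y] by simp
  qed
  then show ?thesis
    unfolding realized_def using Kset_comp[OF g'(1) g1(1)] by blast
qed

text \<open>The \<open>f k\<close> are fixed as well. Orthogonality leaves \<open>h (dl k)\<close> a
  multiple \<open>r k\<close> of \<open>dl k\<close>, and \<open>w_dl\<close> passes the same factor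
  on to \<open>x k c\<close>. Isometry gives \<open>r k * r k = 1\<close>, so the square of
  \<open>x k N0\<close> is fixed, and its terms linear in \<open>dl k\<close> and
  \<open>x k N0\<close> exclude the value -1.\<close>

lemma saut_fix_uw:
  assumes h: "saut h" and u: "\<And>k. h (u k) = u k" and w: "\<And>k c. h (w k c) = w k c"
  shows "realized h"
proof -
  have f: "h (f k) = f k" for k
    using h_u_f[OF h, of k] u by (auto simp: u_inj)
  have orth: "form (h y) z = 0" if "t \<diamondop> y = l *\<^sub>Q y" "t \<diamondop> z = m *\<^sub>Q z" "h t = t" "l \<noteq> m" "t \<in> SP" "y \<in> SP" for t y l z m
    using h_orth[OF h that(1) _ that(4-6)] that(2,3) by simp
  have es: "h es = es"
    by (simp add: es_split h_add[OF h] SP_closed u)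
  have "\<exists>r. h (dl k) = r *\<^sub>Q dl k" for k
  proof -
    have 1: "form (h (dl k)) (u j) = 0" for j
    proof -
      consider "j = k" | "j = perp k" | "j \<noteq> k" "j \<noteq> perp k" by blast
      then show ?thesis
      proof cases
        case 1
        then show ?thesis
          by (intro orth[of "u k" _ 0 _ 1]) (auto simp: u u_dl mul_uu)
      next
        case 2
        then show ?thesis
          by (intro orth[of "u (perp k)" _ 0 _ 1]) (auto simp: u u_dl_perp mul_uu)
      next
        case 3
        then show ?thesis
          by (intro orth[of "u j" _ "1/5" _ 1]) (auto simp: u u_dl_skew mul_uu)
      qed
    qed
    have 2: "form (h (dl k)) (w j c) = 0" for j c
      by (rule orth[OF f_dl, of k "w j c" 0]) (auto simp: f f_w)
    have 3: "form (h (dl k)) (f j) = 0" for j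
    proof (cases "j = k \<or> j = perp k")
      case True
      then show ?thesis
        by (intro orth[OF f_dl, of k "f j" 1]) (auto simp: f f_f)
    next
      case False
      then show ?thesis
        by (intro orth[OF f_dl, of k "f j" 0]) (auto simp: f f_f_skew)
    qed
    have 4: "form (h (dl k)) (dl j) = 0" if "j \<noteq> k" "j \<noteq> perp k" for j
      using that by (intro orth[OF f_dl, of k "dl j" 0]) (auto simp: f f_dl_skew)
    have 5: "form (h (dl k)) (x j c) = 0" for j c
    proof -
      consider "j = k" | "j = perp k" | "j \<noteq> k" "j \<noteq> perp k" by blast
      then show ?thesis
      proof cases
        case 1
        then show ?thesis
          by (intro orth[of "u k" _ 0 _ "1/3"]) (auto simp: u u_dl u_x)
      next
        case 2
        then show ?thesis
          by (intro orth[of "u (perp k)" _ 0 _ "1/3"]) (auto simp: u u_dl_perp u_x)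
      next
        case 3
        then show ?thesis
          by (intro orth[OF f_dl, of k "x j c" 0]) (auto simp: f f_x_skew)
      qed
    qed
    have "h (dl k) = (\<Sum>i\<in>{Id k, Id (perp k)}. (rw i * form (h (dl k)) (nv i)) *\<^sub>Q nv i)"
    proof (rule frame_select)
      fix i assume "i \<notin> {Id k, Id (perp k)}"
      then show "form (h (dl k)) (nv i) = 0"
        by (cases i) (auto simp: 1 2 3 4 5)
    qed (simp add: h_SP[OF h])
    \<comment> \<open>The two frame vectors are \<open>dl k\<close> and its negative; their
      contributions agree, whence the factor 2.\<close>
    then have "h (dl k) = (2 * (16/117 * form (h (dl k)) (dl k))) *\<^sub>Q dl k"
      by (simp add: form_minus_right flip: scale_left_distrib)
    then show ?thesis by blast
  qed
  then obtain r where r: "h (dl k) = r k *\<^sub>Q dl k" for k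
    by metis
  have x: "h (x k c) = r k *\<^sub>Q x k c" for k c
  proof -
    have "x k c = (16/9) *\<^sub>Q (w k c \<diamondop> dl k)"
      by (simp add: w_dl)
    then have "h (x k c) = (16/9) *\<^sub>Q (w k c \<diamondop> (r k *\<^sub>Q dl k))"
      by (simp add: h_scale[OF h] h_mul[OF h] w r)
    then show ?thesis
      by (simp add: mul_scale_right w_dl)
  qed
  have r2: "r k * r k = 1" for k
  proof -
    have "form (h (dl k)) (h (dl k)) = form (dl k) (dl k)"
      by (rule h_iso[OF h]) auto
    then show ?thesis
      by (simp add: r form_scale_left form_scale_right form_dl_dl)
  qed
  have r1: "r k = 1" for k
  proof -
    define E where "E = (65/512) *\<^sub>Q u k + (13/1024) *\<^sub>Q (es - u k - u (perp k)) + (13/432) *\<^sub>Q w k N0 + (99/512) *\<^sub>Q f k"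
    have ES: "E \<in> SP" "h E = E"
      unfolding E_def by (simp_all add: h_rules[OF h] u w f es)
    have xx: "x k N0 \<diamondop> x k N0 = E + (7/96) *\<^sub>Q dl k + (7/24) *\<^sub>Q x k N0"
      by (simp add: x_x E_def)
    have "h (x k N0 \<diamondop> x k N0) = (r k * r k) *\<^sub>Q (x k N0 \<diamondop> x k N0)"
      by (simp add: h_mul[OF h] x mul_lin)
    then have "h (E + (7/96) *\<^sub>Q dl k + (7/24) *\<^sub>Q x k N0) = E + (7/96) *\<^sub>Q dl k + (7/24) *\<^sub>Q x k N0"
      unfolding r2 xx by simp
    then have "(7/96) *\<^sub>Q (r k *\<^sub>Q dl k) + (7/24) *\<^sub>Q (r k *\<^sub>Q x k N0) = (7/96) *\<^sub>Q dl k + (7/24) *\<^sub>Q x k N0"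
      using ES by (simp add: h_rules[OF h] r x)
    from arg_cong[OF this, of "form (dl k)"] show ?thesis
      by (simp add: form_add_right form_scale_right form_dl_dl form_dl_x)
  qed
  have nv: "h (nv i) = nv i" for i
    by (cases i) (simp_all add: u w f r x r1)
  have "y \<in> SP \<and> h y = y" if "y \<in> SP" for y
    using that unfolding SP_def
  proof (induction rule: span_induct_alt)
    case base
    then show ?case by (simp add: h_zero[OF h] span_zero)
  next
    case (step c y z)
    then have "y \<in> SP" "z \<in> SP" "h y = y" "h z = z"
      using nv by (auto simp flip: SP_def)
    then show ?case
      unfolding SP_def[symmetric] by (simp add: h_rules[OF h])
  qed
  then show ?thesis
    unfolding realized_def by (intro bexI[OF _ id_Kset]) (simp add: act_id)
qed

end

text \<open>Comparing the arguments (i, 0) and (0, i) shows that the three maps differ by constants;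
  the sum 1 + 1 = 2 then makes them affine with a common slope, nonzero because \<open>p1\<close> is
  not constant.\<close>

lemma f3_affine:
  fixes p1 p2 p3 :: "f3 \<Rightarrow> f3"
  assumes "\<And>i j. p3 (i + j) = p1 i + p2 j" "p1 N0 \<noteq> p1 N1"
  obtains t where "t \<noteq> N0" "\<And>i. p1 i = t * i + p1 N0" "\<And>i. p2 i = t * i + p2 N0"
    "\<And>i. p3 i = t * i + (p1 N0 + p2 N0)"
proof -
  define t where "t = p1 N1 - p1 N0"
  have t: "t \<noteq> N0"
    using assms(2) by (cases "p1 N0"; cases "p1 N1"; simp add: t_def)
  have 3: "p3 i = p1 i + p2 N0" "p3 i = p1 N0 + p2 i" for i
    using assms(1)[of i N0] assms(1)[of N0 i] by simp_all
  have 2: "p2 i = p1 i + p2 N0 - p1 N0" for i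
    using 3[of i] by (metis add_diff_cancel_left')
  have "p1 N2 + p2 N0 = p1 N1 + p2 N1"
    using 3(1)[of N2] assms(1)[of N1 N1] by simp
  then have "p1 N2 = p1 N1 + p1 N1 - p1 N0"
    unfolding 2[of N1] by (cases "p1 N0"; cases "p1 N1"; cases "p1 N2"; cases "p2 N0"; simp)
  then have 1: "p1 i = t * i + p1 N0" for i
    unfolding t_def by (cases i; cases "p1 N0"; cases "p1 N1"; simp)
  have "p2 i = t * i + p2 N0" "p3 i = t * i + (p1 N0 + p2 N0)" for i
    using 1[of i] 2[of i] 3[of i] by (simp_all add: algebra_simps)
  with t 1 that show thesis by blast
qed

section \<open>Automorphisms that fix the four 3A-axes\<close>

context m9_config
begin

text \<open>In coordinates the equation reads r (r - 2s - 1) = 0 and s (s - 2r - 1) = 0. Its four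
  solutions are zero and the three vectors \<open>w k c\<close>.\<close>

lemma w_idempotents:
  assumes y: "y = r *\<^sub>Q w k N0 + s *\<^sub>Q w k N1" and yy: "y \<diamondop> y = (405/1024) *\<^sub>Q (es - u (perp k)) + (3/8) *\<^sub>Q y"
    and "y \<noteq> 0"
  shows "\<exists>c. y = w k c"
proof -
  define E where "E = (405/1024) *\<^sub>Q (es - u (perp k))"
  \<comment> \<open>The mixed product is obtained by squaring \<open>w k N2\<close>, which is minus
    the sum of the other two.\<close>
  define m where "m = w k N0 \<diamondop> w k N1"
  have "w k N2 \<diamondop> w k N2 = w k N0 \<diamondop> w k N0 + m + (w k N1 \<diamondop> w k N1 + m)"
    unfolding w_N2 by (simp add: mul_lin mul_minus_left mul_minus_right m_def mul_commute[of "w k N1" "w k N0"])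
  then have mm: "m + m = - E - (3/4) *\<^sub>Q (w k N0 + w k N1)"
  proof -
    assume *: "w k N2 \<diamondop> w k N2 = w k N0 \<diamondop> w k N0 + m + (w k N1 \<diamondop> w k N1 + m)"
    define vs where "vs = [w k N0, w k N1, E]"
    have vs: "w k N0 = den vs (LG 0)" "w k N1 = den vs (LG 1)" "E = den vs (LG 2)"
      by (simp_all add: vs_def)
    have "m + m = w k N2 \<diamondop> w k N2 - w k N0 \<diamondop> w k N0 - w k N1 \<diamondop> w k N1"
      unfolding * by (simp add: algebra_simps)
    also have "\<dots> = - E - (3/4) *\<^sub>Q (w k N0 + w k N1)"
      unfolding w_w E_def[symmetric] unfolding w_N2 unfolding vs den_fold
      by (rule den_eqI) (simp add: vs_def)
    finally show ?thesis .
  qed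
  have "y \<diamondop> y = (r * r) *\<^sub>Q (w k N0 \<diamondop> w k N0) + (r * s) *\<^sub>Q (m + m) + (s * s) *\<^sub>Q (w k N1 \<diamondop> w k N1)"
    unfolding y by (simp add: mul_lin m_def mul_commute[of "w k N1" "w k N0"] scale_right_distrib mult.commute)
  then have "y \<diamondop> y = (r * r) *\<^sub>Q (E + (3/8) *\<^sub>Q w k N0) + (r * s) *\<^sub>Q (- E - (3/4) *\<^sub>Q (w k N0 + w k N1))
      + (s * s) *\<^sub>Q (E + (3/8) *\<^sub>Q w k N1)"
    unfolding mm w_w E_def[symmetric] .
  then have "(r * r) *\<^sub>Q (E + (3/8) *\<^sub>Q w k N0) + (r * s) *\<^sub>Q (- E - (3/4) *\<^sub>Q (w k N0 + w k N1))
      + (s * s) *\<^sub>Q (E + (3/8) *\<^sub>Q w k N1) = E + (3/8) *\<^sub>Q y"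
    unfolding E_def[symmetric] yy[folded E_def] by simp
  note eq = this[unfolded y]
  \<comment> \<open>Pairing with \<open>w k N0\<close> and \<open>w k N1\<close> therefore removes
    the constant term and leaves two scalar equations.\<close>
  have Ew: "form E (w k c) = 0" for c
    unfolding E_def es_split by (simp add: form_lin form_u_w)
  have "729 * (r * r) / 128 - 729 * (r * s) / 128 - 729 * (s * s) / 256 = 729 * r / 128 - 729 * s / 256"
    using arg_cong[OF eq, of "\<lambda>z. form z (w k N0)"] by (simp add: form_lin form_minus_left Ew form_w)
  moreover have "- (729 * (r * r) / 256) - 729 * (r * s) / 128 + 729 * (s * s) / 128 = 729 * s / 128 - 729 * r / 256"
    using arg_cong[OF eq, of "\<lambda>z. form z (w k N1)"] by (simp add: form_lin form_minus_left Ew form_w)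
  ultimately have 1: "r * r - 2 * (r * s) = r" "s * s - 2 * (r * s) = s"
    by linarith+
  have "r * (r - 2 * s - 1) = 0" "s * (s - 2 * r - 1) = 0"
    using 1 by (simp_all add: algebra_simps)
  then have "r = 0 \<or> r - 2 * s - 1 = 0" "s = 0 \<or> s - 2 * r - 1 = 0"
    unfolding mult_eq_0_iff .
  then consider "r = 0" "s = 0" | "r = 0" "s = 1" | "r = 1" "s = 0" | "r = -1" "s = -1"
  proof (elim disjE)
    assume "r - 2 * s - 1 = 0" "s - 2 * r - 1 = 0"
    then have "r = -1" "s = -1"
      by linarith+
    then show ?thesis by (rule that(4))
  qed (auto intro: that)
  then show ?thesis
  proof cases
    case 1
    then show ?thesis using assms(3) y by simp
  next
    case 2
    then show ?thesis using y by (intro exI[of _ N1]) simp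
  next
    case 3
    then show ?thesis using y by (intro exI[of _ N0]) simp
  next
    case 4
    then show ?thesis using y by (intro exI[of _ N2]) (simp add: w_N2)
  qed
qed

lemma saut_fix_u_w:
  assumes h: "saut h" and u: "\<And>k. h (u k) = u k"
  shows "\<exists>c'. h (w k c) = w k c'"
proof -
  have f: "h (f k) = f k" for k
    using h_u_f[OF h, of k] u by (auto simp: u_inj)
  have es: "h es = es"
    by (simp add: es_split h_add[OF h] SP_closed u)
  have orth: "form (h y) z = 0" if "t \<diamondop> y = l *\<^sub>Q y" "t \<diamondop> z = m *\<^sub>Q z" "h t = t" "l \<noteq> m" "t \<in> SP" "y \<in> SP" for t y l z m
    using h_orth[OF h that(1) _ that(4-6)] that(2,3) by simp
  have 1: "form (h (w k c)) (u j) = 0" for j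
  proof (cases "j = perp k")
    case True
    then show ?thesis
      by (intro orth[of "u j" _ 0 _ 1]) (auto simp: u u_w_perp mul_uu)
  next
    case False
    then show ?thesis
      by (intro orth[of "u j" _ "1/3" _ 1]) (auto simp: u u_w mul_uu)
  qed
  have 2: "form (h (w k c)) (w j d) = 0" if "j \<noteq> k" for j d
  proof -
    have "perp k \<noteq> perp j"
      using that by (metis perp_perp)
    then show ?thesis
      by (intro orth[of "u (perp k)" _ 0 _ "1/3"]) (auto simp: u u_w u_w_perp)
  qed
  have 3: "form (h (w k c)) (f j) = 0" for j
    by (rule orth[of "f j" _ 0 _ 1]) (auto simp: f f_w f_f)
  have 4: "form (h (w k c)) (dl j) = 0" for j
    by (rule orth[of "f j" _ 0 _ "3/5"]) (auto simp: f f_w f_dl)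
  have 5: "form (h (w k c)) (x j d) = 0" for j d
    by (rule orth[of "f j" _ 0 _ "3/5"]) (auto simp: f f_w f_x)
  define q where "q d = 256/729 * form (h (w k c)) (w k d)" for d
  have "h (w k c) = (\<Sum>i\<in>Iw k ` UNIV. (rw i * form (h (w k c)) (nv i)) *\<^sub>Q nv i)"
  proof (rule frame_select)
    fix i assume "i \<notin> Iw k ` UNIV"
    then show "form (h (w k c)) (nv i) = 0"
      by (cases i) (auto simp: 1 3 4 5 intro: 2)
  qed (simp add: h_SP[OF h])
  also have "\<dots> = q N0 *\<^sub>Q w k N0 + q N1 *\<^sub>Q w k N1 + q N2 *\<^sub>Q w k N2"
    by (subst sum.reindex) (auto simp: inj_def sum_f3 q_def)
  also have "\<dots> = (q N0 - q N2) *\<^sub>Q w k N0 + (q N1 - q N2) *\<^sub>Q w k N1"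
    unfolding w_N2 by (simp add: scale_right_diff_distrib scale_left_diff_distrib)
  finally have y: "h (w k c) = (q N0 - q N2) *\<^sub>Q w k N0 + (q N1 - q N2) *\<^sub>Q w k N1" .
  have "h (w k c) \<diamondop> h (w k c) = h ((405/1024) *\<^sub>Q (es - u (perp k)) + (3/8) *\<^sub>Q w k c)"
    by (simp add: w_w flip: h_mul[OF h])
  also have "\<dots> = (405/1024) *\<^sub>Q (es - u (perp k)) + (3/8) *\<^sub>Q h (w k c)"
    by (simp add: h_rules[OF h] u es)
  finally have yy: "h (w k c) \<diamondop> h (w k c) = (405/1024) *\<^sub>Q (es - u (perp k)) + (3/8) *\<^sub>Q h (w k c)" .
  have "form (h (w k c)) (h (w k c)) \<noteq> 0"
    by (simp add: h_iso[OF h] form_w)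
  then have "h (w k c) \<noteq> 0"
    by auto
  from w_idempotents[OF y yy this] show ?thesis .
qed

text \<open>The lines of each class are permuted by some \<open>p k\<close>. The product rule for
  \<open>w D1 i\<close> and \<open>w D2 j\<close> shows that these permutations respect incidence,
  so they come from one homothety with translation, which is then undone.\<close>

lemma saut_fix_u:
  assumes h: "saut h" and u: "\<And>k. h (u k) = u k"
  shows "realized h"
proof -
  obtain p where p: "h (w k c) = w k (p k c)" for k c
    using saut_fix_u_w[OF assms] by metis
  have inj: "p k c = p k d \<Longrightarrow> c = d" for k c d
    using p h_inj[OF h, of "w k c" "w k d"] w_inj by auto
  have eq: "p D3 (i + j) = p D1 i + p D2 j \<and> p D4 (i - j) = p D1 i - p D2 j" for i j
  proof -
    have "(9/32) *\<^sub>Q (w D3 (p D3 (i + j)) + w D4 (p D4 (i - j))) = h (w D1 i \<diamondop> w D2 j)"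
      unfolding w_w_D1_D2 by (simp add: h_rules[OF h] p del: f3_diff)
    also have "\<dots> = (9/32) *\<^sub>Q (w D3 (p D1 i + p D2 j) + w D4 (p D1 i - p D2 j))"
      unfolding h_mul[OF h SP_w SP_w] p by (rule w_w_D1_D2)
    finally have e: "w D3 (p D3 (i + j)) + w D4 (p D4 (i - j)) = w D3 (p D1 i + p D2 j) + w D4 (p D1 i - p D2 j)"
      by simp
    show ?thesis
      using arg_cong[OF e, of "\<lambda>z. form z (w D3 (p D1 i + p D2 j))"]
        arg_cong[OF e, of "\<lambda>z. form z (w D4 (p D1 i - p D2 j))"]
      by (simp add: form_add_left form_w split: if_splits)
  qed
  obtain t where t: "t \<noteq> N0" "\<And>i. p D1 i = t * i + p D1 N0" "\<And>i. p D2 i = t * i + p D2 N0"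
    "\<And>i. p D3 i = t * i + (p D1 N0 + p D2 N0)"
  proof (rule f3_affine[of "p D3" "p D1" "p D2"])
    show "p D3 (i + j) = p D1 i + p D2 j" for i j
      using eq by blast
    show "p D1 N0 \<noteq> p D1 N1"
      using inj[of D1 N0 N1] by auto
  qed blast
  have t4: "p D4 i = t * i + (p D1 N0 - p D2 N0)" for i
  proof -
    have "p D4 i = p D1 i - p D2 N0"
      using eq[of i N0] by simp
    also have "\<dots> = t * i + p D1 N0 - p D2 N0"
      using t(2)[of i] by simp
    finally show ?thesis
      by (simp only: add_diff_eq)
  qed
  define v where "v = (p D1 N0, p D2 N0)"
  have pv: "p k i = t * i + lam k v" for k i
    using t(2)[of i] t(3)[of i] t(4)[of i] t4[of i] by (cases k) (simp_all only: v_def lam.simps)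
  \<comment> \<open>A nonzero \<open>t\<close> is its own inverse, so the inverse of i -> t i + lam
    k v is i -> t i - t (lam k v).\<close>
  define q where "q = (- t * p D1 N0, - t * p D2 N0)"
  note lm = line_map_homothety[OF t(1), of q]
  have "lam k q = - t * lam k v" for k
    by (cases k) (simp_all add: q_def v_def distrib_left right_diff_distrib del: f3_diff)
  moreover have "t * (t * i) = i" for i
    using t(1) by (cases t; cases i; simp)
  ultimately have inv: "t * p k i + lam k q = i" for k i
    by (simp add: pv[of k i] distrib_left)
  have "realized (act (kmap (t, N0) False q) \<circ> h)"
  proof (rule saut_fix_uw)
    show "saut (act (kmap (t, N0) False q) \<circ> h)"
      by (rule saut_comp[OF saut_act[OF lm] h])
  qed (simp_all add: u p act_all[OF lm] inv)
  then show ?thesis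
    using lmK[OF lm] realized_act by blast
qed

lemma saut_fix_u1:
  assumes h: "saut h" and "h (u D1) = u D1"
  shows "realized h"
proof -
  have u2: "h (u D2) = u D2"
    using h_u_perp[OF assms] by simp
  obtain j where j: "h (u D3) = u j"
    using h_u_f[OF h, of D3] by blast
  then have u4: "h (u D4) = u (perp j)"
    using h_u_perp[OF h j] by simp
  have "j \<noteq> D1" "j \<noteq> D2"
    using h_inj[OF h, of "u D3" "u D1"] h_inj[OF h, of "u D3" "u D2"] j assms(2) u2 u_inj by auto
  then consider "j = D3" | "j = D4"
    by (cases j) auto
  then show ?thesis
  proof cases
    case 1
    then have "h (u k) = u k" for k
      using assms(2) u2 u4 j by (cases k) auto
    then show ?thesis
      by (rule saut_fix_u[OF h])
  next
    \<comment> \<open>The reflection \<open>rho D1 N0\<close> preserves \<open>D1\<close> and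
      \<open>D2\<close> and exchanges \<open>D3\<close> with \<open>D4\<close>.\<close>
    case 2
    note lm = line_map_rho
    have "realized (act (rho D1 N0) \<circ> h)"
    proof (rule saut_fix_u)
      show "saut (act (rho D1 N0) \<circ> h)"
        by (rule saut_comp[OF saut_act[OF lm] h])
      show "(act (rho D1 N0) \<circ> h) (u k) = u k" for k
        using assms(2) u2 u4 j 2 by (cases k) (auto simp: act_all[OF lm])
    qed
    then show ?thesis
      using lmK[OF lm] realized_act by blast
  qed
qed

theorem saut_realized:
  assumes h: "saut h"
  shows "realized h"
proof -
  obtain j where j: "h (u D1) = u j"
    using h_u_f[OF h, of D1] by blast
  \<comment> \<open>\<open>dsh D3\<close> cycles D1, D3, D2, D4, and \<open>dsh D4\<close> is its
    inverse; \<open>k\<close> selects the rotation that takes class \<open>j\<close> back to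
    \<open>D1\<close>.\<close>
  define k where "k = (case j of D1 \<Rightarrow> D1 | D2 \<Rightarrow> D2 | D3 \<Rightarrow> D4 | D4 \<Rightarrow> D3)"
  have k: "dsh k j = D1"
    by (cases j) (simp_all add: k_def)
  obtain g t where lm: "line_map g (dsh k) t"
    by (metis line_map_all)
  have "realized (act g \<circ> h)"
  proof (rule saut_fix_u1)
    show "saut (act g \<circ> h)"
      by (rule saut_comp[OF saut_act[OF lm] h])
    show "(act g \<circ> h) (u D1) = u D1"
      by (simp add: j act_all[OF lm] k)
  qed
  then show ?thesis
    using lmK[OF lm] realized_act by blast
qed

end

section \<open>The group $U_3(2){:}2$ as a group of affine maps\<close>

type_synonym t3 = "gf4 \<times> gf4 \<times> gf4"

definition gf_elems :: "gf4 list" where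
  "gf_elems = [GF4 0 0, GF4 1 0, GF4 0 1, GF4 1 1]"

definition cq :: "gf4 \<Rightarrow> gf4" where
  "cq y = y * y"

fun dot3 :: "t3 \<Rightarrow> t3 \<Rightarrow> gf4" where
  "dot3 (p, q, r) (x, y, z) = p * x + q * y + r * z"

fun cq3 :: "t3 \<Rightarrow> t3" where
  "cq3 (p, q, r) = (cq p, cq q, cq r)"

fun sc3 :: "gf4 \<Rightarrow> t3 \<Rightarrow> t3" where
  "sc3 c (p, q, r) = (c * p, c * q, c * r)"

text \<open>The conjugate of the cross product, with signs dropped in characteristic two. It
  completes two orthonormal rows to a unitary matrix of determinant 1.\<close>

fun cross3c :: "t3 \<Rightarrow> t3 \<Rightarrow> t3" where
  "cross3c (p, q, r) (x, y, z) = (cq (q * z + r * y), cq (r * x + p * z), cq (p * y + q * x))"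

definition mv3 :: "t3 \<Rightarrow> t3 \<Rightarrow> t3 \<Rightarrow> t3 \<Rightarrow> t3" where
  "mv3 r s t v = (dot3 r v, dot3 s v, dot3 t v)"

text \<open>Representatives of the nine isotropic points of the Hermitian form, labelled by the points
  of the affine plane over $\mathbb{F}_3$.\<close>

fun rep3 :: "pt \<Rightarrow> t3" where
  "rep3 (N0, N0) = (GF4 0 0, GF4 1 0, GF4 1 0)"
| "rep3 (N0, N1) = (GF4 1 0, GF4 1 0, GF4 0 0)"
| "rep3 (N0, N2) = (GF4 1 0, GF4 0 0, GF4 1 0)"
| "rep3 (N1, N0) = (GF4 0 0, GF4 1 0, GF4 0 1)"
| "rep3 (N1, N1) = (GF4 1 0, GF4 0 1, GF4 0 0)"
| "rep3 (N1, N2) = (GF4 1 0, GF4 0 0, GF4 1 1)"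
| "rep3 (N2, N0) = (GF4 0 0, GF4 1 0, GF4 1 1)"
| "rep3 (N2, N1) = (GF4 1 0, GF4 1 1, GF4 0 0)"
| "rep3 (N2, N2) = (GF4 1 0, GF4 0 0, GF4 0 1)"

definition pts :: "pt list" where
  "pts = [(N0, N0), (N0, N1), (N0, N2), (N1, N0), (N1, N1), (N1, N2), (N2, N0), (N2, N1), (N2, N2)]"

definition prop3 :: "t3 \<Rightarrow> t3 \<Rightarrow> bool" where
  "prop3 v v' \<longleftrightarrow> v = v' \<or> v = sc3 (GF4 0 1) v' \<or> v = sc3 (GF4 1 1) v'"

text \<open>Logarithm to the base omega of a cube root of unity, with values in the field with three
  elements; 0 shares the default value with 1.\<close>

definition lab :: "gf4 \<Rightarrow> f3" where
  "lab y = (if y = GF4 0 1 then N1 else if y = GF4 1 1 then N2 else N0)"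

text \<open>Every nonzero entry has norm 1, so in characteristic two a nonzero isotropic vector has
  exactly two nonzero entries. The position of the zero gives one coordinate and the ratio of the
  other entries the other; ratios use that the inverse is the square.\<close>

fun pidx :: "t3 \<Rightarrow> pt" where
  "pidx (x, y, z) = (if x = GF4 0 0 then (lab (z * cq y), N0)
     else if y = GF4 0 0 then (- lab (z * cq x), N2) else (lab (y * cq x), N1))"

definition vecs3 :: "t3 list" where
  "vecs3 = [(p, q, r). p <- gf_elems, q <- gf_elems, r <- gf_elems]"

definition unit3 :: "t3 list" where
  "unit3 = filter (\<lambda>v. dot3 v (cq3 v) = GF4 1 0) vecs3"

text \<open>Enumerates the special unitary group by its first two rows, since they determine the
  third.\<close>

definition su_rows :: "(t3 \<times> t3) list" where
  "su_rows = [(r, s). r <- unit3, s <- unit3, dot3 r (cq3 s) = GF4 0 0]"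

text \<open>Auxiliary arguments instead of \<open>let\<close>, which evaluation by rewriting would unfold.\<close>

fun affine_check :: "pt list \<Rightarrow> pt \<Rightarrow> pt \<Rightarrow> bool" where
  "affine_check im d c \<longleftrightarrow>
     c \<noteq> (N0, N0) \<and> (im = map (kmap c False d) pts \<or> im = map (kmap c True d) pts)"

text \<open>The affine map is recovered from the images of 0 and 1, which stand at positions 0 and 3
  of \<open>pts\<close>. The second condition later keeps properly semilinear maps out of the
  kernel, and the third makes a matrix in the kernel scalar.\<close>

fun image_check :: "pt list \<Rightarrow> t3 \<Rightarrow> t3 \<Rightarrow> t3 \<Rightarrow> bool" where
  "image_check im r s t \<longleftrightarrow> affine_check im (im ! 0) (im ! 3 - im ! 0) \<and> im \<noteq> map (rho D1 N0) pts \<and>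
     (im = pts \<longrightarrow> r = (fst r, GF4 0 0, GF4 0 0) \<and> s = (GF4 0 0, fst r, GF4 0 0) \<and> t = (GF4 0 0, GF4 0 0, fst r))"

fun triple_check :: "t3 \<Rightarrow> t3 \<Rightarrow> t3 \<Rightarrow> bool" where
  "triple_check r s t \<longleftrightarrow> image_check (map (\<lambda>p. pidx (mv3 r s t (rep3 p))) pts) r s t"

fun row_check :: "t3 \<times> t3 \<Rightarrow> bool" where
  "row_check (r, s) \<longleftrightarrow> triple_check r s (cross3c r s)"

lemma gf_elems_all: "y \<in> set gf_elems"
proof (cases y)
  case (GF4 p q)
  then show ?thesis
    by (cases p; cases q) (simp_all add: gf_elems_def)
qed

lemma vecs3_all: "v \<in> set vecs3"
  by (cases v) (auto simp: vecs3_def image_iff gf_elems_all)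

lemma pidx_sc_list: "list_all (\<lambda>c. c = GF4 0 0 \<or> list_all (\<lambda>v. pidx (sc3 c v) = pidx v) vecs3) gf_elems"
  by code_simp

lemma pidx_rep_list: "list_all (\<lambda>p. pidx (rep3 p) = p) pts"
  by code_simp

lemma pidx_iso_list: "list_all (\<lambda>v. dot3 v (cq3 v) = GF4 0 0 \<longrightarrow> v = (GF4 0 0, GF4 0 0, GF4 0 0) \<or> prop3 v (rep3 (pidx v))) vecs3"
  by code_simp

text \<open>Exhaustive verification over all matrices of the special unitary group.\<close>

lemma rows_list: "list_all row_check su_rows"
  by code_simp

section \<open>The semilinear unitary group\<close>

lemma cq_add: "cq (x + y) = cq x + cq y"
proof (cases x; cases y)
  fix p q r t
  assume "x = GF4 p q" "y = GF4 r t"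
  then show ?thesis
    by (cases p; cases q; cases r; cases t; simp add: cq_def)
qed

lemma cq_mult: "cq (x * y) = cq x * cq y"
  by (simp add: cq_def mult_ac)

lemma cq_cq: "cq (cq y) = y"
proof (cases y)
  case (GF4 p q)
  then show ?thesis by (cases p; cases q) (simp_all add: cq_def)
qed

lemma cq_01 [simp]: "cq 0 = 0" "cq 1 = 1"
  by (simp_all add: cq_def)

lemma cq_eq_0 [simp]: "cq y = 0 \<longleftrightarrow> y = 0"
  by (simp add: cq_def)

lemma cq_eq_1 [simp]: "cq y = 1 \<longleftrightarrow> y = 1"
  by (metis cq_cq cq_01(2))

definition cm :: "gf4 ^ 3 ^ 3 \<Rightarrow> gf4 ^ 3 ^ 3" where
  "cm A = (\<chi> i j. cq (A $ i $ j))"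

definition cv :: "gf4 ^ 3 \<Rightarrow> gf4 ^ 3" where
  "cv v = (\<chi> i. cq (v $ i))"

lemma cm_cm [simp]: "cm (cm A) = A" and cv_cv [simp]: "cv (cv v) = v"
  by (simp_all add: cm_def cv_def cq_cq)

lemma cm_transpose: "cm (transpose A) = transpose (cm A)"
  by (simp add: cm_def transpose_def)

lemma cm_mult: "cm (A ** B) = cm A ** cm B"
  by (simp add: cm_def matrix_matrix_mult_def sum_3 cq_add cq_mult)

lemma cv_mult: "cv (A *v v) = cm A *v cv v"
  by (simp add: cm_def cv_def matrix_vector_mult_def sum_3 cq_add cq_mult)

lemma cm_one [simp]: "cm (mat 1) = mat 1"
  by (simp add: cm_def mat_def vec_eq_iff)

lemma cq_diff: "cq (x - y) = cq x - cq y"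
  by (simp add: minus_gf4_def cq_add)

lemma det_cm: "det (cm A) = cq (det A)"
  by (simp add: det_3 cm_def cq_add cq_diff cq_mult)

lemma SU_iff: "A \<in> SU3_2 \<longleftrightarrow> A ** transpose (cm A) = mat 1 \<and> det A = 1"
  by (simp add: SU3_2_def cm_def cq_def power2_eq_square)

lemma SU_mult:
  assumes "A \<in> SU3_2" "B \<in> SU3_2"
  shows "A ** B \<in> SU3_2"
proof -
  have "A ** B ** transpose (cm (A ** B)) = A ** (B ** transpose (cm B)) ** transpose (cm A)"
    by (simp add: cm_mult matrix_transpose_mul matrix_mul_assoc)
  with assms show ?thesis
    by (simp add: SU_iff det_mul)
qed

lemma SU_cm: "A \<in> SU3_2 \<Longrightarrow> cm A \<in> SU3_2"
  using cm_mult[of A "transpose (cm A)"] by (auto simp: SU_iff det_cm cm_transpose)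

lemma SU_adjoint: "A \<in> SU3_2 \<Longrightarrow> transpose (cm A) ** A = mat 1"
  by (simp add: SU_iff matrix_left_right_inverse)

lemma SU_inverse: "A \<in> SU3_2 \<Longrightarrow> transpose (cm A) \<in> SU3_2"
  using SU_adjoint[of A] by (auto simp: SU_iff cm_transpose det_cm transpose_transpose det_transpose)

lemma SU_transpose: "A \<in> SU3_2 \<Longrightarrow> transpose A \<in> SU3_2"
  using SU_inverse[OF SU_cm, of A] by simp

lemma SU_one: "mat 1 \<in> SU3_2"
  by (simp add: SU_iff transpose_mat)

definition LA :: "gf4 ^ 3 ^ 3 \<Rightarrow> gf4 ^ 3 \<Rightarrow> gf4 ^ 3" where
  "LA A = (\<lambda>v. A *v v)"

definition SA :: "gf4 ^ 3 ^ 3 \<Rightarrow> gf4 ^ 3 \<Rightarrow> gf4 ^ 3" where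
  "SA A = (\<lambda>v. A *v cv v)"

lemma Sigma_carrier: "carrier SigmaU3_2 = LA ` SU3_2 \<union> SA ` SU3_2"
  by (auto simp: SigmaU3_2_def LA_def SA_def cv_def cq_def power2_eq_square)

lemma Sigma_mult [simp]: "mult SigmaU3_2 = (\<circ>)" and Sigma_one [simp]: "one SigmaU3_2 = id"
  by (simp_all add: SigmaU3_2_def)

lemma LS_comp: "LA A \<circ> LA B = LA (A ** B)" "LA A \<circ> SA B = SA (A ** B)"
  "SA A \<circ> LA B = SA (A ** cm B)" "SA A \<circ> SA B = LA (A ** cm B)"
  by (simp_all add: fun_eq_iff LA_def SA_def cv_mult matrix_vector_mul_assoc)

lemma LA_one: "LA (mat 1) = id"
  by (simp add: LA_def fun_eq_iff)

lemma group_Sigma: "group SigmaU3_2"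
proof (rule groupI)
  fix g assume "g \<in> carrier SigmaU3_2"
  then consider A where "A \<in> SU3_2" "g = LA A" | A where "A \<in> SU3_2" "g = SA A"
    by (auto simp: Sigma_carrier)
  then show "\<exists>g'\<in>carrier SigmaU3_2. g' \<otimes>\<^bsub>SigmaU3_2\<^esub> g = \<one>\<^bsub>SigmaU3_2\<^esub>"
  proof cases
    case 1
    then show ?thesis
      by (intro bexI[of _ "LA (transpose (cm A))"])
        (auto simp: LS_comp SU_adjoint LA_one Sigma_carrier SU_inverse)
  next
    case 2
    then show ?thesis
      using SU_adjoint[OF SU_cm, of A]
      by (intro bexI[of _ "SA (transpose A)"])
        (auto simp: LS_comp LA_one Sigma_carrier SU_transpose)
  qed
next
  fix g g' assume "g \<in> carrier SigmaU3_2" "g' \<in> carrier SigmaU3_2"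
  then show "g \<otimes>\<^bsub>SigmaU3_2\<^esub> g' \<in> carrier SigmaU3_2"
    by (auto simp: Sigma_carrier LS_comp SU_mult SU_cm)
next
  show "\<one>\<^bsub>SigmaU3_2\<^esub> \<in> carrier SigmaU3_2"
    using SU_one by (auto simp: Sigma_carrier simp flip: LA_one)
qed (simp_all add: comp_assoc)

definition tri :: "gf4 ^ 3 \<Rightarrow> t3" where
  "tri v = (v $ 1, v $ 2, v $ 3)"

lemma tri_inj: "tri v = tri v' \<longleftrightarrow> v = v'"
  by (auto simp: tri_def vec_eq_iff forall_3)

lemma tri_surj: "\<exists>v. tri v = t"
  by (rule exI[of _ "vector [fst t, fst (snd t), snd (snd t)]"]) (simp add: tri_def)

definition rep :: "pt \<Rightarrow> gf4 ^ 3" where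
  "rep p = (SOME v. tri v = rep3 p)"

lemma tri_rep [simp]: "tri (rep p) = rep3 p"
  unfolding rep_def using tri_surj by (rule someI_ex)

lemma tri_scale: "tri (c *s v) = sc3 c (tri v)"
  by (simp add: tri_def)

lemma tri_LA: "tri (LA A v) = mv3 (tri (A $ 1)) (tri (A $ 2)) (tri (A $ 3)) (tri v)"
  by (simp add: LA_def tri_def mv3_def matrix_vector_mult_def sum_3)

lemma gf4_zero: "(0 :: gf4) = GF4 0 0" and gf4_one: "(1 :: gf4) = GF4 1 0"
  by (simp_all add: zero_gf4_def one_gf4_def)

lemma pidx_sc:
  assumes "c \<noteq> 0"
  shows "pidx (sc3 c v) = pidx v"
proof -
  have "c = GF4 0 0 \<or> (\<forall>v\<in>set vecs3. pidx (sc3 c v) = pidx v)"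
    using pidx_sc_list gf_elems_all[of c] by (simp only: list_all_iff)
  with assms vecs3_all[of v] show ?thesis
    unfolding gf4_zero by (elim disjE) (simp_all only: not_True_eq_False simp_thms)
qed

lemma set_pts: "set pts = UNIV"
proof -
  have "p \<in> set pts" for p
    by (cases p; cases "fst p"; cases "snd p"; simp add: pts_def)
  then show ?thesis by auto
qed

lemma pidx_rep: "pidx (rep3 p) = p"
  using pidx_rep_list by (simp only: list_all_iff set_pts ball_UNIV)

definition isotropic :: "gf4 ^ 3 \<Rightarrow> bool" where
  "isotropic v \<longleftrightarrow> v \<noteq> 0 \<and> dot3 (tri v) (cq3 (tri v)) = 0"

lemma isotropic_rep:
  assumes "isotropic v"
  shows "\<exists>c. c \<noteq> 0 \<and> v = c *s rep (pidx (tri v))"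
proof -
  have "tri v \<noteq> (GF4 0 0, GF4 0 0, GF4 0 0)"
    using assms by (auto simp: isotropic_def tri_def vec_eq_iff forall_3 gf4_zero)
  then have "prop3 (tri v) (rep3 (pidx (tri v)))"
    using assms pidx_iso_list[unfolded list_all_iff, rule_format, OF vecs3_all[of "tri v"]]
    by (simp add: isotropic_def gf4_zero del: pidx.simps)
  then obtain c where c: "c \<noteq> 0" "tri v = sc3 c (rep3 (pidx (tri v)))"
    unfolding prop3_def
  proof (elim disjE)
    assume "tri v = rep3 (pidx (tri v))"
    moreover have "sc3 1 t = t" for t
      by (cases t) simp
    ultimately show ?thesis
      by (intro that[of 1]) simp_all
  qed (use that in \<open>auto simp: gf4_zero\<close>)
  then have "tri v = tri (c *s rep (pidx (tri v)))"
    by (simp add: tri_scale)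
  with c(1) show ?thesis
    unfolding tri_inj by blast
qed

lemma isotropic_repI: "isotropic (rep p)"
proof -
  obtain x y where "p = (x, y)" by fastforce
  then have "dot3 (rep3 p) (cq3 (rep3 p)) = 0 \<and> rep3 p \<noteq> (0, 0, 0)"
    by (cases x; cases y; simp add: cq_def gf4_zero)
  moreover have "tri 0 = (0, 0, 0)"
    by (simp add: tri_def)
  ultimately show ?thesis
    unfolding isotropic_def by (metis tri_rep)
qed

lemma dot3_vec: "dot3 (tri v) (cq3 (tri v')) = (\<Sum>i\<in>UNIV. v $ i * cv v' $ i)"
  by (simp add: tri_def sum_3 cv_def)

lemma isotropic_LA:
  assumes "A \<in> SU3_2" "isotropic v"
  shows "isotropic (LA A v)"
proof -
  have inj: "transpose (cm A) *v (A *v v) = v" for v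
    using SU_adjoint[OF assms(1)] by (simp add: matrix_vector_mul_assoc)
  have "A *v v \<noteq> 0"
    using inj[of v] assms(2) by (auto simp: isotropic_def)
  moreover have "(\<Sum>i\<in>UNIV. (A *v v) $ i * cv (A *v v) $ i) = (\<Sum>i\<in>UNIV. v $ i * cv v $ i)"
  proof -
    have "(\<Sum>i\<in>UNIV. (A *v v) $ i * cv (A *v v) $ i) =
        (\<Sum>i\<in>UNIV. (\<Sum>j\<in>UNIV. A $ i $ j * v $ j) * cv (A *v v) $ i)"
      by (simp add: matrix_vector_mult_def)
    also have "\<dots> = (\<Sum>j\<in>UNIV. v $ j * (transpose A *v cv (A *v v)) $ j)"
      unfolding matrix_vector_mult_def transpose_def
      by (simp add: sum_3 algebra_simps)
    also have "transpose A *v cv (A *v v) = cv v"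
      using SU_adjoint[OF SU_cm[OF assms(1)]] by (simp add: cv_mult matrix_vector_mul_assoc)
    finally show ?thesis .
  qed
  ultimately show ?thesis
    using assms(2) by (simp add: isotropic_def LA_def dot3_vec)
qed

lemma isotropic_cv: "isotropic v \<Longrightarrow> isotropic (cv v)"
proof -
  assume v: "isotropic v"
  have "cv v \<noteq> 0"
    using v by (auto simp: isotropic_def cv_def vec_eq_iff)
  moreover have "dot3 (tri (cv v)) (cq3 (tri (cv v))) = cq (dot3 (tri v) (cq3 (tri v)))"
    by (simp add: tri_def cv_def cq_add cq_mult)
  ultimately show ?thesis
    using v by (simp add: isotropic_def)
qed

lemma SA_LA: "SA A v = LA A (cv v)"
  by (simp add: SA_def LA_def)

lemma Sigma_isotropic: "g \<in> carrier SigmaU3_2 \<Longrightarrow> isotropic v \<Longrightarrow> isotropic (g v)"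
  by (auto simp: Sigma_carrier SA_LA isotropic_LA isotropic_cv)

lemma Sigma_scale: "g \<in> carrier SigmaU3_2 \<Longrightarrow> c \<noteq> 0 \<Longrightarrow> \<exists>c'. c' \<noteq> 0 \<and> g (c *s v) = c' *s g v"
proof -
  assume g: "g \<in> carrier SigmaU3_2" and c: "c \<noteq> 0"
  have L: "LA A (c *s v) = c *s LA A v" for A c v
    by (simp add: LA_def vec_eq_iff matrix_vector_mult_def sum_distrib_left mult_ac)
  have "cv (c *s v) = cq c *s cv v"
    by (simp add: cv_def vec_eq_iff cq_mult)
  then have "SA A (c *s v) = cq c *s SA A v" for A
    by (simp add: SA_LA L)
  note S = this
  from g consider A where "g = LA A" | A where "g = SA A"
    by (auto simp: Sigma_carrier)
  then show ?thesis
  proof cases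
    case 1
    then show ?thesis using L c by blast
  next
    case 2
    then show ?thesis using S c by (intro exI[of _ "cq c"]) simp
  qed
qed

section \<open>Action on the nine isotropic points\<close>

definition Psi :: "(gf4 ^ 3 \<Rightarrow> gf4 ^ 3) \<Rightarrow> pt \<Rightarrow> pt" where
  "Psi g p = pidx (tri (g (rep p)))"

text \<open>Semilinear maps send proportional vectors to proportional vectors, so the choice of
  representatives does not matter.\<close>

lemma Psi_comp:
  assumes "g \<in> carrier SigmaU3_2" "g' \<in> carrier SigmaU3_2"
  shows "Psi (g \<circ> g') = Psi g \<circ> Psi g'"
proof
  fix p
  obtain c where c: "c \<noteq> 0" "g' (rep p) = c *s rep (Psi g' p)"
    using isotropic_rep[OF Sigma_isotropic[OF assms(2) isotropic_repI[of p]]] by (auto simp: Psi_def)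
  define q where "q = Psi g' p"
  obtain c' where c': "c' \<noteq> 0" "g (c *s rep q) = c' *s g (rep q)"
    using Sigma_scale[OF assms(1) c(1)] by blast
  have "Psi (g \<circ> g') p = pidx (tri (g (g' (rep p))))"
    by (simp add: Psi_def)
  also have "\<dots> = pidx (sc3 c' (tri (g (rep q))))"
    by (simp only: c(2) q_def[symmetric] c'(2) tri_scale)
  also have "\<dots> = Psi g q"
    by (simp only: pidx_sc[OF c'(1)] Psi_def)
  finally show "Psi (g \<circ> g') p = (Psi g \<circ> Psi g') p"
    by (simp add: q_def)
qed

lemma cross_eq:
  assumes "A \<in> SU3_2"
  shows "tri (A $ 3) = cross3c (tri (A $ 1)) (tri (A $ 2))" "(tri (A $ 1), tri (A $ 2)) \<in> set su_rows"
proof -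
  have e: "(\<Sum>k\<in>UNIV. A $ i $ k * cq (A $ j $ k)) = (if i = j then 1 else 0)" for i j
  proof -
    have "(A ** transpose (cm A)) $ i $ j = (mat 1 :: gf4 ^ 3 ^ 3) $ i $ j"
      using assms by (simp add: SU_iff)
    then show ?thesis
      by (simp add: matrix_matrix_mult_def transpose_def cm_def mat_def)
  qed
  then have d: "dot3 (tri (A $ i)) (cq3 (tri (A $ j))) = (if i = j then 1 else 0)" for i j
    by (simp add: dot3_vec cv_def)
  then show "(tri (A $ 1), tri (A $ 2)) \<in> set su_rows"
    using vecs3_all by (simp add: su_rows_def unit3_def gf4_zero[symmetric] gf4_one[symmetric]) 
  \<comment> \<open>The cross product of the first two rows. \<open>A\<close> maps it to the third
    unit vector by the determinant, and maps the conjugate of its third row there by unitarity;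
    \<open>A\<close> is invertible.\<close>
  define y :: "gf4 ^ 3" where "y = vector [A$1$2 * A$2$3 + A$1$3 * A$2$2, A$1$3 * A$2$1 + A$1$1 * A$2$3, A$1$1 * A$2$2 + A$1$2 * A$2$1]"
  have dbl: "x + x = 0" for x :: gf4
    using gf4_zero by (cases x) simp
  have two: "(2 :: gf4) = 0"
    using dbl[of 1] by (simp only: one_add_one)
  have mp: "x - x' = x + x'" for x x' :: gf4
    by (simp add: minus_gf4_def)
  have "A *v y = A *v cv (A $ 3)"
  proof -
    have "A$1$1*y$1 + A$1$2*y$2 + A$1$3*y$3 = 0" "A$2$1*y$1 + A$2$2*y$2 + A$2$3*y$3 = 0"
      "A$3$1*y$1 + A$3$2*y$2 + A$3$3*y$3 = det A"
      unfolding y_def det_3 mp by (simp_all add: algebra_simps two)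
    then show ?thesis
      using e[of 1 3] e[of 2 3] e[of 3 3] assms
      by (simp add: vec_eq_iff forall_3 matrix_vector_mult_def sum_3 cv_def SU_iff)
  qed
  then have "y = cv (A $ 3)"
    using SU_adjoint[OF assms] by (metis matrix_vector_mul_assoc matrix_vector_mul_lid)
  then have "A $ 3 = cv y"
    by simp
  then show "tri (A $ 3) = cross3c (tri (A $ 1)) (tri (A $ 2))"
    by (simp add: tri_def y_def cv_def)
qed

lemma LA_row_check:
  assumes "A \<in> SU3_2"
  shows "image_check (map (Psi (LA A)) pts) (tri (A $ 1)) (tri (A $ 2)) (tri (A $ 3))"
proof -
  have "row_check (tri (A $ 1), tri (A $ 2))"
    using rows_list cross_eq(2)[OF assms] by (simp only: list_all_iff)
  moreover have "(\<lambda>p. pidx (mv3 (tri (A $ 1)) (tri (A $ 2)) (tri (A $ 3)) (rep3 p))) = Psi (LA A)"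
    by (simp add: fun_eq_iff Psi_def tri_LA del: pidx.simps)
  ultimately show ?thesis
    by (simp only: row_check.simps triple_check.simps cross_eq(1)[OF assms, symmetric])
qed

lemma map_pts_eq: "map g pts = map g' pts \<longleftrightarrow> g = g'"
  using set_pts by (auto simp: fun_eq_iff)

lemma Psi_LA_Kset:
  assumes "A \<in> SU3_2"
  shows "Psi (LA A) \<in> Kset" "Psi (LA A) \<noteq> rho D1 N0" "Psi (LA A) = id \<Longrightarrow> \<exists>c. c \<noteq> 0 \<and> LA A = (\<lambda>v. c *s v)"
proof -
  note ck = LA_row_check[OF assms, unfolded image_check.simps affine_check.simps map_pts_eq]
  show "Psi (LA A) \<in> Kset"
    using ck by (elim conjE disjE) (auto intro: KsetI simp: zero_prod_def)
  show "Psi (LA A) \<noteq> rho D1 N0"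
    using ck by blast
  assume "Psi (LA A) = id"
  then have "map (Psi (LA A)) pts = pts"
    by simp
  then obtain c where c: "tri (A $ 1) = (c, 0, 0)" "tri (A $ 2) = (0, c, 0)" "tri (A $ 3) = (0, 0, c)"
    using ck that[of "fst (tri (A $ 1))"] unfolding gf4_zero by blast
  then have "LA A = (\<lambda>v. c *s v)"
    by (auto simp: fun_eq_iff LA_def vec_eq_iff forall_3 matrix_vector_mult_def sum_3 tri_def)
  moreover have "c \<noteq> 0"
  proof
    assume "c = 0"
    with c have "det A = 0"
      by (simp add: det_3 tri_def)
    with assms show False
      by (simp add: SU_iff)
  qed
  ultimately show "\<exists>c. c \<noteq> 0 \<and> LA A = (\<lambda>v. c *s v)" by blast
qed

lemma Psi_cv: "Psi (SA (mat 1)) = rho D1 N0"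
proof
  fix p :: pt
  have "tri (SA (mat 1) (rep p)) = cq3 (rep3 p)"
    by (simp add: SA_def tri_def cv_def flip: tri_rep)
  then show "Psi (SA (mat 1)) p = rho D1 N0 p"
    unfolding Psi_def by (cases p; cases "fst p"; cases "snd p"; simp add: cq_def lab_def)
qed

lemma Psi_SA: "A \<in> SU3_2 \<Longrightarrow> Psi (SA A) = Psi (LA A) \<circ> rho D1 N0"
proof -
  assume A: "A \<in> SU3_2"
  have "SA A = LA A \<circ> SA (mat 1)"
    by (simp add: LS_comp)
  with A show ?thesis
    by (simp add: Psi_comp Sigma_carrier SU_one Psi_cv)
qed

lemma Psi_Kset: "g \<in> carrier SigmaU3_2 \<Longrightarrow> Psi g \<in> Kset"
  unfolding Sigma_carrier using Psi_LA_Kset(1) rho_in_Kset by (auto simp: Psi_SA intro!: Kset_comp)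

definition Scal :: "(gf4 ^ 3 \<Rightarrow> gf4 ^ 3) set" where
  "Scal = {\<lambda>v. c *s v | c. c \<noteq> 0}"

lemma rho_invol: "rho k c \<circ> rho k c = id"
  by (cases k) (auto simp: fun_eq_iff)

text \<open>If \<open>SA A\<close> acted trivially, then \<open>LA A\<close> would induce the
  reflection \<open>rho D1 N0\<close> of field conjugation, which the enumeration excludes.\<close>

lemma Psi_kernel: "g \<in> carrier SigmaU3_2 \<Longrightarrow> Psi g = id \<Longrightarrow> g \<in> Scal"
proof -
  assume g: "g \<in> carrier SigmaU3_2" "Psi g = id"
  then consider A where "A \<in> SU3_2" "g = LA A" | A where "A \<in> SU3_2" "g = SA A"
    by (auto simp: Sigma_carrier)
  then show ?thesis
  proof cases
    case 1
    then show ?thesis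
      using Psi_LA_Kset(3) g(2) by (auto simp: Scal_def)
  next
    case 2
    then have "Psi (LA A) \<circ> rho D1 N0 \<circ> rho D1 N0 = rho D1 N0"
      using g(2) by (simp add: Psi_SA)
    then have "Psi (LA A) = rho D1 N0"
      by (simp add: comp_assoc rho_invol)
    with 2 show ?thesis
      using Psi_LA_Kset(2) by blast
  qed
qed

text \<open>Nonzero scalars are cube roots of unity, so they have norm 1 and determinant 1.\<close>

lemma Scal_kernel: "g \<in> Scal \<Longrightarrow> g \<in> carrier SigmaU3_2 \<and> Psi g = id"
proof -
  assume "g \<in> Scal"
  then obtain c where c: "c \<noteq> 0" "g = (\<lambda>v. c *s v)"
    by (auto simp: Scal_def)
  obtain c1 c2 where cc: "c = GF4 c1 c2"
    by (cases c)
  have c3: "c * (c * c) = 1"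
    using c(1) unfolding cc by (cases c1; cases c2) (simp_all add: zero_gf4_def one_gf4_def)
  have c3': "c * c * c = 1"
    using c3 by (simp add: ac_simps)
  have "(mat c :: gf4 ^ 3 ^ 3) \<in> SU3_2"
    unfolding SU_iff
    by (simp add: det_3 c3 c3' mat_def cm_def transpose_def matrix_matrix_mult_def vec_eq_iff forall_3 sum_3 cq_def)
  moreover have "LA (mat c) = g"
    by (simp add: c LA_def fun_eq_iff vec_eq_iff forall_3 matrix_vector_mult_def sum_3 mat_def)
  ultimately have "g \<in> carrier SigmaU3_2"
    by (auto simp: Sigma_carrier)
  moreover have "Psi g = id"
    by (simp add: fun_eq_iff Psi_def c tri_scale pidx_sc pidx_rep)
  ultimately show ?thesis by blast
qed

lemma group_hom_Psi: "group_hom SigmaU3_2 Kgrp Psi"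
proof (intro group_hom.intro group_hom_axioms.intro group_Sigma group_Kgrp homI)
  fix g g' assume g: "g \<in> carrier SigmaU3_2" "g' \<in> carrier SigmaU3_2"
  then show "Psi g \<in> carrier Kgrp"
    by (simp add: Kgrp_def Psi_Kset)
  have "Psi (g \<circ> g') = Psi g \<circ> Psi g'"
    by (rule Psi_comp[OF g])
  then show "Psi (g \<otimes>\<^bsub>SigmaU3_2\<^esub> g') = Psi g \<otimes>\<^bsub>Kgrp\<^esub> Psi g'"
    by (simp add: Kgrp_def SigmaU3_2_def)
qed

text \<open>The image contains generators of the group of affine maps: two independent translations,
  multiplication by a generator of the multiplicative group, and a reflection.\<close>

lemma Psi_image: "Psi ` carrier SigmaU3_2 = Kset"
proof (rule antisym)
  show "Psi ` carrier SigmaU3_2 \<subseteq> Kset"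
    using Psi_Kset by blast
  define I where "I = Psi ` carrier SigmaU3_2"
  have comp: "g \<circ> g' \<in> I" if gg: "g \<in> I" "g' \<in> I" for g g'
  proof -
    obtain k k' where k: "k \<in> carrier SigmaU3_2" "k' \<in> carrier SigmaU3_2" "g = Psi k" "g' = Psi k'"
      using gg unfolding I_def by blast
    then have "k \<circ> k' \<in> carrier SigmaU3_2"
      using group.subgroup_self[OF group_Sigma, THEN subgroup.m_closed, of k k'] by simp
    then show ?thesis
      unfolding I_def using Psi_comp[OF k(1,2)] k(3,4) by (metis imageI)
  qed
  have LI: "Psi (LA A) \<in> I" "Psi (SA A) \<in> I" if "A \<in> SU3_2" for A
    using that by (auto simp: I_def Sigma_carrier)
  have su: "(vector [vector [p1, p2, p3], vector [q1, q2, q3], vector [r1, r2, r3]] :: gf4 ^ 3 ^ 3) \<in> SU3_2"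
    if "dot3 (p1,p2,p3) (cq3 (p1,p2,p3)) = 1" "dot3 (q1,q2,q3) (cq3 (q1,q2,q3)) = 1"
      "dot3 (r1,r2,r3) (cq3 (r1,r2,r3)) = 1" "dot3 (p1,p2,p3) (cq3 (q1,q2,q3)) = 0" "dot3 (q1,q2,q3) (cq3 (p1,p2,p3)) = 0"
      "dot3 (p1,p2,p3) (cq3 (r1,r2,r3)) = 0" "dot3 (r1,r2,r3) (cq3 (p1,p2,p3)) = 0"
      "dot3 (q1,q2,q3) (cq3 (r1,r2,r3)) = 0" "dot3 (r1,r2,r3) (cq3 (q1,q2,q3)) = 0"
      "p1 * q2 * r3 + p2 * q3 * r1 + p3 * q1 * r2 + p1 * q3 * r2 + p2 * q1 * r3 + p3 * q2 * r1 = 1"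
    for p1 p2 p3 q1 q2 q3 r1 r2 r3
    using that by (simp add: SU_iff det_3 matrix_matrix_mult_def transpose_def cm_def mat_def vec_eq_iff forall_3 sum_3 minus_gf4_def)
  let ?O = "GF4 0 0" let ?I = "GF4 1 0" let ?w = "GF4 0 1" let ?v = "GF4 1 1"
  \<comment> \<open>The cyclic shift \<open>X\<close> induces translation by i, the diagonal matrix
    \<open>Z\<close> translation by 1, and \<open>Y\<close> after field conjugation induces
    multiplication by 1 + i.\<close>
  define X :: "gf4 ^ 3 ^ 3" where "X = vector [vector [?O, ?I, ?O], vector [?O, ?O, ?I], vector [?I, ?O, ?O]]"
  define Z :: "gf4 ^ 3 ^ 3" where "Z = vector [vector [?I, ?O, ?O], vector [?O, ?w, ?O], vector [?O, ?O, ?v]]"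
  define Y :: "gf4 ^ 3 ^ 3" where "Y = vector [vector [?I, ?v, ?v], vector [?w, ?v, ?w], vector [?w, ?w, ?v]]"
  have SU: "X \<in> SU3_2" "Z \<in> SU3_2" "Y \<in> SU3_2"
    unfolding X_def Z_def Y_def by (rule su; simp add: cq_def gf4_zero gf4_one)+
  have tX: "Psi (LA X) = kmap (N1, N0) False (N0, N1)" and tZ: "Psi (LA Z) = kmap (N1, N0) False (N1, N0)"
    and tY: "Psi (SA Y) = kmap (N1, N1) False (N0, N0)"
  proof -
    have rows: "tri (X $ 1) = (?O, ?I, ?O)" "tri (X $ 2) = (?O, ?O, ?I)" "tri (X $ 3) = (?I, ?O, ?O)"
      "tri (Z $ 1) = (?I, ?O, ?O)" "tri (Z $ 2) = (?O, ?w, ?O)" "tri (Z $ 3) = (?O, ?O, ?v)"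
      "tri (Y $ 1) = (?I, ?v, ?v)" "tri (Y $ 2) = (?w, ?v, ?w)" "tri (Y $ 3) = (?w, ?w, ?v)"
      by (simp_all add: X_def Y_def Z_def tri_def)
    have tcv: "tri (cv v) = cq3 (tri v)" for v
      by (simp add: tri_def cv_def)
    show "Psi (LA X) = kmap (N1, N0) False (N0, N1)"
      unfolding fun_eq_iff split_paired_all
      by (simp add: all_f3 Psi_def tri_LA rows mv3_def cq_def lab_def)
    show "Psi (LA Z) = kmap (N1, N0) False (N1, N0)"
      unfolding fun_eq_iff split_paired_all
      by (simp add: all_f3 Psi_def tri_LA rows mv3_def cq_def lab_def)
    show "Psi (SA Y) = kmap (N1, N1) False (N0, N0)"
      unfolding fun_eq_iff split_paired_all
      by (simp add: all_f3 Psi_def SA_LA tri_LA tcv rows mv3_def cq_def lab_def)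
  qed
  have t01: "kmap (N1, N0) False (N0, N1) \<in> I" and t10: "kmap (N1, N0) False (N1, N0) \<in> I"
    and z1: "kmap (N1, N1) False (N0, N0) \<in> I" and r: "rho D1 N0 \<in> I"
    using LI SU SU_one tX tZ tY Psi_cv by metis+
  have ceq: "kmap (c1, c2) False (N0, N0) \<circ> kmap (e1, e2) False (N0, N0) = kmap (c1 * e1 - c2 * e2, c2 * e1 + c1 * e2) False (N0, N0)"
    for c1 c2 e1 e2
    by (auto simp: fun_eq_iff algebra_simps)
  \<comment> \<open>1 + i generates the multiplicative group of the field with nine elements, cyclic
    of order 8; \<open>z1\<close> to \<open>z7\<close> and then \<open>z0\<close> are its powers 1
    to 8.\<close>
  have z2: "kmap (N0, N2) False (N0, N0) \<in> I"
    using comp[OF z1 z1] by (simp add: ceq)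
  have z3: "kmap (N1, N2) False (N0, N0) \<in> I"
    using comp[OF z2 z1] by (simp add: ceq)
  have z4: "kmap (N2, N0) False (N0, N0) \<in> I"
    using comp[OF z3 z1] by (simp add: ceq)
  have z5: "kmap (N2, N2) False (N0, N0) \<in> I"
    using comp[OF z4 z1] by (simp add: ceq)
  have z6: "kmap (N0, N1) False (N0, N0) \<in> I"
    using comp[OF z5 z1] by (simp add: ceq)
  have z7: "kmap (N2, N1) False (N0, N0) \<in> I"
    using comp[OF z6 z1] by (simp add: ceq)
  have z0: "kmap (N1, N0) False (N0, N0) \<in> I"
    using comp[OF z7 z1] by (simp add: ceq)
  have zc: "kmap (c1, c2) False (N0, N0) \<in> I" if "(c1, c2) \<noteq> 0" for c1 c2
    using that z0 z1 z2 z3 z4 z5 z6 z7 by (cases c1; cases c2; simp add: zero_prod_def)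
  have zs: "kmap (c1, c2) s (N0, N0) \<in> I" if "(c1, c2) \<noteq> 0" for c1 c2 s
  proof (cases s)
    case True
    \<comment> \<open>\<open>rho D1 N0\<close> is minus the conjugation, which is why the multiplier
      is negated.\<close>
    have "kmap (c1, c2) True (N0, N0) = kmap (- c1, - c2) False (N0, N0) \<circ> rho D1 N0"
      by (auto simp: fun_eq_iff)
    moreover have "(- c1, - c2) \<noteq> 0"
      using that by (cases c1; cases c2; simp add: zero_prod_def)
    ultimately show ?thesis
      using comp[OF zc r] True by metis
  qed (use zc that in simp)
  have teq: "kmap (N1, N0) False (d1, d2) \<circ> kmap c s (e1, e2) = kmap c s (d1 + e1, d2 + e2)" for c s d1 d2 e1 e2
    by (cases c) (auto simp: fun_eq_iff Let_def ac_simps)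
  have "kmap c s (N0, N0) \<in> I \<Longrightarrow> kmap c s d \<in> I" for c s d
  proof -
    assume k: "kmap c s (N0, N0) \<in> I"
    have 1: "kmap c s (N1, N0) \<in> I"
      using comp[OF t10 k] by (simp add: teq)
    have 2: "kmap c s (N2, N0) \<in> I"
      using comp[OF t10 1] by (simp add: teq)
    have "kmap c s (d1, N0) \<in> I" for d1
      using k 1 2 by (cases d1) auto
    note 0 = this
    have 3: "kmap c s (d1, N1) \<in> I" for d1
      using comp[OF t01 0[of d1]] by (simp add: teq)
    have 4: "kmap c s (d1, N2) \<in> I" for d1
      using comp[OF t01 3[of d1]] by (simp add: teq)
    show "kmap c s d \<in> I"
      using 0 3 4 by (cases d; cases "snd d") auto
  qed
  with zs show "Kset \<subseteq> I"
    unfolding Kset_def by auto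
qed

theorem U3_2_ext2_iso: "U3_2_ext2 \<cong> Kgrp"
proof -
  interpret group_hom SigmaU3_2 Kgrp Psi
    by (rule group_hom_Psi)
  have "kernel SigmaU3_2 Kgrp Psi = Scal"
    using Psi_kernel Scal_kernel by (auto simp: kernel_def Kgrp_def)
  moreover have "Psi ` carrier SigmaU3_2 = carrier Kgrp"
    by (simp add: Psi_image Kgrp_def)
  ultimately have "SigmaU3_2 Mod Scal \<cong> Kgrp"
    using FactGroup_iso by metis
  then show ?thesis
    by (simp add: U3_2_ext2_def Scal_def)
qed

section \<open>Miyamoto involutions\<close>

context comm_algebra
begin

text \<open>The Lagrange interpolation polynomial of the multiplication by \<open>t\<close> that projects onto the eigenvalue
  $\frac1{32}$ along the eigenvalues $0$, $\frac14$ and $1$.\<close>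

definition mproj :: "'v \<Rightarrow> 'v \<Rightarrow> 'v" where
  "mproj t v = (32768/217) *\<^sub>Q (t \<diamondop> (t \<diamondop> (t \<diamondop> v - v) - (1/4) *\<^sub>Q (t \<diamondop> v - v)))"

text \<open>The Miyamoto involution as a polynomial in the multiplication by \<open>t\<close>. In
  this form it can be evaluated from a multiplication table, and it visibly commutes with
  automorphisms.\<close>

definition tau :: "'v \<Rightarrow> 'v \<Rightarrow> 'v" where
  "tau t v = v - 2 *\<^sub>Q mproj t v"

lemma mproj_lin: "mproj t (v + v') = mproj t v + mproj t v'" "mproj t (r *\<^sub>Q v) = r *\<^sub>Q mproj t v"
  by (simp_all add: mproj_def mul_lin algebra_simps scale_right_distrib scale_right_diff_distrib)

lemma tau_add: "tau t (v + v') = tau t v + tau t v'" and tau_scale: "tau t (r *\<^sub>Q v) = r *\<^sub>Q tau t v"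
  by (simp_all add: tau_def mproj_lin algebra_simps scale_right_distrib scale_right_diff_distrib)

lemma tau_zero: "tau t 0 = 0"
  using tau_scale[of t 0 0] by simp

lemma mproj_eigen:
  assumes "t \<diamondop> v = l *\<^sub>Q v"
  shows "mproj t v = (32768/217 * (l * (l - 1/4) * (l - 1))) *\<^sub>Q v"
proof -
  have 1: "t \<diamondop> v - v = (l - 1) *\<^sub>Q v"
    by (simp add: assms scale_left_diff_distrib)
  have 2: "t \<diamondop> ((l - 1) *\<^sub>Q v) - (1/4) *\<^sub>Q ((l - 1) *\<^sub>Q v) = ((l - 1/4) * (l - 1)) *\<^sub>Q v"
    by (simp add: assms mul_scale_right flip: scale_left_diff_distrib) (simp add: field_simps)
  show ?thesis
    unfolding mproj_def 1 2 by (simp add: mul_scale_right assms field_simps)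
qed

lemma tau_even: "t \<diamondop> v = l *\<^sub>Q v \<Longrightarrow> l \<in> {1, 0, 1/4} \<Longrightarrow> tau t v = v"
  and tau_odd: "t \<diamondop> v = (1/32) *\<^sub>Q v \<Longrightarrow> tau t v = - v"
proof -
  show "t \<diamondop> v = l *\<^sub>Q v \<Longrightarrow> l \<in> {1, 0, 1/4} \<Longrightarrow> tau t v = v"
    using mproj_eigen[of t v l] by (auto simp: tau_def)
  assume "t \<diamondop> v = (1/32) *\<^sub>Q v"
  then have "mproj t v = 1 *\<^sub>Q v"
    using mproj_eigen[of t v "1/32"] by simp
  moreover have "v - 2 *\<^sub>Q v = - v"
    using scale_left_distrib[of 1 1 v] by (simp add: algebra_simps)
  ultimately show "tau t v = - v"
    by (simp add: tau_def)
qed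

lemma axis_span: "primitive_axis t \<Longrightarrow> v \<in> span (\<Union>l\<in>{1, 0, 1/4, 1/32}. eigenspace t l)"
  by (auto simp: primitive_axis_def eigen_sum_def)

lemma axis_induct [consumes 1, case_names zero step]:
  assumes "primitive_axis t" "P 0"
    and "\<And>c v v' l. l \<in> {1, 0, 1/4, 1/32} \<Longrightarrow> t \<diamondop> v = l *\<^sub>Q v \<Longrightarrow> P v' \<Longrightarrow> P (c *\<^sub>Q v + v')"
  shows "P v"
  using axis_span[OF assms(1), of v]
proof (induction rule: span_induct_alt)
  case (step c v v')
  then obtain l where "l \<in> {1, 0, 1/4, 1/32}" "t \<diamondop> v = l *\<^sub>Q v"
    unfolding eigenspace_def by blast
  with step.IH show ?case
    using assms(3) by blast
qed (rule assms(2))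

lemma tau_linear: "Vector_Spaces.linear scale scale (tau t)"
  by (intro Vector_Spaces.linear.intro module_hom.intro module_hom_axioms.intro vector_space_axioms
      module_axioms tau_add tau_scale)

lemma miyamoto_eq:
  assumes "primitive_axis t"
  shows "miyamoto t = tau t"
  unfolding miyamoto_def
proof (rule the_equality)
  show "Vector_Spaces.linear scale scale (tau t) \<and>
     (\<forall>u\<in>eigenspace t (1/32). tau t u = - u) \<and> (\<forall>l\<in>{1, 0, 1/4}. \<forall>u\<in>eigenspace t l. tau t u = u)"
    using tau_linear tau_even tau_odd unfolding eigenspace_def by blast
next
  fix h
  assume h: "Vector_Spaces.linear scale scale h \<and>
     (\<forall>u\<in>eigenspace t (1/32). h u = - u) \<and> (\<forall>l\<in>{1, 0, 1/4}. \<forall>u\<in>eigenspace t l. h u = u)"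
  then have lin: "h (v + v') = h v + h v'" "h (c *\<^sub>Q v) = c *\<^sub>Q h v" for v v' c
    unfolding Vector_Spaces.linear_def module_hom_def module_hom_axioms_def by blast+
  have "h v = tau t v" for v
    using assms
  proof (induction v rule: axis_induct)
    case zero
    then show ?case
      using lin(2)[of 0 0] by (simp add: tau_zero)
  next
    case (step c v v' l)
    have "h v = tau t v"
    proof (cases "l = 1/32")
      case True
      then show ?thesis
        using h step(2) tau_odd[of t v] by (simp add: eigenspace_def)
    next
      case False
      then have l: "l \<in> {1, 0, 1/4}"
        using step(1) by simp
      then have "h v = v"
        using h step(2) unfolding eigenspace_def by blast
      then show ?thesis
        using tau_even[OF step(2) l] by simp
    qed
    then show ?case
      by (simp add: lin tau_add tau_scale step)
  qed
  then show "h = tau t" by blast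
qed

lemma tau_tau:
  assumes "primitive_axis t"
  shows "tau t (tau t v) = v"
  using assms
proof (induction v rule: axis_induct)
  case (step c v v' l)
  have m: "tau t (- v) = - tau t v" for v
    using tau_scale[of t "-1" v] by simp
  have "tau t (tau t v) = v"
    using tau_even[OF step(2)] tau_odd[of t v] step(1,2) by (cases "l = 1/32") (auto simp: m)
  then show ?case
    by (simp add: tau_add tau_scale step)
qed (simp add: tau_zero)

lemma mproj_odd:
  assumes "primitive_axis t"
  shows "t \<diamondop> mproj t v = (1/32) *\<^sub>Q mproj t v"
  using assms
proof (induction v rule: axis_induct)
  case zero
  then show ?case by (simp add: mproj_def)
next
  case (step c v v' l)
  have "t \<diamondop> mproj t v = (1/32) *\<^sub>Q mproj t v"
  proof -
    define s where "s = 32768/217 * (l * (l - 1/4) * (l - 1))"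
    \<comment> \<open>Either the interpolation polynomial vanishes at \<open>l\<close>, so that s is
      0, or \<open>l\<close> is 1/32.\<close>
    have s: "s * l = (1/32) * s"
    proof -
      have "l * (l - 1/4) * (l - 1) = 0 \<or> l = 1/32"
        using step(1) by auto
      then show ?thesis
      proof
        assume "l * (l - 1/4) * (l - 1) = 0"
        then show ?thesis
          unfolding s_def by (simp only: mult_zero_right mult_zero_left)
      qed (simp only: mult.commute)
    qed
    have "t \<diamondop> mproj t v = (s * l) *\<^sub>Q v"
      unfolding mproj_eigen[OF step(2), folded s_def] by (simp add: mul_scale_right step(2))
    also have "\<dots> = (1/32) *\<^sub>Q mproj t v"
      unfolding mproj_eigen[OF step(2), folded s_def] s by simp
    finally show ?thesis .
  qed
  then show ?case
    by (simp add: mproj_lin mul_lin step scale_right_distrib)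
qed

text \<open>A vector negated by \<open>tau t\<close> equals its own projection
  \<open>mproj t v\<close>, and such projections are 1/32-eigenvectors.\<close>

lemma tau_minus_odd:
  assumes "primitive_axis t" "tau t v = - v"
  shows "t \<diamondop> v = (1/32) *\<^sub>Q v"
proof -
  have "2 *\<^sub>Q mproj t v = v + v"
    using assms(2) by (simp add: tau_def algebra_simps)
  also have "v + v = 2 *\<^sub>Q v"
    using scale_left_distrib[of 1 1 v] by simp
  finally have "mproj t v = v"
    by simp
  with mproj_odd[OF assms(1), of v] show ?thesis
    by simp
qed

lemma eigen_sum_tau:
  assumes "v \<in> eigen_sum t N" "\<And>l w. l \<in> N \<Longrightarrow> t \<diamondop> w = l *\<^sub>Q w \<Longrightarrow> tau t w = e *\<^sub>Q w"
  shows "tau t v = e *\<^sub>Q v"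
  using assms(1) unfolding eigen_sum_def
proof (induction rule: span_induct_alt)
  case (step c v v')
  then show ?case
    using assms(2) by (auto simp: eigenspace_def tau_add tau_scale scale_right_distrib mult.commute)
qed (simp add: tau_zero)

definition fusion_sgn :: "rat \<Rightarrow> rat" where
  "fusion_sgn l = (if l = 1/32 then - 1 else 1)"

text \<open>The fusion law is graded by a group of order two, with 1/32 odd and the other
  eigenvalues even; this is why \<open>tau t\<close> is multiplicative.\<close>

lemma monster_fusion_sgn: "\<forall>l\<in>{1, 0, 1/4, 1/32}. \<forall>m\<in>{1, 0, 1/4, 1/32}. \<forall>k\<in>monster_fusion l m.
    k \<in> {1, 0, 1/4, 1/32} \<and> fusion_sgn k = fusion_sgn l * fusion_sgn m"
  by (simp add: monster_fusion_def fusion_sgn_def doubleton_eq_iff)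

lemma tau_mul:
  assumes ax: "primitive_axis t"
  shows "tau t (v \<diamondop> w) = tau t v \<diamondop> tau t w"
proof -
  have base: "tau t (v \<diamondop> w) = tau t v \<diamondop> tau t w"
    if l: "l \<in> {1, 0, 1/4, 1/32}" "t \<diamondop> v = l *\<^sub>Q v" and m: "m \<in> {1, 0, 1/4, 1/32}" "t \<diamondop> w = m *\<^sub>Q w" for l m v w
  proof -
    have s: "tau t y = fusion_sgn l *\<^sub>Q y" if "l \<in> {1, 0, 1/4, 1/32}" "t \<diamondop> y = l *\<^sub>Q y" for l y
    proof (cases "l = 1/32")
      case True
      then show ?thesis
        using tau_odd[of t y] that(2) by (simp add: fusion_sgn_def)
    next
      case False
      then have "l \<in> {1, 0, 1/4}"
        using that(1) by blast
      then show ?thesis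
        using tau_even[OF that(2)] False by (simp add: fusion_sgn_def)
    qed
    have "v \<diamondop> w \<in> eigen_sum t (monster_fusion l m)"
      by (rule axis_fusion[OF ax l(1) m(1) l(2) m(2)])
    then have "tau t (v \<diamondop> w) = (fusion_sgn l * fusion_sgn m) *\<^sub>Q (v \<diamondop> w)"
    proof (rule eigen_sum_tau)
      fix k y assume k: "k \<in> monster_fusion l m" "t \<diamondop> y = k *\<^sub>Q y"
      have "k \<in> {1, 0, 1/4, 1/32} \<and> fusion_sgn k = fusion_sgn l * fusion_sgn m"
        using monster_fusion_sgn l(1) m(1) k(1) by blast
      with s[OF _ k(2)] show "tau t y = (fusion_sgn l * fusion_sgn m) *\<^sub>Q y"
        by metis
    qed
    then show ?thesis
      by (simp add: s[OF l] s[OF m] mul_scale_left mul_scale_right)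
  qed
  have 1: "tau t (v \<diamondop> w) = tau t v \<diamondop> tau t w" if l: "l \<in> {1, 0, 1/4, 1/32}" "t \<diamondop> v = l *\<^sub>Q v" for l v
    using ax
  proof (induction w rule: axis_induct)
    case (step c w w' m)
    then show ?case
      using base[OF l step(1,2)] by (simp add: mul_lin tau_add tau_scale)
  qed (simp add: tau_zero)
  show ?thesis
    using ax
  proof (induction v rule: axis_induct)
    case (step c v v' l)
    then show ?case
      using 1[OF step(1,2)] by (simp add: mul_lin tau_add tau_scale)
  qed (simp add: tau_zero)
qed

lemma aut_carrier: "g \<in> carrier (aut_group UNIV) \<longleftrightarrow> bij g \<and> (\<forall>y z. g (y + z) = g y + g z) \<and>
    (\<forall>r y. g (r *\<^sub>Q y) = r *\<^sub>Q g y) \<and> (\<forall>y z. g (y \<diamondop> z) = g y \<diamondop> g z)"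
  by (auto simp: aut_group_def BijGroup_def Bij_def)

lemma aut_mult: "g \<in> carrier (aut_group UNIV) \<Longrightarrow> g' \<in> carrier (aut_group UNIV) \<Longrightarrow>
    g \<otimes>\<^bsub>aut_group UNIV\<^esub> g' = g \<circ> g'"
  by (auto simp: aut_group_def BijGroup_def compose_def)

lemma aut_one: "\<one>\<^bsub>aut_group UNIV\<^esub> = id"
  by (auto simp: aut_group_def BijGroup_def)

lemma group_aut: "group (aut_group UNIV)"
proof (rule groupI)
  fix g assume g: "g \<in> carrier (aut_group UNIV)"
  define g' where "g' = inv_into UNIV g"
  have b: "bij g" and 1: "g (g' y) = y" "g' (g y) = y" for y
    using g by (auto simp: aut_carrier g'_def bij_is_surj surj_f_inv_f bij_is_inj)
  have "bij g'"
    unfolding g'_def by (rule bij_imp_bij_inv[OF b])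
  moreover have "g' (y + z) = g' y + g' z" "g' (r *\<^sub>Q y) = r *\<^sub>Q g' y" "g' (y \<diamondop> z) = g' y \<diamondop> g' z" for y z r
    using g 1 unfolding aut_carrier by metis+
  ultimately have "g' \<in> carrier (aut_group UNIV)"
    by (simp add: aut_carrier)
  then show "\<exists>g'\<in>carrier (aut_group UNIV). g' \<otimes>\<^bsub>aut_group UNIV\<^esub> g = \<one>\<^bsub>aut_group UNIV\<^esub>"
    using g 1 by (intro bexI[of _ g']) (auto simp: aut_mult aut_one fun_eq_iff)
next
  have cl: "g \<circ> g' \<in> carrier (aut_group UNIV)" if "g \<in> carrier (aut_group UNIV)" "g' \<in> carrier (aut_group UNIV)" for g g'
    using that by (auto simp: aut_carrier intro: bij_comp)
  then show "g \<otimes>\<^bsub>aut_group UNIV\<^esub> g' \<in> carrier (aut_group UNIV)"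
    if "g \<in> carrier (aut_group UNIV)" "g' \<in> carrier (aut_group UNIV)" for g g'
    using that by (simp add: aut_mult)
  show "\<one>\<^bsub>aut_group UNIV\<^esub> \<in> carrier (aut_group UNIV)"
    by (simp add: aut_one aut_carrier)
  then show "\<one>\<^bsub>aut_group UNIV\<^esub> \<otimes>\<^bsub>aut_group UNIV\<^esub> g = g" if "g \<in> carrier (aut_group UNIV)" for g
    using that by (subst aut_mult) (auto simp: aut_one)
  show "g \<otimes>\<^bsub>aut_group UNIV\<^esub> g' \<otimes>\<^bsub>aut_group UNIV\<^esub> k = g \<otimes>\<^bsub>aut_group UNIV\<^esub> (g' \<otimes>\<^bsub>aut_group UNIV\<^esub> k)"
    if "g \<in> carrier (aut_group UNIV)" "g' \<in> carrier (aut_group UNIV)" "k \<in> carrier (aut_group UNIV)" for g g' k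
    using that cl by (simp add: aut_mult comp_assoc)
qed

lemma tau_aut: "primitive_axis t \<Longrightarrow> tau t \<in> carrier (aut_group UNIV)"
  using tau_tau[of t] by (auto simp: aut_carrier tau_add tau_scale tau_mul intro!: o_bij[of "tau t"])

lemma aut_tau: "g \<in> carrier (aut_group UNIV) \<Longrightarrow> tau (g t) (g v) = g (tau t v)"
proof -
  assume g: "g \<in> carrier (aut_group UNIV)"
  then have r: "g (y + z) = g y + g z" "g (c *\<^sub>Q y) = c *\<^sub>Q g y" "g (y \<diamondop> z) = g y \<diamondop> g z" for y z c
    by (auto simp: aut_carrier)
  have "g (y - z) = g y - g z" for y z
    using r(1)[of "y - z" z] by simp
  with r show ?thesis
    by (simp add: tau_def mproj_def)
qed

lemma miyamoto_group_group:
  assumes "\<And>t. t \<in> X \<Longrightarrow> primitive_axis t"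
  shows "group (miyamoto_group X)" "carrier (miyamoto_group X) \<subseteq> carrier (aut_group UNIV)"
    "\<And>g g'. g \<in> carrier (miyamoto_group X) \<Longrightarrow> g' \<in> carrier (miyamoto_group X) \<Longrightarrow> g \<otimes>\<^bsub>miyamoto_group X\<^esub> g' = g \<circ> g'"
    "\<one>\<^bsub>miyamoto_group X\<^esub> = id"
proof -
  have sub: "miyamoto ` X \<subseteq> carrier (aut_group UNIV)"
    using assms tau_aut miyamoto_eq by auto
  have sg: "subgroup (generate (aut_group UNIV) (miyamoto ` X)) (aut_group UNIV)"
    by (rule group.generate_is_subgroup[OF group_aut sub])
  then show "group (miyamoto_group X)"
    unfolding miyamoto_group_def by (rule subgroup.subgroup_is_group[OF _ group_aut])
  show c: "carrier (miyamoto_group X) \<subseteq> carrier (aut_group UNIV)"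
    using subgroup.subset[OF sg] by (simp add: miyamoto_group_def)
  show "\<one>\<^bsub>miyamoto_group X\<^esub> = id"
    by (simp add: miyamoto_group_def aut_one)
  show "g \<otimes>\<^bsub>miyamoto_group X\<^esub> g' = g \<circ> g'" if "g \<in> carrier (miyamoto_group X)" "g' \<in> carrier (miyamoto_group X)" for g g'
    using aut_mult c that by (auto simp: miyamoto_group_def)
qed

text \<open>An odd difference and an even sum exhibit two vectors as exchanged by the
  involution.\<close>

lemma tau_flip:
  assumes "t \<diamondop> (y - z) = (1/32) *\<^sub>Q (y - z)" "mproj t (y + z) = 0"
  shows "tau t y = z"
proof -
  have "tau t (y - z) = - (y - z)"
    by (rule tau_odd[OF assms(1)])
  moreover have "tau t (y + z) = y + z"
    by (simp add: tau_def assms)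
  moreover have "2 *\<^sub>Q y = (y - z) + (y + z)"
    using scale_left_distrib[of 1 1 y] by simp
  ultimately have "2 *\<^sub>Q tau t y = (z - y) + (y + z)"
    by (metis minus_diff_eq tau_add tau_scale)
  also have "\<dots> = 2 *\<^sub>Q z"
    using scale_left_distrib[of 1 1 z] by simp
  finally show ?thesis
    by simp
qed

text \<open>The table alone shows that the involution of \<open>e i\<close> reflects the indices
  about i. This identifies the axes \<open>e j\<close> beyond the two given ones, whose existence is
  all that the shape provides. \<open>flip_6A\<close> serves the same purpose.\<close>

lemma flip_4B:
  fixes e :: "int \<Rightarrow> 'v"
  assumes "\<And>i. e (i + 4) = e i"
    and "\<And>i. e i \<diamondop> e i = e i \<and>
          e i \<diamondop> e (i + 1) = (1/64) *\<^sub>Q (e i + e (i + 1) - e (i - 1) - e (i + 2) + r) \<and>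
          e i \<diamondop> e (i + 2) = (1/8) *\<^sub>Q (e i + e (i + 2) - r) \<and>
          e i \<diamondop> r = (1/8) *\<^sub>Q (e i + r - e (i + 2))"
  shows "tau (e i) (e (i + 1)) = e (i - 1)"
proof -
  have p: "e (i - 2) = e (i + 2)"
    using assms(1)[of "i - 2"] by (simp add: add.commute)
  define vs where "vs = [e i, e (i + 1), e (i - 1), e (i + 2), r]"
  have vs: "e i = den vs (LG 0)" "e (i + 1) = den vs (LG 1)" "e (i - 1) = den vs (LG 2)"
    "e (i + 2) = den vs (LG 3)" "r = den vs (LG 4)"
    by (simp_all add: vs_def)
  have m: "e i \<diamondop> e (i - 1) = (1/64) *\<^sub>Q (e (i - 1) + e i - e (i + 2) - e (i + 1) + r)"
    unfolding mul_commute[of "e i" "e (i - 1)"] using assms(2)[of "i - 1"] by (simp add: p add.commute[of _ i])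
  note t = assms(2)[of i, THEN conjunct1] assms(2)[of i, THEN conjunct2, THEN conjunct1]
    assms(2)[of i, THEN conjunct2, THEN conjunct2, THEN conjunct1]
    assms(2)[of i, THEN conjunct2, THEN conjunct2, THEN conjunct2]
  show ?thesis
  proof (rule tau_flip)
    show "e i \<diamondop> (e (i + 1) - e (i - 1)) = (1/32) *\<^sub>Q (e (i + 1) - e (i - 1))"
      unfolding mul_lin t m unfolding vs den_fold by (rule den_eqI) (simp add: vs_def)
    have "mproj (e i) (e (i + 1) + e (i - 1)) = 0 *\<^sub>Q e i"
      unfolding mproj_def mul_lin t m unfolding mul_lin t m unfolding mul_lin t m
      unfolding vs den_fold by (rule den_eqI) (simp add: vs_def)
    then show "mproj (e i) (e (i + 1) + e (i - 1)) = 0"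
      by simp
  qed
qed

lemma flip_6A:
  fixes e :: "int \<Rightarrow> 'v"
  assumes "\<And>i. e (i + 6) = e i"
    and "\<And>i. e i \<diamondop> e i = e i \<and>
          e i \<diamondop> e (i + 1) =
            (1/64) *\<^sub>Q (e i + e (i + 1) - e (i - 2) - e (i - 1) - e (i + 2) - e (i + 3) + r)
            + (45/2048) *\<^sub>Q u \<and>
          e i \<diamondop> e (i + 2) =
            (1/32) *\<^sub>Q (2 *\<^sub>Q e i + 2 *\<^sub>Q e (i + 2) + e (i - 2)) - (135/2048) *\<^sub>Q u \<and>
          e i \<diamondop> e (i + 3) = (1/8) *\<^sub>Q (e i + e (i + 3) - r) \<and>
          e i \<diamondop> r = (1/8) *\<^sub>Q (e i + r - e (i + 3)) \<and>
          e i \<diamondop> u = (1/9) *\<^sub>Q (2 *\<^sub>Q e i - e (i + 2) - e (i - 2)) + (5/32) *\<^sub>Q u"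
  shows "tau (e i) (e (i + 1)) = e (i - 1)"
proof -
  have p: "e (i - 3) = e (i + 3)" "e (i - 4) = e (i + 2)"
    using assms(1)[of "i - 3"] assms(1)[of "i - 4"] by (simp_all add: add.commute)
  define vs where "vs = [e i, e (i + 1), e (i - 1), e (i + 2), e (i - 2), e (i + 3), r, u]"
  have vs: "e i = den vs (LG 0)" "e (i + 1) = den vs (LG 1)" "e (i - 1) = den vs (LG 2)"
    "e (i + 2) = den vs (LG 3)" "e (i - 2) = den vs (LG 4)" "e (i + 3) = den vs (LG 5)"
    "r = den vs (LG 6)" "u = den vs (LG 7)"
    by (simp_all add: vs_def)
  have m: "e i \<diamondop> e (i - 1) = (1/64) *\<^sub>Q (e (i - 1) + e i - e (i + 3) - e (i - 2) - e (i + 1) - e (i + 2) + r)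
      + (45/2048) *\<^sub>Q u"
    unfolding mul_commute[of "e i" "e (i - 1)"] using assms(2)[of "i - 1"] by (simp add: p add.commute[of _ i])
  have m2: "e i \<diamondop> e (i - 2) = (1/32) *\<^sub>Q (2 *\<^sub>Q e (i - 2) + 2 *\<^sub>Q e i + e (i + 2)) - (135/2048) *\<^sub>Q u"
    unfolding mul_commute[of "e i" "e (i - 2)"] using assms(2)[of "i - 2"] by (simp add: p add.commute[of _ i])
  note t = assms(2)[of i, THEN conjunct1] assms(2)[of i, THEN conjunct2, THEN conjunct1]
    assms(2)[of i, THEN conjunct2, THEN conjunct2, THEN conjunct1]
    assms(2)[of i, THEN conjunct2, THEN conjunct2, THEN conjunct2, THEN conjunct1]
    assms(2)[of i, THEN conjunct2, THEN conjunct2, THEN conjunct2, THEN conjunct2, THEN conjunct1]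
    assms(2)[of i, THEN conjunct2, THEN conjunct2, THEN conjunct2, THEN conjunct2, THEN conjunct2] m m2
  show ?thesis
  proof (rule tau_flip)
    show "e i \<diamondop> (e (i + 1) - e (i - 1)) = (1/32) *\<^sub>Q (e (i + 1) - e (i - 1))"
      unfolding mul_lin t unfolding vs den_fold by (rule den_eqI) (simp add: vs_def)
    have "mproj (e i) (e (i + 1) + e (i - 1)) = 0 *\<^sub>Q e i"
      unfolding mproj_def mul_lin t unfolding mul_lin t unfolding mul_lin t
      unfolding vs den_fold by (rule den_eqI) (simp add: vs_def)
    then show "mproj (e i) (e (i + 1) + e (i - 1)) = 0"
      by simp
  qed
qed

end

section \<open>Involutions of the affine group\<close>

lemma sig_apply: "sig p q = - p - q"
  by (simp add: sig_def)

text \<open>Affine maps intertwine the reflection in a point with that in its image. Over a general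
  ring it is a ring identity; in characteristic three the term \<open>- e - e\<close> becomes
  \<open>e\<close>.\<close>

lemma affine_reflect:
  fixes r t p1 p2 x y e :: "'r :: comm_ring_1"
  shows "r * (- p1 - x) - t * (- p2 - y) + (- e - e) = - (r * p1 - t * p2 + e) - (r * x - t * y + e)"
    and "r * (- p1 - x) + t * (- p2 - y) + (- e - e) = - (r * p1 + t * p2 + e) - (r * x + t * y + e)"
  by (simp_all add: algebra_simps)

lemma kmap_sig: "kmap c s d \<circ> sig p = sig (kmap c s d p) \<circ> kmap c s d"
proof -
  have neg: "y = - y - y" for y :: f3
    by (cases y) simp_all
  note e = affine_reflect[where ?'r = f3, folded neg]
  have m: "- (- p - y) = - (- p) - (- y)" for p y :: f3
    by simp
  obtain c1 c2 d1 d2 p1 p2 where v: "c = (c1, c2)" "d = (d1, d2)" "p = (p1, p2)"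
    by (metis surj_pair)
  show ?thesis
  proof (rule ext)
    fix q :: pt
    obtain x y where q: "q = (x, y)"
      by fastforce
    have "sig (p1, p2) (x, y) = (- p1 - x, - p2 - y)"
      by (simp add: sig_def)
    then show "(kmap c s d \<circ> sig p) q = (sig (kmap c s d p) \<circ> kmap c s d) q"
      unfolding v q comp_apply by (cases s) (simp_all only: kmap.simps Let_def if_True if_False m e sig_apply diff_Pair uminus_Pair)
  qed
qed

lemma sig_conj: "g \<in> Kset \<Longrightarrow> g \<circ> sig p = sig (g p) \<circ> g"
proof -
  assume "g \<in> Kset"
  then obtain c s d where "g = kmap c s d"
    unfolding Kset_def by blast
  then show ?thesis
    by (simp only: kmap_sig)
qed

lemma sig_in_Kset: "sig p \<in> Kset"
proof (rule KsetI)
  show "sig p = kmap (N2, N0) False (- p)"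
    unfolding fun_eq_iff split_paired_all
    by (cases p; cases "fst p"; cases "snd p") (simp_all add: all_f3 sig_def)
qed (simp add: zero_prod_def)

definition invol :: "(pt \<Rightarrow> pt) \<Rightarrow> bool" where
  "invol t \<longleftrightarrow> t \<in> Kset \<and> t \<circ> t = id \<and> t \<noteq> id"

lemma invol_sig: "invol (sig p)"
proof -
  have "sig p 0 \<noteq> 0 \<or> sig p (N1, N0) \<noteq> (N1, N0)"
    by (cases p; cases "fst p"; cases "snd p") (simp_all add: sig_def zero_prod_def)
  then have "sig p \<noteq> id"
    by (metis id_apply)
  moreover have "sig p \<circ> sig p = id"
    by (simp add: fun_eq_iff sig_def)
  ultimately show ?thesis
    by (simp add: invol_def sig_in_Kset)
qed

lemma invol_rho: "invol (rho k c)"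
proof -
  have "rho k c (N0, N0) \<noteq> (N0, N0) \<or> rho k c (N1, N0) \<noteq> (N1, N0) \<or> rho k c (N0, N1) \<noteq> (N0, N1)"
    by (cases k; cases c) simp_all
  then have "rho k c \<noteq> id"
    by (metis id_apply)
  moreover have "rho k c \<circ> rho k c = id"
    by (cases k) (auto simp: fun_eq_iff)
  ultimately show ?thesis
    by (simp add: invol_def rho_in_Kset)
qed

lemma invol_conj:
  assumes "g \<in> Kset" "g' \<in> Kset" "g' \<circ> g = id" "g \<circ> g' = id" "invol t"
  shows "invol (g \<circ> t \<circ> g')"
  unfolding invol_def
proof (intro conjI)
  note e = assms(3,4)[THEN fun_cong, simplified]
  have tt: "t (t v) = v" for v
    using assms(5) unfolding invol_def by (metis comp_apply id_apply)
  show "g \<circ> t \<circ> g' \<in> Kset"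
    using assms by (simp add: Kset_comp invol_def)
  show "g \<circ> t \<circ> g' \<circ> (g \<circ> t \<circ> g') = id"
    using e tt by (simp add: fun_eq_iff)
  show "g \<circ> t \<circ> g' \<noteq> id"
  proof
    assume "g \<circ> t \<circ> g' = id"
    then have "g (t (g' (g y))) = g y" for y
      by (metis comp_apply id_apply)
    then have "t y = y" for y
      using e by metis
    with assms(5) show False
      by (auto simp: invol_def)
  qed
qed

lemma invol_cases:
  assumes "invol t"
  obtains p where "t = sig p" | k c where "t = rho k c"
proof -
  obtain c1 c2 s d1 d2 where t: "t = kmap (c1, c2) s (d1, d2)"
    using assms by (auto simp: invol_def Kset_def)
  have tt: "t (t q) = q" for q
    using assms unfolding invol_def by (metis comp_apply id_apply)
  \<comment> \<open>An affine map is determined by three points in general position, so testing the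
    involution property there is enough.\<close>
  have "(c1 = N1 \<and> c2 = N0 \<and> \<not> s \<and> d1 = N0 \<and> d2 = N0) \<or> (c1 = N2 \<and> c2 = N0 \<and> \<not> s) \<or>
      (s \<and> c1 = N1 \<and> c2 = N0 \<and> d1 = N0) \<or> (s \<and> c1 = N2 \<and> c2 = N0 \<and> d2 = N0) \<or>
      (s \<and> c1 = N0 \<and> c2 = N1 \<and> d2 = - d1) \<or> (s \<and> c1 = N0 \<and> c2 = N2 \<and> d2 = d1)"
    using tt[of "(N0, N0)"] tt[of "(N1, N0)"] tt[of "(N0, N1)"] unfolding t
    by (cases c1; cases c2; cases s; cases d1; cases d2; simp)
  then show ?thesis
  proof (elim disjE conjE)
    assume "c1 = N1" "c2 = N0" "\<not> s" "d1 = N0" "d2 = N0"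
    then have "t = id"
      by (auto simp: t fun_eq_iff)
    with assms show ?thesis
      by (simp add: invol_def)
  next
    assume "c1 = N2" "c2 = N0" "\<not> s"
    then have "t = sig (- d1, - d2)"
      unfolding t fun_eq_iff split_paired_all by (cases d1; cases d2; simp add: all_f3 sig_def)
    then show ?thesis by (rule that(1))
  next
    assume "s" "c1 = N1" "c2 = N0" "d1 = N0"
    then have "t = rho D2 (- d2)"
      unfolding t fun_eq_iff split_paired_all by (cases d2; simp add: all_f3)
    then show ?thesis by (rule that(2))
  next
    assume "s" "c1 = N2" "c2 = N0" "d2 = N0"
    then have "t = rho D1 (- d1)"
      unfolding t fun_eq_iff split_paired_all by (cases d1; simp add: all_f3)
    then show ?thesis by (rule that(2))
  next
    assume "s" "c1 = N0" "c2 = N1" "d2 = - d1"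
    then have "t = rho D4 d1"
      unfolding t fun_eq_iff split_paired_all by (cases d1; simp add: all_f3)
    then show ?thesis by (rule that(2))
  next
    assume "s" "c1 = N0" "c2 = N2" "d2 = d1"
    then have "t = rho D3 d1"
      unfolding t fun_eq_iff split_paired_all by (cases d1; simp add: all_f3)
    then show ?thesis by (rule that(2))
  qed
qed

lemma lam_rho: "lam k (rho k c p) = - c - lam k p"
  by (cases k; cases p; cases "fst p"; cases "snd p"; cases c) simp_all

lemma sig_rho_sig: "sig p \<circ> rho k c \<circ> sig p = rho k (- c - lam k p)"
  unfolding fun_eq_iff split_paired_all
  by (cases k; cases c; cases p; cases "fst p"; cases "snd p") (simp_all add: all_f3 sig_def)

lemma rho_sig_rho: "rho k c \<circ> sig p \<circ> rho k c = sig (rho k c p)"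
proof -
  have "rho k c \<circ> sig p \<circ> rho k c = sig (rho k c p) \<circ> (rho k c \<circ> rho k c)"
    using sig_conj[OF rho_in_Kset, of k c p] by (simp add: comp_assoc)
  then show ?thesis
    using invol_rho[of k c] by (simp add: invol_def)
qed

lemma sig_sig: "sig p \<circ> sig q = (\<lambda>v. v + (q - p))"
  by (simp add: sig_def fun_eq_iff)

lemma sig_rho_in: "sig p \<circ> rho k (lam k p) = rho (perp k) (lam (perp k) p)"
  unfolding fun_eq_iff split_paired_all
  by (cases k; cases p; cases "fst p"; cases "snd p") (simp_all add: all_f3 sig_def)

lemma rho_rho_perp: "rho k (lam k p) \<circ> rho (perp k) (lam (perp k) p) = sig p"
  unfolding fun_eq_iff split_paired_all
  by (cases k; cases p; cases "fst p"; cases "snd p") (simp_all add: all_f3 sig_def)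

text \<open>For a point off the line the product has order 6, and its cube is the reflection in the
  perpendicular line through the point: the 6A case.\<close>

lemma sig_rho_cube:
  assumes "lam k p \<noteq> c"
  defines "g \<equiv> sig p \<circ> rho k c"
  shows "g \<circ> g \<circ> g = rho (perp k) (lam (perp k) p)" "g \<circ> g \<noteq> id"
proof -
  show "g \<circ> g \<circ> g = rho (perp k) (lam (perp k) p)"
    using assms(1) unfolding g_def fun_eq_iff split_paired_all
    by (cases k; cases c; cases p; cases "fst p"; cases "snd p") (simp_all add: all_f3 sig_def)
  have "g (g (N0, N0)) \<noteq> (N0, N0)"
    using assms(1) unfolding g_def
    by (cases k; cases c; cases p; cases "fst p"; cases "snd p") (simp_all add: sig_def)
  then show "g \<circ> g \<noteq> id"
    by (auto simp: fun_eq_iff)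
qed

text \<open>Reflections in skew lines through \<open>p\<close> have a product of order 4 whose
  square is the reflection in \<open>p\<close>: the 4B case, with the conjugates that occur in its
  table.\<close>

lemma rho_skew_square:
  fixes p :: pt
  assumes "j \<noteq> k" "j \<noteq> perp k"
  defines "g \<equiv> rho k (lam k p) \<circ> rho j (lam j p)"
  shows "g \<circ> g = sig p" "rho k (lam k p) \<circ> rho j (lam j p) \<circ> rho k (lam k p) = rho (perp j) (lam (perp j) p)"
  using assms(1,2) unfolding g_def fun_eq_iff split_paired_all
  by (cases k; cases j; cases p; cases "fst p"; cases "snd p"; simp add: all_f3 sig_def)+

lemma rho_par_cube:
  fixes k :: dir and c d :: f3
  defines "g \<equiv> rho k c \<circ> rho k d"
  shows "g \<circ> g \<circ> g = id"
  unfolding g_def fun_eq_iff split_paired_all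
  by (cases k; cases c; cases d) (simp_all add: all_f3)

lemma ex_f3: "(\<exists>x. P x) \<longleftrightarrow> P N0 \<or> P N1 \<or> P N2"
  by (metis f3.exhaust)

lemma exists_lam2: "j \<noteq> k \<Longrightarrow> \<exists>p. lam k p = c \<and> lam j p = d"
proof -
  assume "j \<noteq> k"
  then have "\<exists>x y. lam k (x, y) = c \<and> lam j (x, y) = d"
    by (cases k; cases j; cases c; cases d; simp add: ex_f3)
  then show ?thesis by blast
qed

lemma rho_line_points: "lam k p \<noteq> c \<Longrightarrow>
    (rho k c p = p + nrm k \<and> - p - (p + nrm k) = p - nrm k) \<or>
    (rho k c p = p - nrm k \<and> - p - (p - nrm k) = p + nrm k)"
  by (cases k; cases c; cases p; cases "fst p"; cases "snd p") (simp_all add: zero_prod_def)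

text \<open>The mirror is the line of class \<open>k\<close> through the third point
  \<open>- p - q\<close> of the line joining the two points.\<close>

lemma rho_swap: "p \<noteq> q \<Longrightarrow> lam (perp k) p = lam (perp k) q \<Longrightarrow>
    lam k p \<noteq> - lam k p - lam k q \<and> rho k (- lam k p - lam k q) p = q"
  by (cases k; cases p; cases "fst p"; cases "snd p"; cases q; cases "fst q"; cases "snd q") simp_all

lemma sig_inj: "sig p = sig q \<Longrightarrow> p = q"
  by (metis sig_apply add.inverse_inverse diff_zero)

lemma rho_inj: "rho k c = rho k d \<Longrightarrow> c = d"
proof -
  assume "rho k c = rho k d"
  then have "- c - lam k 0 = - d - lam k 0"
    by (metis lam_rho)
  then show ?thesis
    by (cases c; cases d; cases "lam k 0"; simp)
qed

section \<open>The axes of the subgroup\<close>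

lemma funpow_small:
  "g ^^ 2 = g \<circ> g" "g ^^ 3 = g \<circ> g \<circ> g" "g ^^ 4 = (g \<circ> g) \<circ> (g \<circ> g)" "g ^^ 6 = (g \<circ> g \<circ> g) \<circ> (g \<circ> g \<circ> g)"
  by (simp_all add: eval_nat_numeral comp_assoc)

text \<open>Fixes the order of an element from the powers that are and are not the identity.\<close>

lemma dvd_small:
  fixes d :: nat
  shows "d dvd 2 \<Longrightarrow> \<not> d dvd 1 \<Longrightarrow> d = 2" "d dvd 3 \<Longrightarrow> \<not> d dvd 1 \<Longrightarrow> d = 3"
    "d dvd 4 \<Longrightarrow> \<not> d dvd 2 \<Longrightarrow> d = 4" "d dvd 6 \<Longrightarrow> \<not> d dvd 2 \<Longrightarrow> \<not> d dvd 3 \<Longrightarrow> d = 6"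
proof -
  have *: "d \<in> {1, 2, 3, 4, 5, 6}" if "d dvd n" "n \<in> {2, 3, 4, 6}" for n
  proof -
    have "d \<le> n"
      using that dvd_imp_le[of d n] by auto
    moreover have "d \<noteq> 0"
      using that by (cases "d = 0") auto
    moreover note that(2)
    ultimately show ?thesis by auto
  qed
  show "d dvd 2 \<Longrightarrow> \<not> d dvd 1 \<Longrightarrow> d = 2"
    using *[of 2] by auto
  show "d dvd 3 \<Longrightarrow> \<not> d dvd 1 \<Longrightarrow> d = 3"
    using *[of 3] by auto
  show "d dvd 4 \<Longrightarrow> \<not> d dvd 2 \<Longrightarrow> d = 4"
    using *[of 4] by auto
  show "d dvd 6 \<Longrightarrow> \<not> d dvd 2 \<Longrightarrow> \<not> d dvd 3 \<Longrightarrow> d = 6"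
    using *[of 6] by auto
qed

text \<open>\<open>th\<close> embeds the affine group into the Miyamoto group; its image will be the
  subgroup \<open>H\<close>.\<close>

locale h_config = seress_algebra_286 scale mul form X
  for scale :: "rat \<Rightarrow> 'v::ab_group_add \<Rightarrow> 'v" (infixr \<open>*\<^sub>Q\<close> 75)
    and mul :: "'v \<Rightarrow> 'v \<Rightarrow> 'v" (infixl \<open>\<diamondop>\<close> 72)
    and form :: "'v \<Rightarrow> 'v \<Rightarrow> rat"
    and X :: "'v set" +
  fixes th :: "(pt \<Rightarrow> pt) \<Rightarrow> 'v \<Rightarrow> 'v"
  assumes th_carrier: "g \<in> Kset \<Longrightarrow> th g \<in> carrier (miyamoto_group X)"
    and th_comp: "g \<in> Kset \<Longrightarrow> g' \<in> Kset \<Longrightarrow> th (g \<circ> g') = th g \<circ> th g'"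
    and th_inj: "inj_on th Kset"
begin

lemma mg:
  shows "group (miyamoto_group X)" "carrier (miyamoto_group X) \<subseteq> carrier (aut_group UNIV)"
    "\<And>g g'. g \<in> carrier (miyamoto_group X) \<Longrightarrow> g' \<in> carrier (miyamoto_group X) \<Longrightarrow>
      g \<otimes>\<^bsub>miyamoto_group X\<^esub> g' = g \<circ> g'"
    "\<one>\<^bsub>miyamoto_group X\<^esub> = id"
  by (rule miyamoto_group_group; (rule axes)?; assumption)+

lemma th_aut: "g \<in> Kset \<Longrightarrow> th g \<in> carrier (aut_group UNIV)"
  using th_carrier mg(2) by blast

lemma th_bij: "g \<in> Kset \<Longrightarrow> bij (th g)"
  and th_add: "g \<in> Kset \<Longrightarrow> th g (y + z) = th g y + th g z"
  and th_scale: "g \<in> Kset \<Longrightarrow> th g (r *\<^sub>Q y) = r *\<^sub>Q th g y"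
  and th_mul: "g \<in> Kset \<Longrightarrow> th g (y \<diamondop> z) = th g y \<diamondop> th g z"
  using th_aut[of g] unfolding aut_carrier by blast+

lemma th_comp_apply: "g \<in> Kset \<Longrightarrow> g' \<in> Kset \<Longrightarrow> th (g \<circ> g') v = th g (th g' v)"
  by (simp add: th_comp)

lemma th_inj_fun: "g \<in> Kset \<Longrightarrow> inj (th g)"
  using th_bij by (rule bij_is_inj)

lemma th_id: "th id v = v"
proof -
  have "th id (th id v) = th id v"
    using th_comp_apply[OF id_Kset id_Kset, of v] by simp
  then show ?thesis
    by (rule injD[OF th_inj_fun[OF id_Kset]])
qed

lemma th_eq_iff: "g \<in> Kset \<Longrightarrow> g' \<in> Kset \<Longrightarrow> th g = th g' \<longleftrightarrow> g = g'"
  using th_inj by (rule inj_on_eq_iff)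

lemma th_pow: "g \<in> Kset \<Longrightarrow> g ^^ n \<in> Kset \<and> th (g ^^ n) = th g [^]\<^bsub>miyamoto_group X\<^esub> n"
proof (induction n)
  case 0
  have "th id = id"
    by (simp add: fun_eq_iff th_id)
  moreover have e: "g ^^ 0 = id"
    by (rule ext) simp
  ultimately show ?case
    unfolding e by (simp only: id_Kset mg(4) monoid.nat_pow_0[OF group.is_monoid[OF mg(1)]] simp_thms)
next
  case (Suc n)
  then have IH: "g ^^ n \<in> Kset" "th (g ^^ n) = th g [^]\<^bsub>miyamoto_group X\<^esub> n"
    by blast+
  have e: "g ^^ Suc n = g ^^ n \<circ> g"
    by (rule funpow_Suc_right)
  have "th g [^]\<^bsub>miyamoto_group X\<^esub> Suc n = th (g ^^ n) \<otimes>\<^bsub>miyamoto_group X\<^esub> th g"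
    by (simp add: monoid.nat_pow_Suc[OF group.is_monoid[OF mg(1)]] IH)
  also have "\<dots> = th (g ^^ Suc n)"
    unfolding e th_comp[OF IH(1) Suc.prems] by (rule mg(3)[OF th_carrier[OF IH(1)] th_carrier[OF Suc.prems]])
  finally have "th g [^]\<^bsub>miyamoto_group X\<^esub> Suc n = th (g ^^ Suc n)" .
  moreover have "g ^^ Suc n \<in> Kset"
    unfolding e by (rule Kset_comp[OF IH(1) Suc.prems])
  ultimately show ?case
    by metis
qed

lemma ord_dvd: "g \<in> Kset \<Longrightarrow> group.ord (miyamoto_group X) (th g) dvd n \<longleftrightarrow> g ^^ n = id"
proof -
  assume g: "g \<in> Kset"
  have i: "th id = \<one>\<^bsub>miyamoto_group X\<^esub>"
    by (simp add: mg(4) fun_eq_iff th_id)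
  have "group.ord (miyamoto_group X) (th g) dvd n \<longleftrightarrow> th (g ^^ n) = th id"
    using group.pow_eq_id[OF mg(1) th_carrier[OF g], of n] th_pow[OF g, of n] i by simp
  also have "\<dots> \<longleftrightarrow> g ^^ n = id"
    using th_pow[OF g, of n] id_Kset by (intro th_eq_iff) auto
  finally show ?thesis .
qed

lemma ord_eq_2_iff: "g \<in> Kset \<Longrightarrow> group.ord (miyamoto_group X) (th g) = 2 \<longleftrightarrow> invol g"
  using ord_dvd[of g 2] ord_dvd[of g 1] dvd_small(1)[of "group.ord (miyamoto_group X) (th g)"]
  by (auto simp: funpow_small invol_def)

definition axf :: "(pt \<Rightarrow> pt) \<Rightarrow> 'v" where
  "axf t = (THE y. y \<in> X \<and> miyamoto y = th t)"

lemma axf_ex1: "invol t \<Longrightarrow> \<exists>!y. y \<in> X \<and> miyamoto y = th t"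
proof -
  assume t: "invol t"
  then have "th t \<in> {g \<in> carrier (miyamoto_group X). group.ord (miyamoto_group X) g = 2}"
    using ord_eq_2_iff[of t] th_carrier[of t] by (simp add: invol_def)
  then show ?thesis
    using bij_betwE[OF miyamoto_bij] bij_betw_imp_inj_on[OF miyamoto_bij] bij_betw_imp_surj_on[OF miyamoto_bij]
    unfolding inj_on_def by (metis (no_types, lifting) imageE)
qed

lemma axf_X: "invol t \<Longrightarrow> axf t \<in> X" and miyamoto_axf: "invol t \<Longrightarrow> miyamoto (axf t) = th t"
  using theI'[OF axf_ex1] unfolding axf_def by blast+

lemma axf_eqI: "y \<in> X \<Longrightarrow> miyamoto y = th t \<Longrightarrow> invol t \<Longrightarrow> y = axf t"
  using axf_ex1 axf_X miyamoto_axf by blast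

lemma axf_inj: "invol s \<Longrightarrow> invol t \<Longrightarrow> axf s = axf t \<Longrightarrow> s = t"
  using miyamoto_axf th_eq_iff unfolding invol_def by metis

lemma tau_axf: "invol t \<Longrightarrow> tau (axf t) = th t"
  using miyamoto_axf miyamoto_eq[OF axes[OF axf_X]] by metis

lemma th_axf:
  assumes "g \<in> Kset" "invol t" "invol t'" "g \<circ> t = t' \<circ> g"
  shows "th g (axf t) = axf t'"
proof (rule axf_eqI)
  show X: "th g (axf t) \<in> X"
    using axes_invariant[OF th_carrier[OF assms(1)]] axf_X[OF assms(2)] by blast
  have t: "t \<in> Kset" "t' \<in> Kset"
    using assms(2,3) by (auto simp: invol_def)
  have "tau (th g (axf t)) v = th t' v" for v
  proof -
    obtain w where v: "v = th g w"
      using bij_is_surj[OF th_bij[OF assms(1)]] by (metis surjD)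
    have "tau (th g (axf t)) (th g w) = th g (th t w)"
      by (simp add: aut_tau[OF th_aut[OF assms(1)]] tau_axf[OF assms(2)])
    also have "\<dots> = th t' (th g w)"
      using assms(4) t assms(1) by (metis th_comp_apply)
    finally show ?thesis by (simp add: v)
  qed
  then show "miyamoto (th g (axf t)) = th t'"
    by (simp add: miyamoto_eq[OF axes[OF X]] fun_eq_iff)
qed (rule assms(3))

lemma invol_conj': "invol s \<Longrightarrow> invol t \<Longrightarrow> invol (s \<circ> t \<circ> s)"
  by (rule invol_conj) (simp_all add: invol_def)

lemma tau_axf_axf: "invol s \<Longrightarrow> invol t \<Longrightarrow> tau (axf s) (axf t) = axf (s \<circ> t \<circ> s)"
proof -
  assume st: "invol s" "invol t"
  then have "s \<circ> t = s \<circ> t \<circ> s \<circ> s"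
    by (simp add: invol_def comp_assoc)
  with st show ?thesis
    unfolding tau_axf[OF st(1)] by (intro th_axf invol_conj') (simp_all add: invol_def)
qed

lemma axf_pair:
  assumes "invol s" "invol t" "s \<noteq> t"
  shows "axf s \<in> X" "axf t \<in> X" "axf s \<noteq> axf t"
    "group.ord (miyamoto_group X) (miyamoto (axf s) \<circ> miyamoto (axf t)) = group.ord (miyamoto_group X) (th (s \<circ> t))"
    "s \<circ> t \<in> Kset" "s \<circ> t \<noteq> id"
proof -
  show "axf s \<in> X" "axf t \<in> X" "axf s \<noteq> axf t"
    using assms axf_X axf_inj by blast+
  have K: "s \<in> Kset" "t \<in> Kset" "s \<circ> s = id"
    using assms by (auto simp: invol_def)
  then show "s \<circ> t \<in> Kset"
    by (simp add: Kset_comp)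
  show "group.ord (miyamoto_group X) (miyamoto (axf s) \<circ> miyamoto (axf t)) = group.ord (miyamoto_group X) (th (s \<circ> t))"
    by (simp add: miyamoto_axf assms th_comp K)
  show "s \<circ> t \<noteq> id"
  proof
    assume "s \<circ> t = id"
    then have "s \<circ> s \<circ> t = s"
      by (simp add: comp_assoc)
    with K assms(3) show False by simp
  qed
qed

lemma config_2A:
  assumes "invol s" "invol t" "s \<circ> t = r" "invol r"
  shows "form (axf s) (axf t) = 1/8" "axf s \<diamondop> axf t = (1/8) *\<^sub>Q (axf s + axf t - axf r)"
proof -
  have ne: "s \<noteq> t"
    using assms by (auto simp: invol_def)
  note p = axf_pair[OF assms(1,2) ne]
  have "group.ord (miyamoto_group X) (th (s \<circ> t)) = 2"
    using ord_eq_2_iff[OF p(5)] assms by simp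
  note sh = shape_2A[OF p(1-3), unfolded p(4), OF this]
  then show "form (axf s) (axf t) = 1/8" by blast
  obtain y where y: "y \<in> X" "miyamoto y = th r" "norton_sakuma_2A (axf s) (axf t) y"
    using sh assms th_comp[of s t] by (auto simp: miyamoto_axf invol_def)
  then have "y = axf r"
    using axf_eqI assms(4) by blast
  with y(3) show "axf s \<diamondop> axf t = (1/8) *\<^sub>Q (axf s + axf t - axf r)"
    by (simp add: norton_sakuma_2A_def)
qed

lemma form_3A:
  assumes "invol s" "invol t" "s \<noteq> t" "(s \<circ> t) \<circ> (s \<circ> t) \<circ> (s \<circ> t) = id"
  shows "form (axf s) (axf t) = 13/256"
proof -
  note p = axf_pair[OF assms(1-3)]
  have "group.ord (miyamoto_group X) (th (s \<circ> t)) = 3"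
    using ord_dvd[OF p(5), of 3] ord_dvd[OF p(5), of 1] assms(4) p(6)
    by (intro dvd_small(2)) (simp_all add: funpow_small)
  then show ?thesis
    using shape_3A[OF p(1-3), unfolded p(4)] by blast
qed

lemma config_4B:
  assumes "invol s" "invol t" "(s \<circ> t) \<circ> (s \<circ> t) = r" "invol r"
  shows "form (axf s) (axf t) = 1/64"
    "axf s \<diamondop> axf t = (1/64) *\<^sub>Q (axf s + axf t - axf (s \<circ> t \<circ> s) - axf (t \<circ> s \<circ> t) + axf r)"
proof -
  have r: "r \<noteq> id" "r \<circ> r = id"
    using assms(4) by (auto simp: invol_def)
  have ne: "s \<noteq> t"
    using assms by (auto simp: invol_def)
  note p = axf_pair[OF assms(1,2) ne]
  have "group.ord (miyamoto_group X) (th (s \<circ> t)) = 4"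
    using ord_dvd[OF p(5), of 4] ord_dvd[OF p(5), of 2] assms(3) r
    by (intro dvd_small(3)) (simp_all add: funpow_small)
  note sh = shape_4B[OF p(1-3), unfolded p(4), OF this]
  then show "form (axf s) (axf t) = 1/64" by blast
  have "th s \<circ> th t = th (s \<circ> t)" "th (s \<circ> t) \<circ> th (s \<circ> t) = th r"
    using th_comp p(5) assms by (auto simp: invol_def)
  then obtain y where y: "y \<in> X" "miyamoto y = th r" "norton_sakuma_4B (axf s) (axf t) y"
    using sh by (auto simp: miyamoto_axf assms(1,2) funpow_small)
  have yr: "y = axf r"
    using y axf_eqI assms(4) by blast
  obtain e :: "int \<Rightarrow> 'v" where e: "e 0 = axf s" "e 1 = axf t" "\<And>i. e (i + 4) = e i"
    and T: "\<And>i. e i \<diamondop> e i = e i \<and>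
          e i \<diamondop> e (i + 1) = (1/64) *\<^sub>Q (e i + e (i + 1) - e (i - 1) - e (i + 2) + axf r) \<and>
          e i \<diamondop> e (i + 2) = (1/8) *\<^sub>Q (e i + e (i + 2) - axf r) \<and>
          e i \<diamondop> axf r = (1/8) *\<^sub>Q (e i + axf r - e (i + 2))"
    using y(3) unfolding norton_sakuma_4B_def yr by metis
  note fl = flip_4B[OF e(3) T]
  \<comment> \<open>The flips at \<open>e 0\<close> and \<open>e 1\<close> turn the two further axes
    of the table into conjugates, hence into known axes of \<open>X\<close>.\<close>
  have m: "e (-1) = axf (s \<circ> t \<circ> s)"
    using fl[of 0] tau_axf_axf[OF assms(1,2)] by (simp add: e)
  have "e 2 = tau (e 1) (e 0)"
    using fl[of 1] tau_tau[OF axes[OF axf_X[OF assms(2)]], of "e 2"] by (simp add: e(2))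
  then have "e 2 = axf (t \<circ> s \<circ> t)"
    using tau_axf_axf[OF assms(2,1)] by (simp add: e)
  with m T[of 0] show "axf s \<diamondop> axf t = (1/64) *\<^sub>Q (axf s + axf t - axf (s \<circ> t \<circ> s) - axf (t \<circ> s \<circ> t) + axf r)"
    by (simp add: e)
qed

lemma config_6A:
  assumes "invol s" "invol t" "(s \<circ> t) \<circ> (s \<circ> t) \<circ> (s \<circ> t) = r" "invol r" "(s \<circ> t) \<circ> (s \<circ> t) \<noteq> id"
  obtains e :: "int \<Rightarrow> 'v" and u where "form (axf s) (axf t) = 5/256"
    "e 0 = axf s" "e 1 = axf t" "e (-1) = tau (axf s) (axf t)" "e 2 = tau (axf t) (axf s)"
    "e 3 = tau (e 2) (e 1)" "e (-2) = tau (e (-1)) (e 0)" "e (-3) = e 3" "e 4 = e (-2)" "e 5 = e (-1)"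
    "axf r \<diamondop> u = 0" "u \<diamondop> u = u"
    "\<And>i. e i \<diamondop> e (i + 1) =
            (1/64) *\<^sub>Q (e i + e (i + 1) - e (i - 2) - e (i - 1) - e (i + 2) - e (i + 3) + axf r)
            + (45/2048) *\<^sub>Q u"
    "\<And>i. e i \<diamondop> e (i + 2) = (1/32) *\<^sub>Q (2 *\<^sub>Q e i + 2 *\<^sub>Q e (i + 2) + e (i - 2)) - (135/2048) *\<^sub>Q u"
    "\<And>i. e i \<diamondop> u = (1/9) *\<^sub>Q (2 *\<^sub>Q e i - e (i + 2) - e (i - 2)) + (5/32) *\<^sub>Q u"
proof -
  have r: "r \<noteq> id" "r \<circ> r = id"
    using assms(4) by (auto simp: invol_def)
  have ne: "s \<noteq> t"
    using assms by (auto simp: invol_def)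
  note p = axf_pair[OF assms(1,2) ne]
  have "group.ord (miyamoto_group X) (th (s \<circ> t)) = 6"
    using ord_dvd[OF p(5), of 6] ord_dvd[OF p(5), of 2] ord_dvd[OF p(5), of 3] assms(3,5) r
    by (intro dvd_small(4)) (simp_all add: funpow_small)
  note sh = shape_6A[OF p(1-3), unfolded p(4), OF this]
  have "th s \<circ> th t = th (s \<circ> t)" "th (s \<circ> t) \<circ> th (s \<circ> t) = th ((s \<circ> t) \<circ> (s \<circ> t))"
    "th ((s \<circ> t) \<circ> (s \<circ> t)) \<circ> th (s \<circ> t) = th r"
    using th_comp[of s t] th_comp[OF p(5) p(5)] th_comp[OF Kset_comp[OF p(5) p(5)] p(5)] assms
    by (auto simp: invol_def)
  then obtain y u where y: "y \<in> X" "miyamoto y = th r" "norton_sakuma_6A (axf s) (axf t) y u"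
    using sh by (auto simp: miyamoto_axf assms(1,2) funpow_small)
  have yr: "y = axf r"
    using y axf_eqI assms(4) by blast
  obtain e :: "int \<Rightarrow> 'v" where e: "e 0 = axf s" "e 1 = axf t" "\<And>i. e (i + 6) = e i"
    and u: "axf r \<diamondop> u = 0" "u \<diamondop> u = u"
    and T: "\<And>i. e i \<diamondop> e i = e i \<and>
          e i \<diamondop> e (i + 1) =
            (1/64) *\<^sub>Q (e i + e (i + 1) - e (i - 2) - e (i - 1) - e (i + 2) - e (i + 3) + axf r)
            + (45/2048) *\<^sub>Q u \<and>
          e i \<diamondop> e (i + 2) =
            (1/32) *\<^sub>Q (2 *\<^sub>Q e i + 2 *\<^sub>Q e (i + 2) + e (i - 2)) - (135/2048) *\<^sub>Q u \<and>
          e i \<diamondop> e (i + 3) = (1/8) *\<^sub>Q (e i + e (i + 3) - axf r) \<and>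
          e i \<diamondop> axf r = (1/8) *\<^sub>Q (e i + axf r - e (i + 3)) \<and>
          e i \<diamondop> u = (1/9) *\<^sub>Q (2 *\<^sub>Q e i - e (i + 2) - e (i - 2)) + (5/32) *\<^sub>Q u"
    using y(3) unfolding norton_sakuma_6A_def yr by metis
  note fl = flip_6A[OF e(3) T]
  have m: "e (-1) = tau (axf s) (axf t)"
    using fl[of 0] by (simp add: e)
  have e2: "e 2 = tau (axf t) (axf s)"
    using fl[of 1] tau_tau[OF axes[OF axf_X[OF assms(2)]], of "e 2"] by (simp add: e)
  have i2: "e 2 = axf (t \<circ> s \<circ> t)" "invol (t \<circ> s \<circ> t)"
    using e2 tau_axf_axf[OF assms(2,1)] invol_conj'[OF assms(2,1)] by auto
  have e3: "e 3 = tau (e 2) (e 1)"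
    using fl[of 2] tau_tau[OF axes[OF axf_X[OF i2(2)]], of "e 3"] by (simp add: i2)
  have em2: "e (-2) = tau (e (-1)) (e 0)"
    using fl[of "-1"] by simp
  show thesis
  proof (rule that[of e u])
    show "form (axf s) (axf t) = 5/256"
      using sh by blast
    show "e (-3) = e 3" "e 4 = e (-2)" "e 5 = e (-1)"
      using e(3)[of "-3"] e(3)[of "-2"] e(3)[of "-1"] by simp_all
  qed (use e m e2 e3 em2 u T in blast)+
qed

end

section \<open>The axes of the subgroup form the configuration\<close>

lemma rho_third: "lam k p \<noteq> c \<Longrightarrow> rho k (- c - lam k p) p = - p - rho k c p"
proof -
  have "\<forall>c x y. lam k (x, y) \<noteq> c \<longrightarrow> rho k (- c - lam k (x, y)) (x, y) = - (x, y) - rho k c (x, y)"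
    by (cases k) (simp_all add: all_f3)
  moreover assume "lam k p \<noteq> c"
  ultimately show ?thesis
    by (cases p) blast
qed

context h_config
begin

definition aa :: "pt \<Rightarrow> 'v" where
  "aa p = axf (sig p)"

definition bb :: "dir \<Rightarrow> f3 \<Rightarrow> 'v" where
  "bb k c = axf (rho k c)"

text \<open>The 3A-axis, solved for in the product of two of the axes of a 3A-algebra.\<close>

definition uu :: "dir \<Rightarrow> 'v" where
  "uu k = (2048/135) *\<^sub>Q ((1/32) *\<^sub>Q (2 *\<^sub>Q bb k N0 + 2 *\<^sub>Q bb k N1 + bb k N2) - bb k N0 \<diamondop> bb k N1)"

lemma tau_ab: "tau (aa p) (bb k c) = bb k (- c - lam k p)"
  unfolding aa_def bb_def tau_axf_axf[OF invol_sig invol_rho] sig_rho_sig by (rule refl)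

lemma tau_ba: "tau (bb k c) (aa p) = aa (rho k c p)"
  unfolding aa_def bb_def tau_axf_axf[OF invol_rho invol_sig] rho_sig_rho by (rule refl)

text \<open>The six axes of the 6A-algebra are alternately the three points of the line through
  \<open>p\<close> along \<open>nrm k\<close> and the three lines of class \<open>k\<close>. Reading
  its table gives all products at once and shows that its 3A-axis depends only on
  \<open>k\<close>.\<close>

lemma hexagon:
  assumes ne: "lam k p \<noteq> c" and q: "rho k c p = q" "- p - q = q'"
  shows "form (aa p) (bb k c) = 5/256"
    and "aa p \<diamondop> bb k c = (1/64) *\<^sub>Q (aa p + bb k c - aa q' - bb k (- c - lam k p) - aa q - bb k (lam k p)
        + bb (perp k) (lam (perp k) p)) + (45/2048) *\<^sub>Q uu k"
    and "aa p \<diamondop> aa q = (1/32) *\<^sub>Q (2 *\<^sub>Q aa p + 2 *\<^sub>Q aa q + aa q') - (135/2048) *\<^sub>Q uu k"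
    and "bb k c \<diamondop> bb k (lam k p) =
      (1/32) *\<^sub>Q (2 *\<^sub>Q bb k c + 2 *\<^sub>Q bb k (lam k p) + bb k (- c - lam k p)) - (135/2048) *\<^sub>Q uu k"
    and "aa p \<diamondop> uu k = (1/9) *\<^sub>Q (2 *\<^sub>Q aa p - aa q - aa q') + (5/32) *\<^sub>Q uu k"
    and "bb k c \<diamondop> uu k = (1/9) *\<^sub>Q (2 *\<^sub>Q bb k c - bb k (lam k p) - bb k (- c - lam k p)) + (5/32) *\<^sub>Q uu k"
    and "bb (perp k) (lam (perp k) p) \<diamondop> uu k = 0"
    and "uu k \<diamondop> uu k = uu k"
proof -
  obtain e :: "int \<Rightarrow> 'v" and u where
    F: "form (axf (sig p)) (axf (rho k c)) = 5/256"
    and e: "e 0 = axf (sig p)" "e 1 = axf (rho k c)" "e (-1) = tau (axf (sig p)) (axf (rho k c))"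
      "e 2 = tau (axf (rho k c)) (axf (sig p))" "e 3 = tau (e 2) (e 1)" "e (-2) = tau (e (-1)) (e 0)"
    and per: "e (-3) = e 3" "e 4 = e (-2)" "e 5 = e (-1)"
    and u: "axf (rho (perp k) (lam (perp k) p)) \<diamondop> u = 0" "u \<diamondop> u = u"
    and T1: "\<And>i. e i \<diamondop> e (i + 1) =
            (1/64) *\<^sub>Q (e i + e (i + 1) - e (i - 2) - e (i - 1) - e (i + 2) - e (i + 3)
              + axf (rho (perp k) (lam (perp k) p))) + (45/2048) *\<^sub>Q u"
    and T2: "\<And>i. e i \<diamondop> e (i + 2) = (1/32) *\<^sub>Q (2 *\<^sub>Q e i + 2 *\<^sub>Q e (i + 2) + e (i - 2)) - (135/2048) *\<^sub>Q u"
    and Tu: "\<And>i. e i \<diamondop> u = (1/9) *\<^sub>Q (2 *\<^sub>Q e i - e (i + 2) - e (i - 2)) + (5/32) *\<^sub>Q u"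
    by (rule config_6A[OF invol_sig invol_rho sig_rho_cube(1)[OF ne] invol_rho sig_rho_cube(2)[OF ne]], rule that)
  have e': "e 0 = aa p" "e 1 = bb k c" "e (-1) = bb k (- c - lam k p)" "e 2 = aa q"
    using e tau_ab tau_ba q unfolding aa_def bb_def by simp_all
  have "- c - (- c - lam k p) = lam k p"
    by simp
  then have e3: "e 3 = bb k (lam k p)"
    unfolding e(5) e' tau_ab q(1)[symmetric] lam_rho by simp
  have e4: "e (-2) = aa q'"
    unfolding e(6) e' tau_ba rho_third[OF ne] q ..
  note ev = e' e3 e4 per
  have B: "bb k c \<diamondop> bb k (lam k p) =
      (1/32) *\<^sub>Q (2 *\<^sub>Q bb k c + 2 *\<^sub>Q bb k (lam k p) + bb k (- c - lam k p)) - (135/2048) *\<^sub>Q u"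
    "bb k (lam k p) \<diamondop> bb k (- c - lam k p) =
      (1/32) *\<^sub>Q (2 *\<^sub>Q bb k (lam k p) + 2 *\<^sub>Q bb k (- c - lam k p) + bb k c) - (135/2048) *\<^sub>Q u"
    "bb k (- c - lam k p) \<diamondop> bb k c =
      (1/32) *\<^sub>Q (2 *\<^sub>Q bb k (- c - lam k p) + 2 *\<^sub>Q bb k c + bb k (lam k p)) - (135/2048) *\<^sub>Q u"
    using T2[of 1] T2[of 3] T2[of "-1"] by (simp_all add: ev)
  \<comment> \<open>The labels \<open>c\<close>, \<open>lam k p\<close> and
    \<open>- c - lam k p\<close> are the three field elements in some order, and the three products
    have the same shape with the same \<open>u\<close>. So the product that defines
    \<open>uu k\<close> is one of them up to commutation, which yields
    \<open>u = uu k\<close>.\<close>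
  define P where "P x y z = (1/32) *\<^sub>Q (2 *\<^sub>Q bb k x + 2 *\<^sub>Q bb k y + bb k z) - (135/2048) *\<^sub>Q u" for x y z
  have sym: "P x y z = P y x z" for x y z
    by (simp only: P_def add.commute)
  have pick: "bb k N0 \<diamondop> bb k N1 = P N0 N1 N2"
    if "bb k x \<diamondop> bb k y = P x y z" "bb k y \<diamondop> bb k z = P y z x" "bb k z \<diamondop> bb k x = P z x y"
      and "(x, y, z) \<in> {(N0, N1, N2), (N1, N2, N0), (N2, N0, N1), (N1, N0, N2), (N0, N2, N1), (N2, N1, N0)}" for x y z
    using that by (elim insertE emptyE Pair_inject; metis mul_commute sym)
  have "bb k N0 \<diamondop> bb k N1 = P N0 N1 N2"
    by (rule pick[OF B[folded P_def]]) (use ne in \<open>cases c; cases "lam k p"; simp\<close>)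
  then have uk: "u = uu k"
    by (simp add: uu_def P_def)
  show "form (aa p) (bb k c) = 5/256"
    using F by (simp add: aa_def bb_def)
  show "aa p \<diamondop> bb k c = (1/64) *\<^sub>Q (aa p + bb k c - aa q' - bb k (- c - lam k p) - aa q - bb k (lam k p)
        + bb (perp k) (lam (perp k) p)) + (45/2048) *\<^sub>Q uu k"
    using T1[of 0] by (simp add: ev uk flip: bb_def)
  show "aa p \<diamondop> aa q = (1/32) *\<^sub>Q (2 *\<^sub>Q aa p + 2 *\<^sub>Q aa q + aa q') - (135/2048) *\<^sub>Q uu k"
    using T2[of 0] by (simp add: ev uk)
  show "bb k c \<diamondop> bb k (lam k p) =
      (1/32) *\<^sub>Q (2 *\<^sub>Q bb k c + 2 *\<^sub>Q bb k (lam k p) + bb k (- c - lam k p)) - (135/2048) *\<^sub>Q uu k"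
    using B(1) by (simp add: uk)
  show "aa p \<diamondop> uu k = (1/9) *\<^sub>Q (2 *\<^sub>Q aa p - aa q - aa q') + (5/32) *\<^sub>Q uu k"
    using Tu[of 0] by (simp add: ev uk)
  show "bb k c \<diamondop> uu k = (1/9) *\<^sub>Q (2 *\<^sub>Q bb k c - bb k (lam k p) - bb k (- c - lam k p)) + (5/32) *\<^sub>Q uu k"
    using Tu[of 1] by (simp add: ev uk)
  show "bb (perp k) (lam (perp k) p) \<diamondop> uu k = 0" "uu k \<diamondop> uu k = uu k"
    using u by (simp_all add: uk bb_def)
qed

lemma c_axis_a: "primitive_axis (aa p)" and c_axis_b: "primitive_axis (bb k c)"
  by (simp_all add: aa_def bb_def axes axf_X invol_sig invol_rho)

lemma c_form_axis_a: "form (aa p) (aa p) = 1" and c_form_axis_b: "form (bb k c) (bb k c) = 1"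
  by (simp_all add: aa_def bb_def form_axis axf_X invol_sig invol_rho)

lemma sig_sig_cube: "(sig p \<circ> sig q) \<circ> (sig p \<circ> sig q) \<circ> (sig p \<circ> sig q) = id"
proof -
  have 3: "y + y + y = 0" for y :: pt
    by (cases y; cases "fst y"; cases "snd y") (simp_all add: zero_prod_def)
  then have "v + y + y + y = v" for v y :: pt
    by (metis add.assoc add.right_neutral)
  then show ?thesis
    by (simp add: sig_sig fun_eq_iff)
qed

lemma c_form_aa: "p \<noteq> q \<Longrightarrow> form (aa p) (aa q) = 13/256"
  unfolding aa_def by (rule form_3A[OF invol_sig invol_sig _ sig_sig_cube]) (use sig_inj in blast)

lemma c_form_bb_par: "c \<noteq> d \<Longrightarrow> form (bb k c) (bb k d) = 13/256"
  unfolding bb_def by (rule form_3A[OF invol_rho invol_rho _ rho_par_cube]) (use rho_inj in blast)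

lemma c_form_ab_in: "form (aa p) (bb k (lam k p)) = 1/8"
  and c_mul_ab_in: "aa p \<diamondop> bb k (lam k p) = (1/8) *\<^sub>Q (aa p + bb k (lam k p) - bb (perp k) (lam (perp k) p))"
  unfolding aa_def bb_def by (rule config_2A[OF invol_sig invol_rho sig_rho_in invol_rho])+

lemma c_mul_bb_perp: "bb k (lam k p) \<diamondop> bb (perp k) (lam (perp k) p) =
    (1/8) *\<^sub>Q (bb k (lam k p) + bb (perp k) (lam (perp k) p) - aa p)"
  unfolding aa_def bb_def by (rule config_2A[OF invol_rho invol_rho rho_rho_perp invol_sig])

lemma c_form_bb_perp: "form (bb k c) (bb (perp k) d) = 1/8"
proof -
  obtain p where p: "lam k p = c" "lam (perp k) p = d"
    using exists_lam2[of "perp k" k c d] by auto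
  show ?thesis
    unfolding bb_def by (rule config_2A[OF invol_rho invol_rho rho_rho_perp[of k p, unfolded p] invol_sig])
qed

lemma c_mul_bb_skew:
  assumes "j \<noteq> k" "j \<noteq> perp k"
  shows "bb k (lam k p) \<diamondop> bb j (lam j p) = (1/64) *\<^sub>Q (bb k (lam k p) + bb j (lam j p)
      - bb (perp k) (lam (perp k) p) - bb (perp j) (lam (perp j) p) + aa p)"
proof -
  have "k \<noteq> j" "k \<noteq> perp j"
    using assms by auto
  then have 2: "rho j (lam j p) \<circ> rho k (lam k p) \<circ> rho j (lam j p) = rho (perp k) (lam (perp k) p)"
    by (rule rho_skew_square(2))
  have perm: "x + y - r - t + z = x + y - t - r + (z :: 'v)" for x y r t z
    by (simp add: algebra_simps)
  show ?thesis
    unfolding aa_def bb_def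
    using config_4B(2)[OF invol_rho invol_rho rho_skew_square(1)[OF assms, of p] invol_sig]
    unfolding 2 rho_skew_square(2)[OF assms] by (simp only: perm[of _ _ "axf (rho (perp j) _)"])
qed

lemma c_form_bb_skew:
  assumes "j \<noteq> k" "j \<noteq> perp k"
  shows "form (bb k c) (bb j d) = 1/64"
proof -
  obtain p where p: "lam k p = c" "lam j p = d"
    using exists_lam2[of j k c d] assms by auto
  show ?thesis
    unfolding bb_def by (rule config_4B(1)[OF invol_rho invol_rho rho_skew_square(1)[OF assms, of p, unfolded p] invol_sig])
qed

lemmas c_form_ab_out = hexagon(1)[OF _ refl refl]

lemma f3_succ_neq: "c + 1 \<noteq> c" "lam k p \<noteq> lam k p + 1"
  for c :: f3
  by (cases c; simp) (cases "lam k p"; simp)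

lemma sixteenth: "(1/32) *\<^sub>Q (2 *\<^sub>Q x + 2 *\<^sub>Q y + z) = (1/16) *\<^sub>Q (x + y) + (1/32) *\<^sub>Q z"
  by (simp add: scale_right_distrib)

lemma c_mul_aa:
  assumes "p \<noteq> q" "lam (perp k) p = lam (perp k) q"
  shows "aa p \<diamondop> aa q = (1/16) *\<^sub>Q (aa p + aa q) + (1/32) *\<^sub>Q aa (- p - q) - (135/2048) *\<^sub>Q uu k"
proof -
  \<comment> \<open>Any two points lie in a hexagon, namely that of a line reflection exchanging
    them.\<close>
  note s = rho_swap[OF assms]
  show ?thesis
    using hexagon(3)[OF s[THEN conjunct1] s[THEN conjunct2] refl] unfolding sixteenth .
qed

lemma c_mul_ab_out:
  assumes "lam k p \<noteq> c"
  shows "aa p \<diamondop> bb k c = (1/64) *\<^sub>Q (aa p + bb k c - aa (p + nrm k) - aa (p - nrm k) - bb k (lam k p)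
        - bb k (- c - lam k p) + bb (perp k) (lam (perp k) p)) + (45/2048) *\<^sub>Q uu k"
proof -
  have perm: "x + y - r - s - t - w + z = x + y - t - r - w - s + (z :: 'v)"
    "x + y - r - s - t - w + z = x + y - r - t - w - s + (z :: 'v)" for x y r s t w z
    by (simp_all add: algebra_simps)
  from rho_line_points[OF assms] show ?thesis
  proof (elim disjE conjE)
    assume "rho k c p = p + nrm k" "- p - (p + nrm k) = p - nrm k"
    from hexagon(2)[OF assms this] show ?thesis
      unfolding perm(1)[of "aa p"] .
  next
    assume "rho k c p = p - nrm k" "- p - (p - nrm k) = p + nrm k"
    from hexagon(2)[OF assms this] show ?thesis
      unfolding perm(2)[of "aa p" "bb k c" _ "bb k (- c - lam k p)"] .
  qed
qed

lemma c_mul_au: "aa p \<diamondop> uu k = (1/9) *\<^sub>Q (2 *\<^sub>Q aa p - aa (p + nrm k) - aa (p - nrm k)) + (5/32) *\<^sub>Q uu k"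
proof -
  have perm: "x - y - z = x - z - (y :: 'v)" for x y z
    by (simp add: algebra_simps)
  from rho_line_points[OF f3_succ_neq(2)[of k p]] show ?thesis
  proof (elim disjE conjE)
    assume "rho k (lam k p + 1) p = p + nrm k" "- p - (p + nrm k) = p - nrm k"
    from hexagon(5)[OF f3_succ_neq(2) this] show ?thesis .
  next
    assume "rho k (lam k p + 1) p = p - nrm k" "- p - (p - nrm k) = p + nrm k"
    from hexagon(5)[OF f3_succ_neq(2) this] show ?thesis
      unfolding perm[of _ "aa (p - nrm k)"] .
  qed
qed

lemma c_mul_bb_par:
  assumes "c \<noteq> d"
  shows "bb k c \<diamondop> bb k d = (1/16) *\<^sub>Q (bb k c + bb k d) + (1/32) *\<^sub>Q bb k (- c - d) - (135/2048) *\<^sub>Q uu k"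
proof -
  obtain p where p: "lam k p = d"
    using exists_lam by blast
  with assms have "lam k p \<noteq> c" by simp
  from hexagon(4)[OF this refl refl] show ?thesis
    unfolding sixteenth p .
qed

lemma c_mul_bu: "bb k c \<diamondop> uu k = (1/9) *\<^sub>Q (2 *\<^sub>Q bb k c - bb k (c + 1) - bb k (c - 1)) + (5/32) *\<^sub>Q uu k"
proof -
  obtain p where p: "lam k p = c + 1"
    using exists_lam by blast
  have "- c - (c + 1) = c - 1"
    by (cases c) simp_all
  moreover have "lam k p \<noteq> c"
    using p f3_succ_neq(1) by metis
  ultimately show ?thesis
    using hexagon(6)[of k p c, OF _ refl refl] unfolding p by simp
qed

lemma c_mul_bu_perp: "bb (perp k) c \<diamondop> uu k = 0"
  using exists_lam[of "perp k" c] hexagon(7)[OF f3_succ_neq(2) refl refl] by metis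

lemma c_mul_uu: "uu k \<diamondop> uu k = uu k"
  by (rule hexagon(8)[OF f3_succ_neq(2)[of k 0] refl refl])

lemma th_aa: "g \<in> Kset \<Longrightarrow> th g (aa p) = aa (g p)"
  unfolding aa_def by (rule th_axf[OF _ invol_sig invol_sig sig_conj])

lemma th_bb: "g \<in> Kset \<Longrightarrow> g \<circ> rho k c = rho j d \<circ> g \<Longrightarrow> th g (bb k c) = bb j d"
  unfolding bb_def by (rule th_axf[OF _ invol_rho invol_rho])

lemma th_rho_minus: "th (rho k c) x = - x \<Longrightarrow> bb k c \<diamondop> x = (1/32) *\<^sub>Q x"
  using tau_minus_odd[OF c_axis_b, of k c x] tau_axf[OF invol_rho] by (simp add: bb_def)

sublocale m9: m9_config scale mul form aa bb uu th
  by (rule m9_config.intro, rule comm_algebra_axioms, rule m9_config_axioms.intro,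
    rule form_sym, rule form_add_left, rule form_scale_left, rule form_pos_def, assumption, rule
    form_frobenius, rule c_axis_a, rule c_axis_b, rule c_form_axis_a, rule c_form_axis_b, rule
    c_form_aa, assumption, rule c_form_ab_in, rule c_form_ab_out, assumption, rule c_form_bb_par,
    assumption, rule c_form_bb_perp, rule c_form_bb_skew, assumption, assumption, rule c_mul_aa,
    assumption, assumption, rule c_mul_ab_in, rule c_mul_ab_out, assumption, rule c_mul_bb_par,
    assumption, rule c_mul_bb_perp, rule c_mul_bb_skew, assumption, assumption, rule c_mul_au, rule
    c_mul_bu, rule c_mul_bu_perp, rule c_mul_uu, rule th_add, assumption, rule th_scale, assumption,
    rule th_mul, assumption, rule th_comp_apply, assumption, assumption, rule th_id, rule
    th_inj_fun, assumption, rule th_aa, assumption, rule th_bb, assumption, assumption, rule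
    th_rho_minus, assumption)

text \<open>The involutions of the affine group are exactly the point and line reflections, so the
  axes selected by the subgroup are the 21 of the configuration.\<close>

lemma sub_axes: "{y \<in> X. miyamoto y \<in> th ` Kset} = m9.ax"
proof (rule Set.set_eqI, rule iffI)
  fix y assume y: "y \<in> {y \<in> X. miyamoto y \<in> th ` Kset}"
  then obtain g where g: "g \<in> Kset" "miyamoto y = th g" "y \<in> X"
    by blast
  then have "group.ord (miyamoto_group X) (th g) = 2"
    using bij_betwE[OF miyamoto_bij] by force
  then have i: "invol g"
    using ord_eq_2_iff[OF g(1)] by blast
  then have "y = axf g"
    using axf_eqI g by blast
  with i show "y \<in> m9.ax"
    by (cases rule: invol_cases) (auto simp flip: aa_def bb_def)
next
  fix y assume "y \<in> m9.ax"
  then consider p where "y = axf (sig p)" | k c where "y = axf (rho k c)"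
    by (auto simp: m9.ax_def aa_def bb_def)
  then show "y \<in> {y \<in> X. miyamoto y \<in> th ` Kset}"
    by cases (auto simp: axf_X miyamoto_axf invol_sig invol_rho sig_in_Kset rho_in_Kset)
qed

lemma axf_ax: "invol t \<Longrightarrow> axf t \<in> m9.ax"
  by (cases rule: invol_cases) (auto simp flip: aa_def bb_def)

lemma th_ax: "g \<in> Kset \<Longrightarrow> y \<in> m9.ax \<Longrightarrow> th g y \<in> m9.ax"
proof -
  assume g: "g \<in> Kset" and y: "y \<in> m9.ax"
  obtain g' where g': "g' \<in> Kset" "g' \<circ> g = id" "g \<circ> g' = id"
    using Kset_inverse[OF g] by blast
  obtain t where t: "y = axf t" "invol t"
    using y invol_sig invol_rho by (auto simp: m9.ax_def aa_def bb_def)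
  have i: "invol (g \<circ> t \<circ> g')"
    by (rule invol_conj[OF g g' t(2)])
  have "th g (axf t) = axf (g \<circ> t \<circ> g')"
    using g' by (intro th_axf g t i) (simp add: comp_assoc)
  with t(1) axf_ax[OF i] show ?thesis by simp
qed

lemma th_SP: "g \<in> Kset \<Longrightarrow> y \<in> m9.SP \<Longrightarrow> th g y \<in> m9.SP"
proof -
  assume g: "g \<in> Kset" and y: "y \<in> m9.SP"
  have z: "th g 0 = 0"
    using th_scale[OF g, of 0 0] by simp
  have "subalgebra {v. th g v \<in> m9.SP}"
    unfolding subalgebra_def
    using m9.SP_mul m9.SP_closed subspace_0[OF m9.subspace_SP]
    by (auto simp: z th_add[OF g] th_scale[OF g] th_mul[OF g] intro!: subspaceI)
  moreover have "m9.ax \<subseteq> {v. th g v \<in> m9.SP}"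
    using th_ax[OF g] m9.ax_SP by blast
  ultimately have "gen_subalgebra m9.ax \<subseteq> {v. th g v \<in> m9.SP}"
    unfolding gen_subalgebra_def by blast
  with y show ?thesis
    unfolding m9.gen_subalgebra_ax by blast
qed

lemma th_bij_SP: "g \<in> Kset \<Longrightarrow> bij_betw (th g) m9.SP m9.SP"
proof -
  assume g: "g \<in> Kset"
  obtain g' where g': "g' \<in> Kset" "g' \<circ> g = id" "g \<circ> g' = id"
    using Kset_inverse[OF g] by blast
  have "th g (th g' v) = v" "th g' (th g v) = v" for v
    using th_comp_apply[OF g g'(1), of v] th_comp_apply[OF g'(1) g, of v] g' by (simp_all add: th_id)
  then show ?thesis
    using th_SP[OF g] th_SP[OF g'(1)] by (intro bij_betw_byWitness[where f' = "th g'"]) auto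
qed

text \<open>Restriction is injective because the point axes already show the action on the plane,
  and surjective because every automorphism is realized by an affine map.\<close>

lemma th_restrict_iso:
  "(\<lambda>g. restrict g m9.SP) \<in> iso ((miyamoto_group X)\<lparr>carrier := th ` Kset\<rparr>) (aut_group m9.SP)"
proof (rule isoI)
  have Bij: "restrict (th g) m9.SP \<in> Bij m9.SP" if "g \<in> Kset" for g
    using th_bij_SP[OF that] by (simp add: Bij_def cong: bij_betw_cong)
  have aut: "restrict (th g) m9.SP \<in> carrier (aut_group m9.SP)" if g: "g \<in> Kset" for g
    using Bij[OF g] m9.SP_closed m9.SP_mul
    by (simp add: aut_group_def th_add[OF g] th_scale[OF g] th_mul[OF g])
  show "(\<lambda>g. restrict g m9.SP) \<in> hom ((miyamoto_group X)\<lparr>carrier := th ` Kset\<rparr>) (aut_group m9.SP)"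
  proof (rule homI)
    fix h h' assume "h \<in> carrier ((miyamoto_group X)\<lparr>carrier := th ` Kset\<rparr>)"
      "h' \<in> carrier ((miyamoto_group X)\<lparr>carrier := th ` Kset\<rparr>)"
    then obtain g g' where g: "g \<in> Kset" "h = th g" "g' \<in> Kset" "h' = th g'"
      by auto
    show "restrict h m9.SP \<in> carrier (aut_group m9.SP)"
      using aut g by simp
    have "restrict (h \<circ> h') m9.SP = compose m9.SP (restrict h m9.SP) (restrict h' m9.SP)"
      using th_SP[OF g(3)] g(4) by (auto simp: compose_def restrict_def fun_eq_iff)
    then show "restrict (h \<otimes>\<^bsub>(miyamoto_group X)\<lparr>carrier := th ` Kset\<rparr>\<^esub> h') m9.SP =
        restrict h m9.SP \<otimes>\<^bsub>aut_group m9.SP\<^esub> restrict h' m9.SP"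
      using mg(3)[OF th_carrier[OF g(1)] th_carrier[OF g(3)]] Bij[OF g(1)] Bij[OF g(3)]
      by (simp add: aut_group_def BijGroup_def g)
  qed
  show "bij_betw (\<lambda>g. restrict g m9.SP) (carrier ((miyamoto_group X)\<lparr>carrier := th ` Kset\<rparr>)) (carrier (aut_group m9.SP))"
  proof (rule bij_betw_imageI)
    show "inj_on (\<lambda>g. restrict g m9.SP) (carrier ((miyamoto_group X)\<lparr>carrier := th ` Kset\<rparr>))"
    proof (rule inj_onI)
      fix h h' assume "h \<in> carrier ((miyamoto_group X)\<lparr>carrier := th ` Kset\<rparr>)"
        "h' \<in> carrier ((miyamoto_group X)\<lparr>carrier := th ` Kset\<rparr>)"
        and eq: "restrict h m9.SP = restrict h' m9.SP"
      then obtain g g' where g: "g \<in> Kset" "h = th g" "g' \<in> Kset" "h' = th g'"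
        by auto
      have "g p = g' p" for p
      proof -
        have "aa (g p) = aa (g' p)"
          using fun_cong[OF eq, of "aa p"] g th_aa by simp
        then show ?thesis
          using axf_inj[OF invol_sig invol_sig] sig_inj unfolding aa_def by metis
      qed
      then have "g = g'"
        by (rule ext)
      with g show "h = h'" by simp
    qed
    show "(\<lambda>g. restrict g m9.SP) ` carrier ((miyamoto_group X)\<lparr>carrier := th ` Kset\<rparr>) = carrier (aut_group m9.SP)"
    proof (rule antisym)
      show "(\<lambda>g. restrict g m9.SP) ` carrier ((miyamoto_group X)\<lparr>carrier := th ` Kset\<rparr>) \<subseteq> carrier (aut_group m9.SP)"
        using aut by auto
      show "carrier (aut_group m9.SP) \<subseteq> (\<lambda>g. restrict g m9.SP) ` carrier ((miyamoto_group X)\<lparr>carrier := th ` Kset\<rparr>)"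
      proof
        fix h assume h: "h \<in> carrier (aut_group m9.SP)"
        then have "m9.saut h"
          by (simp add: m9.saut_def aut_group_def Bij_def)
        then obtain g where g: "g \<in> Kset" "\<forall>y\<in>m9.SP. h y = th g y"
          using m9.saut_realized unfolding m9.realized_def by blast
        moreover have "h \<in> extensional m9.SP"
          using h by (simp add: aut_group_def Bij_def)
        ultimately have "h = restrict (th g) m9.SP"
          by (auto simp: fun_eq_iff extensional_def restrict_def)
        with g(1) show "h \<in> (\<lambda>g. restrict g m9.SP) ` carrier ((miyamoto_group X)\<lparr>carrier := th ` Kset\<rparr>)"
          by auto
      qed
    qed
  qed
qed

end

theorem mainTheorem5:
  fixes scale :: "rat \<Rightarrow> 'v::ab_group_add \<Rightarrow> 'v"
    and mul :: "'v \<Rightarrow> 'v \<Rightarrow> 'v"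
    and form :: "'v \<Rightarrow> 'v \<Rightarrow> rat"
    and X :: "'v set"
    and M :: "('v \<Rightarrow> 'v) monoid"
    and H :: "('v \<Rightarrow> 'v) set"
    and A24 :: "'v set"
  assumes "seress_algebra_286 scale mul form X"
    and "M = comm_algebra.miyamoto_group scale mul X"
    and "maximal_subgroup H M"
    and "M\<lparr>carrier := H\<rparr> \<cong> U3_2_ext2"
    and "A24 = comm_algebra.gen_subalgebra scale mul
               {a \<in> X. comm_algebra.miyamoto scale mul a \<in> H}"
  shows "vector_space.dim scale A24 = 24 \<and>
    (\<lambda>g. restrict g A24) \<in> iso (M\<lparr>carrier := H\<rparr>) (comm_algebra.aut_group scale mul A24) \<and>
    comm_algebra.aut_group scale mul A24 \<cong> U3_2_ext2"
proof -
  interpret S: seress_algebra_286 scale mul form X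
    by (rule assms(1))
  note M = assms(2)
  have gM: "group M"
    unfolding M by (rule S.miyamoto_group_group(1)) (rule S.axes)
  have H: "subgroup H M"
    using assms(3) by (simp add: maximal_subgroup_def)
  have gH: "group (M\<lparr>carrier := H\<rparr>)"
    by (rule subgroup.subgroup_is_group[OF H gM])
  \<comment> \<open>The abstract isomorphism of \<open>H\<close> with the unitary group becomes a
    concrete action of the affine group on the algebra.\<close>
  have "Kgrp \<cong> M\<lparr>carrier := H\<rparr>"
    by (rule group.iso_sym[OF gH iso_trans[OF assms(4) U3_2_ext2_iso]])
  then obtain th where th: "th \<in> iso Kgrp (M\<lparr>carrier := H\<rparr>)"
    unfolding is_iso_def by blast
  then have bij: "bij_betw th Kset H" and hom: "th \<in> hom Kgrp (M\<lparr>carrier := H\<rparr>)"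
    by (auto simp: iso_def Kgrp_def)
  have thH: "th ` Kset = H"
    by (rule bij_betw_imp_surj_on[OF bij])
  have carr: "th g \<in> carrier M" if "g \<in> Kset" for g
    using that thH subgroup.subset[OF H] by blast
  interpret h: h_config scale mul form X th
  proof (unfold_locales)
    show "th g \<in> carrier (S.miyamoto_group X)" if "g \<in> Kset" for g
      using carr[OF that] unfolding M .
    show "th (g \<circ> g') = th g \<circ> th g'" if "g \<in> Kset" "g' \<in> Kset" for g g'
    proof -
      have "th (g \<circ> g') = th g \<otimes>\<^bsub>M\<^esub> th g'"
        using hom_mult[OF hom, of g g'] that by (simp add: Kgrp_def)
      also have "\<dots> = th g \<circ> th g'"
        using carr[OF that(1)] carr[OF that(2)] unfolding M
        by (rule S.miyamoto_group_group(3)[rotated]) (rule S.axes)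
      finally show ?thesis .
    qed
    show "inj_on th Kset"
      by (rule bij_betw_imp_inj_on[OF bij])
  qed
  have A: "A24 = h.m9.SP"
    unfolding assms(5) thH[symmetric] h.sub_axes by (rule h.m9.gen_subalgebra_ax)
  have iso: "(\<lambda>g. restrict g A24) \<in> iso (M\<lparr>carrier := H\<rparr>) (S.aut_group A24)"
    using h.th_restrict_iso unfolding thH A M .
  have "S.dim A24 = 24"
    unfolding A by (rule h.m9.dim_SP)
  moreover have "S.aut_group A24 \<cong> U3_2_ext2"
    by (rule iso_trans[OF group.iso_sym[OF gH is_isoI[OF iso]] assms(4)])
  ultimately show ?thesis
    using iso by blast
qed

end
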